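(* There is an absolute constant $C>0$ such that the following holds. Let $d\ge1$, let $D\in\{2d,2d+1\}$, and let $\Sigma\subset\mathbb R^{D+1}$ be the cone of coefficient vectors, in the basis $\mathbf q=(q_0,\dots,q_D)$ of Chebyshev polynomials of the first kind, of univariate polynomials of degree at most $D$ nonnegative on $[-1,1]$ (represented as weighted sums of squares as in the context). Let $\mathbf t\in\Sigma^\circ$ have integer components of bit size at most $\tau$. Then there exists an integer dual certificate $\overline{\mathbf y}\in(\Sigma^* )^\circ\cap\mathbb Z^{D+1}$ of $\mathbf t$ with $$\log(\|\overline{\mathbf y}\|_\infty)\le C\,(d\tau+d^2).$$
   Context: $\mathcal V_k$ denotes univariate real polynomials of degree at most $k$; $\Sigma_{2k}$ the sums of squares of elements of $\mathcal V_k$. If $D=2d$: weights $w_1=1$, $w_2=1-z^2$, degrees $(d_1,d_2)=(d,d-1)$; if $D=2d+1$: weights $w_1=1-z$, $w_2=1+z$, degrees $(d_1,d_2)=(d,d)$. In both cases $\Sigma=\{w_1\sigma_1+w_2\sigma_2:\sigma_i\in\Sigma_{2d_i}\}$, which is exactly the cone of polynomials in $\mathcal V_D$ nonnegative on $[-1,1]$. Polynomials in $\mathcal V_D$ are identified with coefficient vectors in the basis $\mathbf q$; put $U=D+1$. $\Sigma^*=\{\mathbf y\in\mathbb R^U:\mathbf x^{\mathrm T}\mathbf y\ge0\ \forall\mathbf x\in\Sigma\}$. Fix any ordered bases $\mathbf p_i$ of $\mathcal V_{d_i}$; $\Lambda_i$ is the unique linear map from $\mathbb R^U$ to symmetric matrices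 with $\Lambda_i(\mathbf q(z))=w_i(z)\mathbf p_i(z)\mathbf p_i(z)^{\mathrm T}$ for all $z$, and $\Lambda=\Lambda_1\oplus\Lambda_2$. Then $\Sigma^*=\{\mathbf x:\Lambda(\mathbf x)\succcurlyeq0\}$ and $(\Sigma^* )^\circ=\{\mathbf x:\Lambda(\mathbf x)\succ0\}$; $^\circ$ denotes interior. Let $f(\mathbf x)=-\ln\det\Lambda(\mathbf x)$ on $(\Sigma^* )^\circ$, with (positive definite) Hessian $H$. A vector $\mathbf x\in(\Sigma^* )^\circ$ is a dual certificate of $\mathbf s\in\Sigma$ if $H(\mathbf x)^{-1}\mathbf s\in\Sigma^*$. The bit size of an integer $y$ is $1+\lceil\log_2(|y|+1)\rceil$. *)

theory Defs
  imports
    "HOL-Analysis.Analysis"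
    "Jordan_Normal_Form.Determinant"
    "Jordan_Normal_Form.Gauss_Jordan_Elimination"
begin

unbundle no vec_syntax
no_notation inner (infixl \<open>\<bullet>\<close> 70)
hide_const (open) Module.smult Determinants.det Finite_Cartesian_Product.mat Finite_Cartesian_Product.vec
hide_type (open) Finite_Cartesian_Product.vec

section \<open>Vectors of varying dimension\<close>

text \<open>The dimension has to range over all natural numbers under an existentially quantified
  constant, so $\mathbb R^n$ is \<^term>\<open>carrier_vec n\<close>. This type carries no topology; the norm and
  the interior are therefore spelled out.\<close>

definition linf_norm :: "real vec \<Rightarrow> real" where
  "linf_norm x = Max {\<bar>x $ i\<bar> | i. i < dim_vec x}"

definition vec_interior :: "nat \<Rightarrow> real vec set \<Rightarrow> real vec set" where
  "vec_interior n S =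
     {x \<in> carrier_vec n. \<exists>\<epsilon>>0. \<forall>y\<in>carrier_vec n. linf_norm (y - x) < \<epsilon> \<longrightarrow> y \<in> S}"

definition partial :: "nat \<Rightarrow> nat \<Rightarrow> (real vec \<Rightarrow> real) \<Rightarrow> real vec \<Rightarrow> real" where
  "partial n i f x = deriv (\<lambda>h. f (x + h \<cdot>\<^sub>v unit_vec n i)) 0"

definition hessian :: "nat \<Rightarrow> (real vec \<Rightarrow> real) \<Rightarrow> real vec \<Rightarrow> real mat" where
  "hessian n f x = mat n n (\<lambda>(i, j). partial n i (partial n j f) x)"

definition bit_size :: "int \<Rightarrow> int" where
  "bit_size y = 1 + \<lceil>log 2 (\<bar>real_of_int y\<bar> + 1)\<rceil>"

section \<open>Polynomials and the Chebyshev basis\<close>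

fun cheb :: "nat \<Rightarrow> real poly" where
  "cheb 0 = 1"
| "cheb (Suc 0) = [:0, 1:]"
| "cheb (Suc (Suc n)) = [:0, 2:] * cheb (Suc n) - cheb n"

definition cheb_poly :: "real vec \<Rightarrow> real poly" where
  "cheb_poly x = (\<Sum>i<dim_vec x. smult (x $ i) (cheb i))"

text \<open>The vector $\mathbf q(z)$ of the first \<open>n\<close> basis polynomials evaluated at \<open>z\<close>.\<close>

definition cheb_vec :: "nat \<Rightarrow> real \<Rightarrow> real vec" where
  "cheb_vec n z = vec n (\<lambda>i. poly (cheb i) z)"

definition poly_space :: "nat \<Rightarrow> real poly set" where
  "poly_space k = {p. degree p \<le> k}"

definition sos :: "nat \<Rightarrow> real poly set" where
  "sos k = {(\<Sum>p\<leftarrow>ps. p ^ 2) | ps. set ps \<subseteq> poly_space k}"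

global_interpretation real_poly: vector_space "smult :: real \<Rightarrow> real poly \<Rightarrow> real poly"
  by unfold_locales (simp_all add: smult_add_right smult_add_left)

definition ordered_basis :: "nat \<Rightarrow> real poly list \<Rightarrow> bool" where
  "ordered_basis k ps \<longleftrightarrow>
     distinct ps \<and> real_poly.independent (set ps) \<and> real_poly.span (set ps) = poly_space k"

section \<open>Weighted sums of squares on the interval $[-1,1]$\<close>

text \<open>\<open>w1\<close>, \<open>w2\<close>, \<open>d1\<close>, \<open>d2\<close> depend on the degree bound \<open>D\<close>, with
  \<open>D = 2d\<close> or \<open>D = 2d + 1\<close> and \<open>d \<ge> 1\<close>.\<close>

definition w1 :: "nat \<Rightarrow> real poly" where
  "w1 D = (if even D then 1 else [:1, -1:])"

definition w2 :: "nat \<Rightarrow> real poly" where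
  "w2 D = (if even D then [:1, 0, -1:] else [:1, 1:])"

definition d1 :: "nat \<Rightarrow> nat" where
  "d1 D = D div 2"

definition d2 :: "nat \<Rightarrow> nat" where
  "d2 D = (if even D then D div 2 - 1 else D div 2)"

text \<open>By the Markov-Lukacs theorem these are exactly the coefficient vectors of the polynomials
  of degree at most \<open>D\<close> that are nonnegative on $[-1,1]$.\<close>

definition Sigma_cone :: "nat \<Rightarrow> real vec set" where
  "Sigma_cone D = {x \<in> carrier_vec (D + 1).
     \<exists>s1\<in>sos (d1 D). \<exists>s2\<in>sos (d2 D). cheb_poly x = w1 D * s1 + w2 D * s2}"

definition dual_cone :: "nat \<Rightarrow> real vec set \<Rightarrow> real vec set" where
  "dual_cone n S = {y \<in> carrier_vec n. \<forall>x\<in>S. x \<bullet> y \<ge> 0}"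

section \<open>The operators $\Lambda_i$ and $\Lambda$\<close>

definition is_Lambda ::
    "nat \<Rightarrow> real poly \<Rightarrow> real poly list \<Rightarrow> (real vec \<Rightarrow> real mat) \<Rightarrow> bool" where
  "is_Lambda n w ps L \<longleftrightarrow>
     (\<forall>x\<in>carrier_vec n. L x \<in> carrier_mat (length ps) (length ps) \<and> transpose_mat (L x) = L x) \<and>
     (\<forall>x\<in>carrier_vec n. \<forall>y\<in>carrier_vec n. L (x + y) = L x + L y) \<and>
     (\<forall>c. \<forall>x\<in>carrier_vec n. L (c \<cdot>\<^sub>v x) = c \<cdot>\<^sub>m L x) \<and>
     (\<forall>z. L (cheb_vec n z) =
        mat (length ps) (length ps) (\<lambda>(i, j). poly w z * (poly (ps ! i) z * poly (ps ! j) z)))"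

text \<open>Existence and uniqueness are \<open>is_Lambda_Lambda_op\<close> and \<open>is_Lambda_unique\<close> below;
  \<^const>\<open>extensional\<close> only fixes the value outside \<open>carrier_vec n\<close>.\<close>

definition Lambda_op :: "nat \<Rightarrow> real poly \<Rightarrow> real poly list \<Rightarrow> real vec \<Rightarrow> real mat" where
  "Lambda_op n w ps = (THE L. L \<in> extensional (carrier_vec n) \<and> is_Lambda n w ps L)"

definition Lambda :: "nat \<Rightarrow> real poly list \<Rightarrow> real poly list \<Rightarrow> real vec \<Rightarrow> real mat" where
  "Lambda D p1 p2 x =
     diag_block_mat [Lambda_op (D + 1) (w1 D) p1 x, Lambda_op (D + 1) (w2 D) p2 x]"

definition barrier :: "nat \<Rightarrow> real poly list \<Rightarrow> real poly list \<Rightarrow> real vec \<Rightarrow> real" where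
  "barrier D p1 p2 x = - ln (det (Lambda D p1 p2 x))"

definition dual_certificate ::
    "nat \<Rightarrow> real poly list \<Rightarrow> real poly list \<Rightarrow> real vec \<Rightarrow> real vec \<Rightarrow> bool" where
  "dual_certificate D p1 p2 s x \<longleftrightarrow>
     s \<in> Sigma_cone D \<and>
     x \<in> vec_interior (D + 1) (dual_cone (D + 1) (Sigma_cone D)) \<and>
     (\<exists>G. mat_inverse (hessian (D + 1) (barrier D p1 p2) x) = Some G \<and>
          G *\<^sub>v s \<in> dual_cone (D + 1) (Sigma_cone D))"

section \<open>Well-definedness of $\Lambda_i$\<close>

lemma degree_cheb [simp]: "degree (cheb n) = n"
proof (induction n rule: cheb.induct)
  case (3 n)
  have nz: "cheb (Suc n) \<noteq> 0" using 3(1) by auto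
  have "degree ([:0, 2:] * cheb (Suc n)) = Suc (Suc n)"
    using nz 3 by (subst degree_mult_eq) auto
  moreover have "degree (- cheb n) = n" using 3 by simp
  ultimately have "degree ([:0, 2:] * cheb (Suc n) + - cheb n) = Suc (Suc n)"
    by (subst degree_add_eq_left) auto
  thus ?case by simp
qed simp_all

lemma lead_coeff_cheb: "coeff (cheb n) n \<noteq> 0"
proof (cases n)
  case (Suc m)
  have "cheb n \<noteq> 0" using degree_cheb[of n] Suc by (metis degree_0 nat.distinct(1))
  thus ?thesis using degree_cheb[of n] by (metis leading_coeff_0_iff)
qed simp

lemma cheb_sum_surj:
  "degree p < n \<Longrightarrow> \<exists>a. p = (\<Sum>i<n. smult (a i) (cheb i))"
proof (induction n arbitrary: p)
  case (Suc n)
  define c where "c = coeff p n / coeff (cheb n) n"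
  define r where "r = p - smult c (cheb n)"
  have rn: "coeff r n = 0" using lead_coeff_cheb[of n] by (simp add: r_def c_def)
  have dr: "degree r \<le> n" unfolding r_def using Suc.prems by (intro degree_diff_le) auto
  have "\<exists>a. r = (\<Sum>i<n. smult (a i) (cheb i))"
  proof (cases "r = 0")
    case True
    thus ?thesis by (intro exI[of _ "\<lambda>_. 0"]) simp
  next
    case False
    hence "degree r \<noteq> n" using rn by (metis leading_coeff_0_iff)
    thus ?thesis using dr Suc.IH by simp
  qed
  then obtain a where a: "r = (\<Sum>i<n. smult (a i) (cheb i))" by blast
  have "p = (\<Sum>i<Suc n. smult ((a(n := c)) i) (cheb i))"
    using a by (simp add: r_def algebra_simps)
  thus ?case by blast
qed simp

lemma cheb_sum_inj:
  "(\<Sum>i<n. smult (a i) (cheb i)) = 0 \<Longrightarrow> i < n \<Longrightarrow> a i = 0"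
proof (induction n arbitrary: i)
  case (Suc n)
  have "coeff (\<Sum>i<n. smult (a i) (cheb i)) n = 0"
    by (simp add: coeff_sum coeff_eq_0)
  with Suc.prems(1) have "a n * coeff (cheb n) n = 0"
    by (metis (no_types, lifting) add_0 coeff_0 coeff_add coeff_smult sum.lessThan_Suc)
  hence "a n = 0" using lead_coeff_cheb by simp
  with Suc show ?case by (cases "i = n") auto
qed simp

lemma cheb_poly_surj:
  assumes "degree p < n"
  shows "\<exists>c\<in>carrier_vec n. cheb_poly c = p"
proof -
  obtain a where "p = (\<Sum>i<n. smult (a i) (cheb i))" using cheb_sum_surj[OF assms] by blast
  thus ?thesis by (intro bexI[of _ "vec n a"]) (auto simp: cheb_poly_def)
qed

lemma cheb_vec_scalar_prod:
  assumes "c \<in> carrier_vec n"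
  shows "cheb_vec n z \<bullet> c = poly (cheb_poly c) z"
  using assms
  by (auto simp: cheb_vec_def cheb_poly_def scalar_prod_def poly_sum lessThan_atLeast0 mult.commute)

lemma linear_functional_vec:
  fixes g :: "real vec \<Rightarrow> real"
  assumes add: "\<And>x y. x \<in> carrier_vec n \<Longrightarrow> y \<in> carrier_vec n \<Longrightarrow> g (x + y) = g x + g y"
    and scale: "\<And>c x. x \<in> carrier_vec n \<Longrightarrow> g (c \<cdot>\<^sub>v x) = c * g x"
    and x: "x \<in> carrier_vec n"
  shows "g x = (\<Sum>i<n. x $ i * g (unit_vec n i))"
proof -
  have "g x = (\<Sum>i<k. x $ i * g (unit_vec n i))"
    if "k \<le> n" "x \<in> carrier_vec n" "\<And>i. i < n \<Longrightarrow> i \<ge> k \<Longrightarrow> x $ i = 0" for k x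
    using that
  proof (induction k arbitrary: x)
    case 0
    hence "x = 0 \<cdot>\<^sub>v x" by (intro eq_vecI) auto
    hence "g x = 0 * g x" using scale[of x 0] 0 by metis
    thus ?case by simp
  next
    case (Suc k)
    define y where "y = vec n (\<lambda>i. if i = k then 0 else x $ i)"
    have y: "y \<in> carrier_vec n" by (simp add: y_def)
    have xy: "x = y + x $ k \<cdot>\<^sub>v unit_vec n k"
      using Suc.prems by (intro eq_vecI) (auto simp: y_def unit_vec_def)
    have "g x = g y + x $ k * g (unit_vec n k)"
      using y by (subst xy) (simp add: add scale)
    also have "g y = (\<Sum>i<k. y $ i * g (unit_vec n i))"
      using Suc.prems by (intro Suc.IH) (auto simp: y_def)
    also have "\<dots> = (\<Sum>i<k. x $ i * g (unit_vec n i))"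
      using Suc.prems by (intro sum.cong) (auto simp: y_def)
    finally show ?case by simp
  qed
  from this[of n x] x show ?thesis by simp
qed

lemma is_Lambda_unique:
  assumes L: "is_Lambda n w ps L" and L': "is_Lambda n w ps L'" and x: "x \<in> carrier_vec n"
  shows "L x = L' x"
proof (rule eq_matI)
  let ?m = "length ps"
  have car: "L y \<in> carrier_mat ?m ?m" "L' y \<in> carrier_mat ?m ?m" if "y \<in> carrier_vec n" for y
    using L L' that by (auto simp: is_Lambda_def)
  show "dim_row (L x) = dim_row (L' x)" "dim_col (L x) = dim_col (L' x)"
    using car[OF x] by auto
  fix i j assume "i < dim_row (L' x)" "j < dim_col (L' x)"
  hence ij: "i < ?m" "j < ?m" using car[OF x] by auto
  define g where "g y = L y $$ (i, j) - L' y $$ (i, j)" for y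
  have add: "g (y + z) = g y + g z" if "y \<in> carrier_vec n" "z \<in> carrier_vec n" for y z
  proof -
    have "L (y + z) = L y + L z" "L' (y + z) = L' y + L' z"
      using L L' that by (auto simp: is_Lambda_def)
    thus ?thesis using car[OF that(2)] ij by (auto simp: g_def)
  qed
  have scale: "g (c \<cdot>\<^sub>v y) = c * g y" if "y \<in> carrier_vec n" for c y
  proof -
    have "L (c \<cdot>\<^sub>v y) = c \<cdot>\<^sub>m L y" "L' (c \<cdot>\<^sub>v y) = c \<cdot>\<^sub>m L' y"
      using L L' that by (auto simp: is_Lambda_def)
    thus ?thesis using car[OF that] ij by (auto simp: g_def algebra_simps)
  qed
  have q: "g (cheb_vec n z) = 0" for z
    using L L' by (simp add: g_def is_Lambda_def)
  have lin: "g y = (\<Sum>k<n. y $ k * g (unit_vec n k))" if "y \<in> carrier_vec n" for y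
    using linear_functional_vec[of n g y] add scale that by blast
  have "poly (\<Sum>k<n. smult (g (unit_vec n k)) (cheb k)) z = 0" for z
    using q[of z] lin[of "cheb_vec n z"]
    by (simp add: cheb_vec_def poly_sum mult.commute)
  hence "(\<Sum>k<n. smult (g (unit_vec n k)) (cheb k)) = 0"
    using poly_all_0_iff_0 by blast
  hence "g (unit_vec n k) = 0" if "k < n" for k
    using cheb_sum_inj[of "\<lambda>k. g (unit_vec n k)" n k] that by blast
  hence "g x = 0" using lin[OF x] by simp
  thus "L x $$ (i, j) = L' x $$ (i, j)" by (simp add: g_def)
qed

lemma is_Lambda_exists:
  assumes deg: "\<And>p q. p \<in> set ps \<Longrightarrow> q \<in> set ps \<Longrightarrow> degree (w * (p * q)) < n"
  shows "\<exists>L. is_Lambda n w ps L"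
proof -
  let ?m = "length ps"
  obtain C where C: "C p \<in> carrier_vec n \<and> cheb_poly (C p) = p" if "degree p < n" for p
    using cheb_poly_surj[of _ n] by metis
  have Cij: "C (w * (ps ! i * ps ! j)) \<in> carrier_vec n"
    "cheb_poly (C (w * (ps ! i * ps ! j))) = w * (ps ! i * ps ! j)"
    if "i < ?m" "j < ?m" for i j
    using that C deg nth_mem by blast+
  have [simp]: "dim_vec (C (w * (ps ! i * ps ! j))) = n" if "i < ?m" "j < ?m" for i j
    using Cij(1)[OF that] by simp
  define L where "L x = mat ?m ?m (\<lambda>(i, j). x \<bullet> C (w * (ps ! i * ps ! j)))" for x :: "real vec"
  have "is_Lambda n w ps L"
    unfolding is_Lambda_def
  proof (intro conjI ballI allI)
    fix x :: "real vec"
    show "L x \<in> carrier_mat ?m ?m" by (simp add: L_def)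
    show "transpose_mat (L x) = L x"
      by (intro eq_matI) (auto simp: L_def mult.commute)
  next
    fix x y :: "real vec" assume "x \<in> carrier_vec n" "y \<in> carrier_vec n"
    thus "L (x + y) = L x + L y"
      by (intro eq_matI) (auto simp: L_def Cij intro!: add_scalar_prod_distrib[where n = n])
  next
    fix c and x :: "real vec" assume "x \<in> carrier_vec n"
    thus "L (c \<cdot>\<^sub>v x) = c \<cdot>\<^sub>m L x"
      by (intro eq_matI) (auto simp: L_def)
  next
    fix z
    show "L (cheb_vec n z) =
        mat ?m ?m (\<lambda>(i, j). poly w z * (poly (ps ! i) z * poly (ps ! j) z))"
      by (intro eq_matI) (auto simp: L_def Cij cheb_vec_scalar_prod)
  qed
  thus ?thesis by blast
qed

lemma is_Lambda_Lambda_op: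
  assumes ps: "ordered_basis k ps" and deg: "degree w + 2 * k < n"
  shows "is_Lambda n w ps (Lambda_op n w ps)"
proof -
  have dk: "degree p \<le> k" if "p \<in> set ps" for p
    using ps that real_poly.span_base[of p "set ps"] by (auto simp: ordered_basis_def poly_space_def)
  have "degree (w * (p * q)) < n" if "p \<in> set ps" "q \<in> set ps" for p q
    using dk[OF that(1)] dk[OF that(2)] deg degree_mult_le[of w "p * q"] degree_mult_le[of p q]
    by linarith
  then obtain L where L: "is_Lambda n w ps L" using is_Lambda_exists[of ps w n] by blast
  let ?L = "restrict L (carrier_vec n)"
  have rL: "is_Lambda n w ps ?L"
    using L by (auto simp: is_Lambda_def cheb_vec_def)
  have "Lambda_op n w ps = ?L"
    unfolding Lambda_op_def
  proof (rule the_equality)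
    show "?L \<in> extensional (carrier_vec n) \<and> is_Lambda n w ps ?L" using rL by simp
    fix L' assume L': "L' \<in> extensional (carrier_vec n) \<and> is_Lambda n w ps L'"
    show "L' = ?L"
      using L' is_Lambda_unique[OF _ rL]
      by (intro extensionalityI[of _ "carrier_vec n"]) auto
  qed
  thus ?thesis using rL by simp
qed

lemma Lambda_op_unique:
  assumes "ordered_basis k ps" "degree w + 2 * k < n" "is_Lambda n w ps L" "x \<in> carrier_vec n"
  shows "Lambda_op n w ps x = L x"
  using assms is_Lambda_Lambda_op is_Lambda_unique by blast

end

theory Submission
  imports Defs
    "Jordan_Normal_Form.Char_Poly"
    "HOL-Computational_Algebra.Fundamental_Theorem_Algebra"
    "HOL-Computational_Algebra.Field_as_Ring"
begin

hide_const (open) Module.smult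
unbundle no inner_syntax

text \<open>A maximizer \<open>y\<close> of \<open>det \<Lambda>\<close> over the points of the dual cone with \<open>t \<bullet> y = 1\<close> satisfies
  \<open>(D + 1) t = - \<nabla>f(y)\<close>, which makes it a dual certificate of \<open>t\<close>, and so is every point sufficiently
  close to it in the norm given by the Hessian at \<open>y\<close>. In bases \<open>g\<^sub>i\<close> that turn \<open>\<Lambda>(y)\<close> into the
  identity the gradient equation reads \<open>(D + 1) t = \<Sum> w\<^sub>i g\<^sub>i\<^sup>2\<close>. This bounds all products
  \<open>w\<^sub>i g\<^sub>i g\<^sub>j\<close> on $[-1,1]$ by a multiple of \<open>t\<close>, hence bounds the Hessian norm of a vector with
  entries at most 1/2, and \<open>N y\<close> may be rounded to an integer vector for \<open>N\<close> of order
  \<open>D\<^sup>4 2\<^sup>\<tau>\<close>. The entries of \<open>y\<close> are at most \<open>1 / min t\<close>. The minimum of \<open>t\<close> is attained at an end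
  point, where \<open>t\<close> is an integer, or it is a critical value, thus a root of the nonzero integer
  polynomial \<open>Res\<^sub>z(t - \<lambda>, t')\<close>, whose coefficients bound it away from 0.\<close>

section \<open>Chebyshev coefficients\<close>

text \<open>The Hessian in \<open>dual_certificate\<close> consists of iterated \<open>deriv\<close>
  of -ln det in arbitrary bases \<open>p1\<close>, \<open>p2\<close>. A change of basis only adds a
  constant to the barrier, so at each point the computation takes place in bases orthonormal there:
  both blocks of \<Lambda> are identities, only permutations moving at most two points contribute to
  second derivatives, and the Hessian becomes the pullback of the Frobenius inner product. Two
  points x and y are then compared through one transition matrix P. The admissible radius around the
  gradient certificate is 1 because P P^T - I and P^T P - I have the same Frobenius norm. The factor
  D + 1 is the total size of the two blocks, that is the degree of homogeneity of det \<Lambda>. The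
  maximizer is found by compactness in the product topology on
  \<open>nat \<Rightarrow> real\<close>, into which vectors are extended by zero; positivity of
  \<open>t\<close> bounds the slice on which the maximum is taken. In the final size N contributes
  only \<tau> + O(log D). The term d \<tau> + d^2 is the logarithm of the bound on 1 / min t, a
  power with exponent 2 D of a base of order D^2 2^\<tau> 3^D.\<close>

lemma poly_cheb_cos: "poly (cheb k) (cos t) = cos (real k * t)"
proof (induction k rule: cheb.induct)
  case (3 k)
  have "cos (real (Suc (Suc k)) * t) + cos (real k * t) = 2 * cos t * cos (real (Suc k) * t)"
    using cos_plus_cos[of "real (Suc (Suc k)) * t" "real k * t"]
    by (simp add: algebra_simps add_divide_distrib)
  with 3 show ?case by simp
qed simp_all

lemma abs_poly_cheb_le:
  assumes "\<bar>z\<bar> \<le> 1" shows "\<bar>poly (cheb k) z\<bar> \<le> 1"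
  using poly_cheb_cos[of k "arccos z"] assms by (simp add: cos_arccos_abs)

definition cheb_node :: "nat \<Rightarrow> nat \<Rightarrow> real" where
  "cheb_node n j = (2 * real j + 1) * pi / (2 * real n)"

text \<open>Multiplication by 2 sin a turns the cosines at odd multiples of a into differences of
  sines at consecutive even multiples. The sum telescopes to sin (k pi) = 0, and k < 2n keeps a
  inside (0, pi), where the sine can be cancelled.\<close>

lemma sum_cos_cheb_node:
  assumes "0 < k" "k < 2 * n"
  shows "(\<Sum>j<n. cos (real k * cheb_node n j)) = 0"
proof -
  define a where "a = real k * pi / (2 * real n)"
  have "2 * sin a * cos (real k * cheb_node n j)
      = sin (2 * real (Suc j) * a) - sin (2 * real j * a)" for j
  proof -
    have "real k * cheb_node n j = (2 * real j + 1) * a"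
      by (simp add: a_def cheb_node_def)
    thus ?thesis
      using sin_diff_sin[of "2 * real (Suc j) * a" "2 * real j * a"]
      by (simp add: algebra_simps add_divide_distrib)
  qed
  hence "2 * sin a * (\<Sum>j<n. cos (real k * cheb_node n j))
      = (\<Sum>j<n. sin (2 * real (Suc j) * a) - sin (2 * real j * a))"
    by (simp add: sum_distrib_left)
  also have "\<dots> = sin (2 * real n * a)"
    by (subst sum_lessThan_telescope) simp
  also have "2 * real n * a = real k * pi" using assms by (simp add: a_def)
  finally have "2 * sin a * (\<Sum>j<n. cos (real k * cheb_node n j)) = 0" by simp
  moreover have "a > 0" "a < pi"
    using assms by (auto simp: a_def field_simps)
  hence "sin a > 0" by (rule sin_gt_zero)
  ultimately show ?thesis by simp
qed

text \<open>The \<open>i\<close>-th Chebyshev coefficient of a polynomial of degree less than \<open>n\<close>, by discrete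
  orthogonality of the Chebyshev polynomials at the zeros of \<open>cheb n\<close>.\<close>

definition cheb_coeff :: "nat \<Rightarrow> nat \<Rightarrow> real poly \<Rightarrow> real" where
  "cheb_coeff n i p = (if i = 0 then 1 else 2) / real n *
     (\<Sum>j<n. poly p (cos (cheb_node n j)) * cos (real i * cheb_node n j))"

lemma cheb_coeff_add: "cheb_coeff n i (p + q) = cheb_coeff n i p + cheb_coeff n i q"
  by (simp add: cheb_coeff_def sum.distrib algebra_simps)

lemma cheb_coeff_smult: "cheb_coeff n i (smult c p) = c * cheb_coeff n i p"
  by (simp add: cheb_coeff_def sum_distrib_left algebra_simps)

lemma cheb_coeff_0 [simp]: "cheb_coeff n i 0 = 0"
  by (simp add: cheb_coeff_def)

lemma cheb_coeff_sum: "cheb_coeff n i (\<Sum>a\<in>A. f a) = (\<Sum>a\<in>A. cheb_coeff n i (f a))"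
  by (induction A rule: infinite_finite_induct) (simp_all add: cheb_coeff_add)

lemma cheb_coeff_cheb:
  assumes "i < n" "k < n"
  shows "cheb_coeff n i (cheb k) = (if i = k then 1 else 0)"
proof -
  \<comment> \<open>The product of cosines splits into the frequencies k - i and k + i, both below
    2n. Assuming i \<le> k makes k - i an honest difference; the other order follows by
    symmetry.\<close>
  have ord: "(\<Sum>j<n. cos (real k * cheb_node n j) * cos (real i * cheb_node n j))
      = (if i = k then (if i = 0 then real n else real n / 2) else 0)" if "i \<le> k" "k < n" for i k
  proof -
    have "cos (real k * cheb_node n j) * cos (real i * cheb_node n j)
      = (cos (real (k - i) * cheb_node n j) + cos (real (k + i) * cheb_node n j)) / 2" for j
      using \<open>i \<le> k\<close> cos_times_cos[of "real k * cheb_node n j" "real i * cheb_node n j"]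
      by (simp add: algebra_simps of_nat_diff)
    hence *: "(\<Sum>j<n. cos (real k * cheb_node n j) * cos (real i * cheb_node n j))
      = ((\<Sum>j<n. cos (real (k - i) * cheb_node n j)) + (\<Sum>j<n. cos (real (k + i) * cheb_node n j))) / 2"
      by (simp only: sum_divide_distrib [symmetric] sum.distrib)
    consider "k = 0" | "k = i" "k > 0" | "i < k" using \<open>i \<le> k\<close> by (cases "i = k") auto
    thus ?thesis
    proof cases
      case 1 thus ?thesis using that by simp
    next
      case 2
      have "(\<Sum>j<n. cos (real (k + i) * cheb_node n j)) = 0"
        by (rule sum_cos_cheb_node) (use 2 that in auto)
      thus ?thesis unfolding * using 2 by simp
    next
      case 3
      have z: "(\<Sum>j<n. cos (real m * cheb_node n j)) = 0" if "m \<in> {k + i, k - i}" for m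
        by (rule sum_cos_cheb_node) (use 3 that \<open>k < n\<close> in auto)
      have "(\<Sum>j<n. cos (real (k + i) * cheb_node n j)) = 0"
        "(\<Sum>j<n. cos (real (k - i) * cheb_node n j)) = 0" by (rule z, simp)+
      thus ?thesis unfolding * using 3 by (simp only:) simp
    qed
  qed
  have "(\<Sum>j<n. cos (real k * cheb_node n j) * cos (real i * cheb_node n j))
      = (if i = k then (if i = 0 then real n else real n / 2) else 0)"
  proof (cases "i \<le> k")
    case True thus ?thesis using ord assms by blast
  next
    case False
    hence "(\<Sum>j<n. cos (real i * cheb_node n j) * cos (real k * cheb_node n j)) = 0"
      using ord[of k i] assms by auto
    thus ?thesis using False by (auto simp: mult.commute)
  qed
  thus ?thesis using assms by (simp add: cheb_coeff_def poly_cheb_cos)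
qed

text \<open>The coefficient is a weighted average of values of \<open>p\<close> on [-1,1], so a sup
  bound passes to every coefficient with a factor 2 that does not depend on the degree. The rounding
  estimate rests on this.\<close>

lemma abs_cheb_coeff_le:
  assumes "\<And>z. \<bar>z\<bar> \<le> 1 \<Longrightarrow> \<bar>poly p z\<bar> \<le> M" "n > 0"
  shows "\<bar>cheb_coeff n i p\<bar> \<le> 2 * M"
proof -
  have M: "M \<ge> 0" using assms(1)[of 0] by linarith
  have "\<bar>\<Sum>j<n. poly p (cos (cheb_node n j)) * cos (real i * cheb_node n j)\<bar> \<le> (\<Sum>j<n. M * 1)"
    by (rule order_trans[OF sum_abs], rule sum_mono, subst abs_mult, rule mult_mono)
       (use assms M in auto)
  hence *: "\<bar>\<Sum>j<n. poly p (cos (cheb_node n j)) * cos (real i * cheb_node n j)\<bar> \<le> n * M" by simp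
  have "\<bar>cheb_coeff n i p\<bar> = (if i = 0 then 1 else 2) / real n *
     \<bar>\<Sum>j<n. poly p (cos (cheb_node n j)) * cos (real i * cheb_node n j)\<bar>"
    by (simp add: cheb_coeff_def abs_mult)
  also have "\<dots> \<le> 2 / real n * (n * M)"
    by (rule mult_mono) (use * assms(2) in \<open>auto simp: divide_right_mono\<close>)
  finally show ?thesis using assms(2) by simp
qed

text \<open>The linear functional sending \<open>cheb i\<close> to \<open>x i\<close> for i < n. It
  is total on polynomials, so linearity carries no degree condition, and it takes a function rather
  than a vector, which later allows continuity in \<open>x\<close> in the product topology.\<close>

definition ell :: "nat \<Rightarrow> (nat \<Rightarrow> real) \<Rightarrow> real poly \<Rightarrow> real" where
  "ell n x p = (\<Sum>i<n. x i * cheb_coeff n i p)"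

lemma ell_cheb:
  assumes "k < n" shows "ell n x (cheb k) = x k"
  using assms by (simp add: ell_def cheb_coeff_cheb if_distrib sum.delta cong: if_cong)

lemma ell_add: "ell n x (p + q) = ell n x p + ell n x q"
  by (simp add: ell_def cheb_coeff_add sum.distrib algebra_simps)

lemma ell_smult: "ell n x (smult c p) = c * ell n x p"
  by (simp add: ell_def cheb_coeff_smult sum_distrib_left algebra_simps)

lemma ell_arg_add: "ell n (\<lambda>i. x i + y i) p = ell n x p + ell n y p"
  by (simp add: ell_def sum.distrib algebra_simps)

lemma ell_arg_diff: "ell n (\<lambda>i. x i - y i) p = ell n x p - ell n y p"
  by (simp add: ell_def sum_subtractf algebra_simps)

lemma ell_arg_scale: "ell n (\<lambda>i. c * x i) p = c * ell n x p"
  by (simp add: ell_def sum_distrib_left algebra_simps)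

lemma ell_cong: "(\<And>i. i < n \<Longrightarrow> x i = y i) \<Longrightarrow> ell n x p = ell n y p"
  by (simp add: ell_def)

lemma cheb_coeff_cheb_poly:
  assumes "c \<in> carrier_vec n" "i < n"
  shows "cheb_coeff n i (cheb_poly c) = c $ i"
  using assms
  by (simp add: cheb_poly_def cheb_coeff_sum cheb_coeff_smult cheb_coeff_cheb if_distrib sum.delta cong: if_cong)

lemma ell_cheb_poly:
  assumes "c \<in> carrier_vec n"
  shows "ell n x (cheb_poly c) = (\<Sum>i<n. x i * c $ i)"
  using assms by (simp add: ell_def cheb_coeff_cheb_poly)

lemma cheb_poly_cheb_coeff:
  assumes "degree p < n"
  shows "cheb_poly (vec n (\<lambda>i. cheb_coeff n i p)) = p"
proof -
  obtain c where c: "c \<in> carrier_vec n" "cheb_poly c = p" using cheb_poly_surj[OF assms] by blast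
  have "vec n (\<lambda>i. cheb_coeff n i p) = c"
    using c cheb_coeff_cheb_poly[OF c(1)] by (intro eq_vecI) auto
  thus ?thesis using c by simp
qed

lemma cheb_expansion:
  assumes "degree p < n"
  shows "p = (\<Sum>i<n. smult (cheb_coeff n i p) (cheb i))"
  using cheb_poly_cheb_coeff[OF assms] by (simp add: cheb_poly_def)

text \<open>The vector q(z) acts as evaluation at z. Hence the values that characterise \<Lambda> on
  such vectors are those of the functional applied to w p_i p_j.\<close>

lemma ell_cheb_vec:
  assumes "degree p < n"
  shows "ell n (\<lambda>i. poly (cheb i) z) p = poly p z"
proof -
  have "poly p z = poly (\<Sum>i<n. smult (cheb_coeff n i p) (cheb i)) z"
    using cheb_expansion[OF assms] by simp
  thus ?thesis by (simp add: ell_def poly_sum mult.commute)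
qed

section \<open>Nonnegative polynomials on $[-1,1]$\<close>

definition weights :: "nat \<Rightarrow> real poly set" where
  "weights D = (if even D then {1, [:1, 0, -1:]} else {[:1, -1:], [:1, 1:]})"

text \<open>Unlike \<^const>\<open>Sigma_cone\<close> this cone bounds the degrees of the summands, hence is
  meaningful for \<open>D = 0\<close>, where \<^const>\<open>d2\<close> is a truncated difference.\<close>

inductive_set wsos :: "nat \<Rightarrow> real poly set" for D :: nat where
  zero: "0 \<in> wsos D"
| add: "p \<in> wsos D \<Longrightarrow> q \<in> wsos D \<Longrightarrow> p + q \<in> wsos D"
| square: "w \<in> weights D \<Longrightarrow> degree (w * (p * p)) \<le> D \<Longrightarrow> w * (p * p) \<in> wsos D"

lemma weights_mult_even_odd:
  assumes "u \<in> weights a" "v \<in> weights b" "even a" "odd b"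
  shows "\<exists>w\<in>weights (a + b). \<exists>r. u * v = w * (r * r)"
proof (cases "u = 1")
  case True
  show ?thesis by (rule bexI[of _ v], rule exI[of _ 1]) (use assms True in \<open>auto simp: weights_def\<close>)
next
  case False
  show ?thesis
    \<comment> \<open>Here u = (1 - z)(1 + z) and v is one of its factors; 2 - v is the other one,
      so u v = (2 - v) v^2.\<close>
    by (rule bexI[of _ "[:2:] - v"], rule exI[of _ v])
       (use assms False in \<open>auto simp: weights_def\<close>)
qed

text \<open>The weights of both parities together are closed under multiplication up to squares: (1
  - z)(1 + z) is the even weight, equal weights give a square, and mixed parities exchange the two
  odd weights. This makes the cones multiplicative with additive degree bounds.\<close>

lemma weights_mult:
  assumes "u \<in> weights a" "v \<in> weights b"
  shows "\<exists>w\<in>weights (a + b). \<exists>r. u * v = w * (r * r)"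
proof -
  consider "even a" "odd b" | "odd a" "even b" | "even (a + b)" "u = v" | "even (a + b)" "u \<noteq> v"
    by auto
  thus ?thesis
  proof cases
    case 1 thus ?thesis using assms by (intro weights_mult_even_odd)
  next
    case 2 thus ?thesis using weights_mult_even_odd[OF assms(2,1)] by (simp add: ac_simps)
  next
    case 3
    show ?thesis by (rule bexI[of _ 1], rule exI[of _ u]) (use 3 in \<open>auto simp: weights_def\<close>)
  next
    case 4
    show ?thesis
      by (rule bexI[of _ "u * v"], rule exI[of _ 1])
         (use 4 assms in \<open>auto simp: weights_def split: if_splits\<close>)
  qed
qed

lemma wsos_mult:
  assumes "p \<in> wsos a" "q \<in> wsos b"
  shows "p * q \<in> wsos (a + b)"
  using assms(1)
proof induction
  case (square u p)
  show ?case using assms(2)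
  proof induction
    case (square v q)
    obtain w r where w: "w \<in> weights (a + b)" "u * v = w * (r * r)"
      using weights_mult[OF \<open>u \<in> weights a\<close> square(1)] by blast
    have "u * (p * p) * (v * (q * q)) = (u * v) * (p * p) * (q * q)" by (simp add: ac_simps)
    also have "\<dots> = w * ((r * p * q) * (r * p * q))" unfolding w(2) by (simp add: ac_simps)
    finally have eq: "u * (p * p) * (v * (q * q)) = w * ((r * p * q) * (r * p * q))" .
    have "degree (u * (p * p) * (v * (q * q))) \<le> a + b"
      using degree_mult_le[of "u * (p * p)" "v * (q * q)"] square \<open>degree (u * (p * p)) \<le> a\<close> by linarith
    thus ?case unfolding eq by (intro wsos.square w)
  qed (auto simp: distrib_left intro: wsos.intros)
qed (auto simp: distrib_right intro: wsos.intros)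

section \<open>Cone members of low degree and monotonicity in the degree bound\<close>

lemma wsos_const: "c \<ge> 0 \<Longrightarrow> [:c:] \<in> wsos 0"
  using wsos.square[of 1 0 "[:sqrt c:]"] by (simp add: weights_def)

text \<open>The hypotheses are the signs at -1 and 1, and a + b z = (a - b)/2 (1 - z) + (a + b)/2 (1
  + z).\<close>

lemma wsos_linear:
  assumes "a - b \<ge> 0" "a + b \<ge> 0"
  shows "[:a, b:] \<in> wsos 1"
proof -
  have "[:1, -1:] * ([:sqrt ((a - b) / 2):] * [:sqrt ((a - b) / 2):])
      + [:1, 1:] * ([:sqrt ((a + b) / 2):] * [:sqrt ((a + b) / 2):]) \<in> wsos 1"
    by (intro wsos.add wsos.square) (auto simp: weights_def degree_mult_eq)
  also have "[:1, -1:] * ([:sqrt ((a - b) / 2):] * [:sqrt ((a - b) / 2):])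
      + [:1, 1:] * ([:sqrt ((a + b) / 2):] * [:sqrt ((a + b) / 2):]) = [:a, b:]"
    using assms by (simp add: field_simps)
  finally show ?thesis .
qed

text \<open>The weights change with the parity of the bound, so inclusion is not immediate.
  Multiplying by 1 = (1 - z)/2 + (1 + z)/2, a member of \<open>wsos 1\<close>, raises the bound by
  one and switches the weights.\<close>

lemma wsos_mono:
  assumes "p \<in> wsos a" "a \<le> b"
  shows "p \<in> wsos b"
proof -
  have "p \<in> wsos (a + k)" for k
  proof (induction k)
    case (Suc k)
    thus ?case using wsos_mult[OF Suc wsos_linear[of 1 0]] by simp
  qed (use assms in simp)
  from this[of "b - a"] show ?thesis using assms by simp
qed

lemma wsos_quadratic: "[:b, 1:] * [:b, 1:] + [:c:] * [:c:] \<in> wsos 2"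
  using wsos.add[OF wsos.square[of 1 2 "[:b, 1:]"] wsos.square[of 1 2 "[:c:]"]]
  by (auto simp: weights_def)

text \<open>Division by g is impossible at its zeros, but these are finitely many: if q were
  negative at z, it would be negative on a whole subinterval, which contains a point where g is
  positive.\<close>

lemma poly_nonneg_factor:
  fixes g q :: "real poly"
  assumes "a < b" "g \<noteq> 0"
    and g: "\<And>z. a \<le> z \<Longrightarrow> z \<le> b \<Longrightarrow> poly g z \<ge> 0"
    and gq: "\<And>z. a \<le> z \<Longrightarrow> z \<le> b \<Longrightarrow> poly (g * q) z \<ge> 0"
    and z: "a \<le> z" "z \<le> b"
  shows "poly q z \<ge> 0"
proof (rule ccontr)
  assume "\<not> poly q z \<ge> 0"
  hence "poly q z < 0" by simp
  moreover have "isCont (poly q) z" by simp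
  ultimately have "eventually (\<lambda>x. poly q x < 0) (at z)"
    unfolding isCont_def by (blast intro: order_tendstoD(2))
  then obtain e where e: "e > 0" "\<And>x. x \<noteq> z \<Longrightarrow> \<bar>x - z\<bar> < e \<Longrightarrow> poly q x < 0"
    unfolding eventually_at by (auto simp: dist_real_def)
  \<comment> \<open>Clipping to [a, b] leaves a nondegenerate interval even when z is an end
    point.\<close>
  define l where "l = max a (z - e / 2)"
  define u where "u = min b (z + e / 2)"
  have "l < u" using assms(1) z e(1) by (auto simp: l_def u_def)
  have "infinite ({l<..<u} - ({z} \<union> {x. poly g x = 0}))"
    using \<open>l < u\<close> poly_roots_finite[OF \<open>g \<noteq> 0\<close>] by (intro Diff_infinite_finite) auto
  then obtain x where "x \<in> {l<..<u} - ({z} \<union> {x. poly g x = 0})"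
    using infinite_imp_nonempty by blast
  hence x: "l < x" "x < u" "x \<noteq> z" "poly g x \<noteq> 0" by auto
  have "poly q x < 0" using x e(1) by (intro e(2)) (auto simp: l_def u_def)
  moreover have "poly g x > 0" using g[of x] x by (auto simp: l_def u_def)
  ultimately have "poly (g * q) x < 0" by (simp add: mult_pos_neg)
  with gq[of x] x show False by (auto simp: l_def u_def)
qed

text \<open>The remainder modulo the real quadratic with roots \<xi> and its conjugate is a real
  polynomial of degree at most 1 with a non-real root, hence zero.\<close>

lemma complex_root_dvd:
  fixes p :: "real poly"
  assumes "poly (map_poly of_real p) \<xi> = 0" "Im \<xi> \<noteq> 0"
  shows "([:- Re \<xi>, 1:] * [:- Re \<xi>, 1:] + [:Im \<xi>:] * [:Im \<xi>:]) dvd p"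
proof -
  interpret hom: map_poly_comm_ring_hom "of_real :: real \<Rightarrow> complex" ..
  define g where "g = [:- Re \<xi>, 1:] * [:- Re \<xi>, 1:] + [:Im \<xi>:] * [:Im \<xi>:]"
  have g: "g = [:(Re \<xi>)\<^sup>2 + (Im \<xi>)\<^sup>2, - 2 * Re \<xi>, 1:]" by (simp add: g_def power2_eq_square)
  have dg: "degree g = 2" "g \<noteq> 0" by (auto simp: g)
  have g0: "poly (map_poly of_real g) \<xi> = 0"
    by (simp add: g map_poly_pCons complex_eq_iff power2_eq_square algebra_simps)
  have "degree (p mod g) < 2" using degree_mod_less'[of g p] dg by (cases "p mod g = 0") auto
  hence "coeff (p mod g) k = 0" if "k \<ge> 2" for k
    using that by (intro coeff_eq_0) simp
  hence "p mod g = [:coeff (p mod g) 0, coeff (p mod g) 1:]"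
    by (intro poly_eqI) (auto simp: coeff_pCons split: nat.split)
  then obtain a b where ab: "p mod g = [:a, b:]" by blast
  have "map_poly complex_of_real p
      = map_poly complex_of_real (p div g) * map_poly complex_of_real g + map_poly complex_of_real (p mod g)"
    by (simp flip: hom.hom_mult hom.hom_add)
  hence "poly (map_poly complex_of_real (p mod g)) \<xi> = 0" using assms(1) g0 by simp
  hence "complex_of_real a + complex_of_real b * \<xi> = 0" by (simp add: ab of_real_hom.map_poly_pCons_hom mult.commute)
  hence "b = 0 \<and> a = 0" using assms(2) by (auto simp: complex_eq_iff)
  hence "g dvd p" using ab by (simp add: mod_eq_0_iff_dvd)
  thus ?thesis by (simp only: g_def)
qed

text \<open>The Markov-Lukacs theorem: a nonnegative polynomial is a product of nonnegative linear forms,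
  squares, and positive definite quadratics.\<close>

lemma nonneg_imp_wsos:
  assumes "\<And>z. -1 \<le> z \<Longrightarrow> z \<le> 1 \<Longrightarrow> poly p z \<ge> 0"
  shows "p \<in> wsos (degree p)"
  using assms
proof (induction "degree p" arbitrary: p rule: less_induct)
  case less
  \<comment> \<open>A factor g that is nonnegative on the interval and lies in its own cone may be
    split off: the cofactor is again nonnegative and of smaller degree.\<close>
  have step: ?case if "p = g * q" "g \<in> wsos (degree g)" "degree g > 0"
    and g0: "\<And>z. -1 \<le> z \<Longrightarrow> z \<le> 1 \<Longrightarrow> poly g z \<ge> 0" for g q
  proof (cases "p = 0")
    case True thus ?thesis by (simp add: wsos.zero)
  next
    case False
    hence nz: "g \<noteq> 0" "q \<noteq> 0" using that(1) by auto
    hence deg: "degree p = degree g + degree q" using that(1) by (simp add: degree_mult_eq)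
    have "poly q z \<ge> 0" if "-1 \<le> z" "z \<le> 1" for z
      by (rule poly_nonneg_factor[of "-1" 1 g q]) (use nz \<open>p = g * q\<close> less(2) \<open>-1 \<le> z\<close> \<open>z \<le> 1\<close> g0 in auto)
    hence "q \<in> wsos (degree q)" using less(1)[of q] deg that(3) by simp
    thus ?thesis unfolding deg unfolding that(1) using that(2) by (intro wsos_mult)
  qed
  have quad: "[:b, 1:] * [:b, 1:] + [:c:] * [:c:] \<in> wsos (degree ([:b, 1:] * [:b, 1:] + [:c:] * [:c:]))"
    "degree ([:b, 1:] * [:b, 1:] + [:c:] * [:c:]) > 0"
    "poly ([:b, 1:] * [:b, 1:] + [:c:] * [:c:]) z \<ge> 0" for b c z :: real
  proof -
    have "degree ([:b, 1:] * [:b, 1:] + [:c:] * [:c:]) = 2" by simp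
    thus "[:b, 1:] * [:b, 1:] + [:c:] * [:c:] \<in> wsos (degree ([:b, 1:] * [:b, 1:] + [:c:] * [:c:]))"
      "degree ([:b, 1:] * [:b, 1:] + [:c:] * [:c:]) > 0"
      using wsos_quadratic[of b c] by (simp_all only:)
    show "poly ([:b, 1:] * [:b, 1:] + [:c:] * [:c:]) z \<ge> 0"
      unfolding poly_add poly_mult by (intro add_nonneg_nonneg zero_le_square)
  qed
  show ?case
  proof (cases "degree p = 0")
    case True
    then obtain c where "p = [:c:]" by (meson degree_eq_zeroE)
    thus ?thesis using less(2)[of 0] wsos_const[of c] by simp
  next
    case False
    hence "\<not> constant (poly (map_poly complex_of_real p))"
      by (simp add: constant_degree)
    then obtain \<xi> where \<xi>: "poly (map_poly complex_of_real p) \<xi> = 0"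
      using fundamental_theorem_of_algebra by blast
    show ?thesis
    proof (cases "Im \<xi> = 0")
      case False
      then obtain q where "p = ([:- Re \<xi>, 1:] * [:- Re \<xi>, 1:] + [:Im \<xi>:] * [:Im \<xi>:]) * q"
        using complex_root_dvd[OF \<xi>] by (auto elim: dvdE)
      thus ?thesis by (rule step) (use quad[of "- Re \<xi>" "Im \<xi>"] in auto)
    next
      case True
      define r where "r = Re \<xi>"
      have "\<xi> = of_real r" using True by (simp add: r_def complex_eq_iff)
      hence "poly p r = 0" using \<xi> by simp
      then obtain q where q: "p = [:- r, 1:] * q" by (auto simp: poly_eq_0_iff_dvd dvd_def)
      consider "r \<le> -1" | "r \<ge> 1" | "-1 < r" "r < 1" by linarith
      thus ?thesis
      proof cases
        case 1
        show ?thesis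
          by (rule step[OF q]) (use 1 wsos_linear[of "-r" 1] in auto)
      next
        case 2
        have "p = [:r, -1:] * (- q)" using q by simp
        thus ?thesis
          by (rule step) (use 2 wsos_linear[of "r" "-1"] in auto)
      next
        case 3
        \<comment> \<open>At a root inside the interval the sign of z - r changes, so q is
          nonnegative on the right of r and nonpositive on the left. Therefore r is at least a
          double root, and its square is split off.\<close>
        have "poly q r \<ge> 0"
          by (rule poly_nonneg_factor[of r 1 "[:- r, 1:]" q]) (use 3 less(2) q in auto)
        moreover have "poly (- q) r \<ge> 0"
          by (rule poly_nonneg_factor[of "-1" r "[:r, -1:]" "- q"]) (use 3 less(2) q in auto)
        ultimately have "poly q r = 0" by simp
        then obtain u where "q = [:- r, 1:] * u" by (auto simp: poly_eq_0_iff_dvd dvd_def)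
        hence "p = ([:- r, 1:] * [:- r, 1:]) * u" using q by (simp only: mult.assoc)
        thus ?thesis
          by (rule step) (use quad[of "-r" 0] in auto)
      qed
    qed
  qed
qed

section \<open>Critical values of integer polynomials\<close>

definition l1_norm :: "'a :: linordered_idom poly \<Rightarrow> 'a" where
  "l1_norm p = poly (map_poly abs p) 1"

lemma l1_norm_0 [simp]: "l1_norm 0 = 0" by (simp add: l1_norm_def)

lemma l1_norm_pCons [simp]: "l1_norm (pCons a p) = \<bar>a\<bar> + l1_norm p"
  by (simp add: l1_norm_def Polynomial.map_poly_pCons)

lemma l1_norm_1 [simp]: "l1_norm 1 = 1" by (simp add: one_pCons)

lemma l1_norm_nonneg: "l1_norm p \<ge> 0"
  by (induction p) auto

lemma l1_norm_uminus [simp]: "l1_norm (- p) = l1_norm p"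
  by (induction p) auto

lemma l1_norm_add: "l1_norm (p + q) \<le> l1_norm p + l1_norm q"
proof (induction p arbitrary: q)
  case (pCons a p)
  obtain b r where q: "q = pCons b r" by (cases q)
  show ?case using pCons.IH[of r] abs_triangle_ineq[of a b] by (simp add: q)
qed simp

lemma l1_norm_diff: "l1_norm (p - q) \<le> l1_norm p + l1_norm q"
  using l1_norm_add[of p "- q"] by simp

lemma l1_norm_smult [simp]: "l1_norm (smult c p) = \<bar>c\<bar> * l1_norm p"
  by (induction p) (auto simp: abs_mult algebra_simps)

lemma l1_norm_mult: "l1_norm (p * q) \<le> l1_norm p * l1_norm q"
proof (induction p)
  case (pCons a p)
  have "l1_norm (pCons a p * q) \<le> l1_norm (smult a q) + l1_norm (pCons 0 (p * q))"
    unfolding mult_pCons_left by (rule l1_norm_add)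
  also have "\<dots> \<le> l1_norm (pCons a p) * l1_norm q"
    using pCons.IH by (simp add: algebra_simps)
  finally show ?case .
qed simp

lemma l1_norm_sum: "l1_norm (\<Sum>i\<in>A. f i) \<le> (\<Sum>i\<in>A. l1_norm (f i))"
  by (induction A rule: infinite_finite_induct) (auto intro: order_trans[OF l1_norm_add])

lemma l1_norm_prod: "l1_norm (\<Prod>i\<in>A. f i) \<le> (\<Prod>i\<in>A. l1_norm (f i))"
proof (induction A rule: infinite_finite_induct)
  case (insert x A)
  have "l1_norm (f x) * l1_norm (\<Prod>i\<in>A. f i) \<le> l1_norm (f x) * (\<Prod>i\<in>A. l1_norm (f i))"
    using insert by (intro mult_left_mono l1_norm_nonneg)
  thus ?case using insert by (auto intro: order_trans[OF l1_norm_mult])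
qed auto

lemma sum_coeff_power:
  fixes p :: "'a :: comm_semiring_1 poly"
  assumes "degree p < n" shows "(\<Sum>j<n. coeff p j * x ^ j) = poly p x"
proof -
  have "(\<Sum>j<n. coeff p j * x ^ j) = (\<Sum>j\<le>degree p. coeff p j * x ^ j)"
    by (rule sum.mono_neutral_right) (use assms in \<open>auto simp: coeff_eq_0\<close>)
  thus ?thesis by (simp add: poly_altdef)
qed

lemma l1_norm_conv_sum:
  assumes "degree p < n" shows "l1_norm p = (\<Sum>i<n. \<bar>coeff p i\<bar>)"
proof -
  have "degree (map_poly abs p) < n" using assms by (meson degree_map_poly_le le_less_trans)
  hence "poly (map_poly abs p) 1 = (\<Sum>i<n. coeff (map_poly abs p) i)"
    using sum_coeff_power[of "map_poly abs p" n 1] by simp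
  thus ?thesis by (simp add: l1_norm_def coeff_map_poly)
qed

lemma l1_norm_pderiv: "l1_norm (pderiv p) \<le> of_nat (degree p) * l1_norm p"
proof (cases "degree p = 0")
  case True
  thus ?thesis by (auto elim!: degree_eq_zeroE)
next
  case False
  define n where "n = degree p"
  have "l1_norm (pderiv p) = (\<Sum>i<n. \<bar>coeff (pderiv p) i\<bar>)"
    using degree_pderiv_le[of p] False by (intro l1_norm_conv_sum) (simp add: n_def)
  also have "\<dots> \<le> (\<Sum>i<n. of_nat n * \<bar>coeff p (Suc i)\<bar>)"
    by (intro sum_mono) (auto simp: coeff_pderiv abs_mult simp del: of_nat_Suc intro!: mult_right_mono)
  also have "\<dots> = of_nat n * (\<Sum>i<n. \<bar>coeff p (Suc i)\<bar>)" by (simp add: sum_distrib_left)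
  also have "\<dots> \<le> of_nat n * (\<Sum>i<Suc n. \<bar>coeff p i\<bar>)"
    by (subst sum.lessThan_Suc_shift) (intro mult_left_mono, auto)
  also have "(\<Sum>i<Suc n. \<bar>coeff p i\<bar>) = l1_norm p"
    by (subst l1_norm_conv_sum[of p "Suc n"]) (auto simp: n_def)
  finally show ?thesis by (simp add: n_def)
qed

lemma abs_poly_le_l1_norm:
  fixes x :: "'a :: linordered_idom"
  assumes "\<bar>x\<bar> \<le> 1" shows "\<bar>poly p x\<bar> \<le> l1_norm p"
proof (induction p)
  case (pCons a p)
  have "\<bar>poly (pCons a p) x\<bar> \<le> \<bar>a\<bar> + \<bar>x\<bar> * \<bar>poly p x\<bar>"
    using abs_triangle_ineq[of a "x * poly p x"] by (simp add: abs_mult)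
  also have "\<bar>x\<bar> * \<bar>poly p x\<bar> \<le> 1 * l1_norm p"
    using assms pCons.IH l1_norm_nonneg[of p] by (intro mult_mono) auto
  finally show ?case by simp
qed simp

lemma l1_norm_signof: "l1_norm (signof p * q :: 'a :: linordered_idom poly) = l1_norm q"
  by (simp add: sign_def)

text \<open>Expanding the product of the row sums gives one term for each of the n^n choice
  functions. The Leibniz terms are those of the permutations, restricted to {..<n} to count as such
  functions, so no factor n! appears.\<close>

lemma l1_norm_det_le:
  fixes A :: "'a :: linordered_idom poly mat"
  assumes A: "A \<in> carrier_mat n n" and K: "\<And>i. i < n \<Longrightarrow> (\<Sum>j<n. l1_norm (A $$ (i, j))) \<le> K"
  shows "l1_norm (det A) \<le> K ^ n"
proof -
  let ?P = "{p. p permutes {0..<n}}"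
  define h where "h f = (\<Prod>i<n. l1_norm (A $$ (i, f i)))" for f
  have "l1_norm (det A) \<le> (\<Sum>p\<in>?P. l1_norm (\<Prod>i = 0..<n. A $$ (i, p i)))"
    unfolding det_def'[OF A] by (rule order_trans[OF l1_norm_sum]) (simp add: l1_norm_signof)
  also have "\<dots> \<le> (\<Sum>p\<in>?P. h p)"
    unfolding h_def lessThan_atLeast0 by (intro sum_mono l1_norm_prod)
  also have "\<dots> = (\<Sum>p\<in>?P. h (restrict p {..<n}))"
    by (simp add: h_def)
  also have "\<dots> = (\<Sum>f\<in>(\<lambda>p. restrict p {..<n}) ` ?P. h f)"
  proof (subst sum.reindex)
    show "inj_on (\<lambda>p. restrict p {..<n}) ?P"
    proof (rule inj_onI)
      fix p q assume pq: "p \<in> ?P" "q \<in> ?P" "restrict p {..<n} = restrict q {..<n}"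
      show "p = q"
      proof
        fix i show "p i = q i"
        proof (cases "i < n")
          case True thus ?thesis using fun_cong[OF pq(3), of i] by simp
        next
          case False thus ?thesis using pq(1,2) by (auto simp: permutes_def)
        qed
      qed
    qed
  qed simp
  also have "\<dots> \<le> (\<Sum>f\<in>PiE {..<n} (\<lambda>_. {..<n}). h f)"
  proof (rule sum_mono2)
    show "(\<lambda>p. restrict p {..<n}) ` ?P \<subseteq> PiE {..<n} (\<lambda>_. {..<n})"
      using permutes_in_image by (fastforce simp: PiE_def Pi_def)
  qed (auto simp: h_def finite_PiE intro!: prod_nonneg l1_norm_nonneg)
  also have "\<dots> = (\<Prod>i<n. \<Sum>j<n. l1_norm (A $$ (i, j)))"
    unfolding h_def by (subst prod_sum_PiE) auto
  also have "\<dots> \<le> (\<Prod>i<n. K)"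
    using K by (intro prod_mono) (auto intro!: sum_nonneg l1_norm_nonneg)
  finally show ?thesis by simp
qed

section \<open>A resultant whose roots are the critical values\<close>

lemma sum_lessThan_add:
  fixes f :: "nat \<Rightarrow> 'a :: comm_monoid_add"
  shows "(\<Sum>i<m + n. f i) = (\<Sum>i<m. f i) + (\<Sum>i<n. f (i + m))"
  by (induction n) (simp_all add: ac_simps)

text \<open>The Sylvester matrix of \<open>p - \<mu>\<close> and \<open>pderiv p\<close>, whose entries are polynomials in the
  indeterminate \<open>\<mu>\<close>; its rows are coefficient vectors, lowest degree first.\<close>

definition crit_mat :: "int poly \<Rightarrow> int poly mat" where
  "crit_mat p = (let n = degree p in mat (2 * n - 1) (2 * n - 1) (\<lambda>(i, j).
     if i < n - 1 then [:coeff (monom 1 i * p) j:] - (if i = j then [:0, 1:] else 0)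
     else [:coeff (monom 1 (i - (n - 1)) * pderiv p) j:]))"

abbreviation cpoly :: "int poly \<Rightarrow> complex poly" where
  "cpoly \<equiv> map_poly of_int"

text \<open>Row i of the matrix at a complex value of the indeterminate, read as a polynomial. The
  matrix times the powers of \<xi> then evaluates rows at \<xi>, and a dependence between rows is a
  relation A (p - \<mu>) + B p' = 0.\<close>

definition crit_row :: "int poly \<Rightarrow> complex \<Rightarrow> nat \<Rightarrow> complex poly" where
  "crit_row p \<mu> i = (let n = degree p in
     if i < n - 1 then monom 1 i * (cpoly p - [:\<mu>:])
     else monom 1 (i - (n - 1)) * pderiv (cpoly p))"

lemma comm_ring_hom_eval: "comm_ring_hom (\<lambda>f. poly (cpoly f) \<mu>)"
  by unfold_locales (auto simp: of_int_poly_hom.hom_add of_int_poly_hom.hom_mult)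

lemma crit_mat_carrier: "crit_mat p \<in> carrier_mat (2 * degree p - 1) (2 * degree p - 1)"
  by (simp add: crit_mat_def Let_def)

lemma crit_mat_row:
  assumes "i < 2 * degree p - 1" "j < 2 * degree p - 1"
  shows "poly (cpoly (crit_mat p $$ (i, j))) \<mu> = coeff (crit_row p \<mu> i) j"
proof -
  interpret comm_ring_hom "\<lambda>f. poly (cpoly f) \<mu>" by (rule comm_ring_hom_eval)
  have pd: "pderiv (cpoly p) = cpoly (pderiv p)"
    by (simp add: of_int_hom.map_poly_pderiv)
  show ?thesis
    using assms unfolding crit_mat_def crit_row_def Let_def pd
    by (auto simp: hom_minus coeff_monom_mult coeff_pCons right_diff_distrib Polynomial.map_poly_pCons split: nat.splits)
qed

lemma degree_crit_row:
  assumes "i < 2 * degree p - 1" "degree p > 0"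
  shows "degree (crit_row p \<mu> i) < 2 * degree p - 1"
proof -
  have "degree (cpoly p - [:\<mu>:]) \<le> degree p"
    by (intro degree_diff_le) auto
  moreover have "degree (pderiv (cpoly p)) \<le> degree p - 1"
    using degree_pderiv_le[of "cpoly p"] by simp
  ultimately show ?thesis
    unfolding crit_row_def Let_def
    using assms degree_mult_le[of "monom 1 i" "cpoly p - [:\<mu>:]"]
      degree_mult_le[of "monom 1 (i - (degree p - 1))" "pderiv (cpoly p)"]
    by (auto simp: degree_monom_eq)
qed

text \<open>At a critical point \<xi> with \<mu> = p(\<xi>) every row polynomial vanishes at \<xi>,
  so the vector of powers of \<xi> is in the kernel. Its entry 0 is 1, hence it is nonzero.\<close>

lemma det_crit_mat_critical_value:
  assumes "degree p > 0" "poly (pderiv (cpoly p)) \<xi> = 0"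
  shows "poly (cpoly (det (crit_mat p))) (poly (cpoly p) \<xi>) = 0"
proof -
  define \<mu> where "\<mu> = poly (cpoly p) \<xi>"
  define N where "N = 2 * degree p - 1"
  interpret comm_ring_hom "\<lambda>f. poly (cpoly f) \<mu>" by (rule comm_ring_hom_eval)
  define M where "M = map_mat (\<lambda>f. poly (cpoly f) \<mu>) (crit_mat p)"
  have M: "M \<in> carrier_mat N N" using crit_mat_carrier[of p] by (simp add: M_def N_def)
  define v where "v = vec N (\<lambda>j. \<xi> ^ j)"
  have "poly (crit_row p \<mu> i) \<xi> = 0" for i
    using assms by (simp add: crit_row_def Let_def \<mu>_def)
  hence row: "(\<Sum>j<N. coeff (crit_row p \<mu> i) j * \<xi> ^ j) = 0" if "i < N" for i
    using that assms degree_crit_row[of i p \<mu>] sum_coeff_power[of "crit_row p \<mu> i" N \<xi>]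
    by (simp add: N_def)
  have "M *\<^sub>v v = 0\<^sub>v N"
  proof (rule eq_vecI)
    fix i assume "i < dim_vec (0\<^sub>v N :: complex vec)"
    hence i: "i < N" by simp
    have "(M *\<^sub>v v) $ i = (\<Sum>j<N. coeff (crit_row p \<mu> i) j * \<xi> ^ j)"
      using i M crit_mat_carrier[of p]
      by (auto simp: scalar_prod_def v_def M_def crit_mat_row N_def lessThan_atLeast0 intro!: sum.cong)
    thus "(M *\<^sub>v v) $ i = 0\<^sub>v N $ i" using row i by simp
  qed (use M in auto)
  moreover have "v $ 0 \<noteq> 0\<^sub>v N $ 0" using assms by (simp add: v_def N_def)
  hence "v \<noteq> 0\<^sub>v N" by auto
  moreover have "v \<in> carrier_vec N" by (simp add: v_def)
  ultimately have "det M = 0" using det_0_iff_vec_prod_zero[OF M] by blast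
  thus ?thesis by (simp add: M_def \<mu>_def[symmetric])
qed

lemma coprime_if_no_common_root:
  fixes p q :: "complex poly"
  assumes "p \<noteq> 0" "\<And>z. poly p z = 0 \<Longrightarrow> poly q z \<noteq> 0"
  shows "coprime p q"
proof (rule coprimeI)
  fix c assume c: "c dvd p" "c dvd q"
  have "c \<noteq> 0" using c(1) assms(1) by auto
  have "degree c = 0"
  proof (rule ccontr)
    assume "degree c \<noteq> 0"
    then obtain z where "poly c z = 0"
      using fundamental_theorem_of_algebra[of c] by (auto simp: constant_degree)
    thus False using c assms(2)[of z] by (auto elim!: dvdE)
  qed
  thus "is_unit c" using \<open>c \<noteq> 0\<close> by (auto simp: is_unit_iff_degree)
qed

text \<open>There are finitely many critical values, so some complex \<mu> avoids them, and then p -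
  \<mu> and p' have no common root. A left kernel vector would give A (p - \<mu>) + B p' = 0 with
  deg B < n; coprimality forces p - \<mu> to divide B, so B and then A vanish. The polynomial p
  itself may well have multiple roots.\<close>

lemma det_crit_mat_nonzero:
  assumes p: "degree p > 0"
  shows "det (crit_mat p) \<noteq> 0"
proof -
  define n where "n = degree p"
  define N where "N = 2 * n - 1"
  have pd0: "pderiv (cpoly p) \<noteq> 0" using p by (simp add: pderiv_eq_0_iff)
  have "finite (poly (cpoly p) ` {\<xi>. poly (pderiv (cpoly p)) \<xi> = 0})"
    using poly_roots_finite[OF pd0] by simp
  then obtain \<mu> where \<mu>: "\<mu> \<notin> poly (cpoly p) ` {\<xi>. poly (pderiv (cpoly p)) \<xi> = 0}"
    using ex_new_if_finite[OF infinite_UNIV_char_0] by blast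
  interpret comm_ring_hom "\<lambda>f. poly (cpoly f) \<mu>" by (rule comm_ring_hom_eval)
  define M where "M = map_mat (\<lambda>f. poly (cpoly f) \<mu>) (crit_mat p)"
  have M: "M \<in> carrier_mat N N" using crit_mat_carrier[of p] by (simp add: M_def N_def n_def)
  let ?q = "cpoly p - [:\<mu>:]"
  have dq: "degree ?q = n"
    using p degree_add_eq_left[of "- [:\<mu>:]" "cpoly p"] unfolding add_uminus_conv_diff by (simp add: n_def)
  hence q0: "?q \<noteq> 0" using p by (auto simp: n_def)
  have cop: "coprime ?q (pderiv (cpoly p))"
    using \<mu> by (intro coprime_if_no_common_root q0) auto
  have "det M \<noteq> 0"
  proof
    assume "det M = 0"
    hence "det (transpose_mat M) = 0" using det_transpose[OF M] by simp
    then obtain v where v: "v \<in> carrier_vec N" "v \<noteq> 0\<^sub>v N" "transpose_mat M *\<^sub>v v = 0\<^sub>v N"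
      using det_0_iff_vec_prod_zero[of "transpose_mat M" N] M by auto
    have vsum: "(\<Sum>i<N. v $ i * coeff (crit_row p \<mu> i) j) = 0" if j: "j < N" for j
    proof -
      have "(\<Sum>i<N. v $ i * coeff (crit_row p \<mu> i) j) = (transpose_mat M *\<^sub>v v) $ j"
        using j M v(1) crit_mat_carrier[of p]
        by (auto simp: scalar_prod_def M_def crit_mat_row N_def n_def lessThan_atLeast0 mult.commute intro!: sum.cong)
      thus ?thesis using v(3) j by simp
    qed
    have zero: "(\<Sum>i<N. smult (v $ i) (crit_row p \<mu> i)) = 0"
    proof (rule poly_eqI)
      fix j
      show "coeff (\<Sum>i<N. smult (v $ i) (crit_row p \<mu> i)) j = coeff 0 j"
      proof (cases "j < N")
        case True thus ?thesis using vsum by (simp add: coeff_sum)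
      next
        case False
        hence "coeff (crit_row p \<mu> i) j = 0" if "i < N" for i
          using degree_crit_row[of i p \<mu>] that p by (intro coeff_eq_0) (auto simp: N_def n_def)
        thus ?thesis by (simp add: coeff_sum)
      qed
    qed
    have N: "N = (n - 1) + n" using p by (simp add: N_def n_def)
    have "(\<Sum>i<N. smult (v $ i) (crit_row p \<mu> i))
      = (\<Sum>i<n - 1. smult (v $ i) (crit_row p \<mu> i)) + (\<Sum>i<n. smult (v $ (i + (n - 1))) (crit_row p \<mu> (i + (n - 1))))"
      unfolding N by (rule sum_lessThan_add)
    also have "(\<Sum>i<n - 1. smult (v $ i) (crit_row p \<mu> i)) = (\<Sum>i<n - 1. monom (v $ i) i) * ?q"
      unfolding sum_distrib_right
      by (intro sum.cong) (auto simp: crit_row_def n_def mult.assoc[symmetric] smult_monom simp flip: mult_smult_left)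
    also have "(\<Sum>i<n. smult (v $ (i + (n - 1))) (crit_row p \<mu> (i + (n - 1))))
      = (\<Sum>i<n. monom (v $ (i + (n - 1))) i) * pderiv (cpoly p)"
      unfolding sum_distrib_right
      by (intro sum.cong) (auto simp: crit_row_def n_def Let_def smult_monom simp flip: mult_smult_left)
    finally have *: "(\<Sum>i<n - 1. monom (v $ i) i) * ?q + (\<Sum>i<n. monom (v $ (i + (n - 1))) i) * pderiv (cpoly p) = 0"
      (is "?A * _ + ?B * _ = 0")
      using zero by simp
    have coeffA: "coeff ?A i = v $ i" if "i < n - 1" for i
      using that by (simp add: coeff_sum)
    have coeffB: "coeff ?B i = v $ (i + (n - 1))" if "i < n" for i
      using that by (simp add: coeff_sum)
    have "?B * pderiv (cpoly p) = (- ?A) * ?q"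
      using * by (simp add: eq_neg_iff_add_eq_0 add.commute)
    hence "?q dvd ?B * pderiv (cpoly p)" by (metis dvd_triv_right)
    hence "?q dvd ?B" using coprime_dvd_mult_left_iff[OF cop] by blast
    moreover have "degree ?B < n"
    proof -
      have "degree ?B \<le> n - 1"
        by (intro degree_sum_le) (auto intro!: order_trans[OF degree_monom_le])
      thus ?thesis using p by (simp add: n_def)
    qed
    ultimately have B0: "?B = 0" using dq by (metis dvd_imp_degree_le not_less)
    hence A0: "?A = 0" using * q0 by simp
    have "v = 0\<^sub>v N"
    proof (rule eq_vecI)
      fix i assume "i < dim_vec (0\<^sub>v N :: complex vec)"
      hence i: "i < N" by simp
      show "v $ i = 0\<^sub>v N $ i"
      proof (cases "i < n - 1")
        case True thus ?thesis using coeffA[of i] A0 i by simp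
      next
        case False thus ?thesis using coeffB[of "i - (n - 1)"] B0 i N by simp
      qed
    qed (use v in auto)
    with v(2) show False by simp
  qed
  moreover have "det M = poly (cpoly (det (crit_mat p))) \<mu>" by (simp add: M_def)
  ultimately show ?thesis by auto
qed

text \<open>A shifted row of p - \<mu> has norm at most that of p plus 1 for the indeterminate; a
  row of the derivative gains at most the factor n.\<close>

lemma l1_norm_det_crit_mat:
  assumes p: "degree p > 0"
  shows "l1_norm (det (crit_mat p)) \<le> (int (degree p) * l1_norm p + 1) ^ (2 * degree p - 1)"
proof (rule l1_norm_det_le[OF crit_mat_carrier])
  fix i assume i: "i < 2 * degree p - 1"
  let ?n = "degree p" let ?N = "2 * degree p - 1"
  have l1_monom: "l1_norm (monom 1 k * q) \<le> l1_norm q" for k and q :: "int poly"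
  proof -
    have "l1_norm (monom (1::int) k) = 1" by (induction k) (auto simp: monom_Suc monom_0)
    thus ?thesis using l1_norm_mult[of "monom 1 k" q] by simp
  qed
  show "(\<Sum>j<?N. l1_norm (crit_mat p $$ (i, j))) \<le> int ?n * l1_norm p + 1"
  proof (cases "i < ?n - 1")
    case True
    have "(\<Sum>j<?N. l1_norm (crit_mat p $$ (i, j)))
        \<le> (\<Sum>j<?N. \<bar>coeff (monom 1 i * p) j\<bar> + (if i = j then 1 else 0))"
    proof (rule sum_mono)
      fix j assume "j \<in> {..<?N}"
      thus "l1_norm (crit_mat p $$ (i, j)) \<le> \<bar>coeff (monom 1 i * p) j\<bar> + (if i = j then 1 else 0)"
        using i True by (simp add: crit_mat_def Let_def)
    qed
    also have "\<dots> = (\<Sum>j<?N. \<bar>coeff (monom 1 i * p) j\<bar>) + 1"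
      using i by (simp add: sum.distrib sum.delta)
    also have "(\<Sum>j<?N. \<bar>coeff (monom 1 i * p) j\<bar>) = l1_norm (monom 1 i * p)"
      using True degree_mult_le[of "monom 1 i" p]
      by (intro l1_norm_conv_sum[symmetric]) (auto simp: degree_monom_eq)
    also have "\<dots> \<le> l1_norm p" by (rule l1_monom)
    also have "\<dots> \<le> int ?n * l1_norm p"
      using p l1_norm_nonneg[of p] mult_right_mono[of 1 "int ?n" "l1_norm p"] by simp
    finally show ?thesis by simp
  next
    case False
    have "(\<Sum>j<?N. l1_norm (crit_mat p $$ (i, j)))
        = (\<Sum>j<?N. \<bar>coeff (monom 1 (i - (?n - 1)) * pderiv p) j\<bar>)"
      using i False by (intro sum.cong) (auto simp: crit_mat_def Let_def)
    also have "\<dots> = l1_norm (monom 1 (i - (?n - 1)) * pderiv p)"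
      using False i degree_mult_le[of "monom 1 (i - (?n - 1))" "pderiv p"] degree_pderiv_le[of p]
      by (intro l1_norm_conv_sum[symmetric]) (auto simp: degree_monom_eq)
    also have "\<dots> \<le> l1_norm (pderiv p)" by (rule l1_monom)
    also have "\<dots> \<le> int ?n * l1_norm p" using l1_norm_pderiv[of p] by simp
    finally show ?thesis by simp
  qed
qed

text \<open>A vanishing constant coefficient is removed by dividing by \<epsilon>. A nonzero one has
  modulus at least 1 and equals, up to sign, \<epsilon> times the value of the remaining
  polynomial.\<close>

lemma int_poly_root_lower_bound:
  fixes \<epsilon> :: real and r :: "int poly"
  assumes "r \<noteq> 0" "poly (map_poly of_int r) \<epsilon> = 0" "0 < \<epsilon>" "\<epsilon> \<le> 1"
  shows "1 \<le> \<epsilon> * of_int (l1_norm r)"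
  using assms(1,2)
proof (induction r)
  case (pCons a s)
  have l1: "real_of_int (l1_norm s) = l1_norm (map_poly of_int s :: real poly)"
    by (induction s) (auto simp: Polynomial.map_poly_pCons)
  have eq: "real_of_int a + \<epsilon> * poly (map_poly of_int s) \<epsilon> = 0"
    using pCons.prems by (simp add: Polynomial.map_poly_pCons)
  show ?case
  proof (cases "a = 0")
    case True
    thus ?thesis using pCons eq assms(3) by auto
  next
    case False
    hence "1 \<le> \<bar>real_of_int a\<bar>" by linarith
    also have "\<bar>real_of_int a\<bar> = \<epsilon> * \<bar>poly (map_poly of_int s) \<epsilon>\<bar>"
    proof -
      have "real_of_int a = - (\<epsilon> * poly (map_poly of_int s) \<epsilon>)" using eq by linarith
      thus ?thesis using assms(3) by (simp add: abs_mult)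
    qed
    also have "\<dots> \<le> \<epsilon> * l1_norm (map_poly of_int s)"
      using assms by (intro mult_left_mono abs_poly_le_l1_norm) auto
    also have "\<dots> \<le> \<epsilon> * of_int (l1_norm (pCons a s))"
      unfolding l1[symmetric] using assms by (intro mult_left_mono) auto
    finally show ?thesis .
  qed
qed simp

lemma critical_value_lower_bound:
  fixes p :: "int poly" and \<xi> :: real
  defines "\<epsilon> \<equiv> poly (map_poly of_int p) \<xi>"
  assumes p: "degree p > 0" and crit: "poly (pderiv (map_poly of_int p)) \<xi> = 0"
    and \<epsilon>: "0 < \<epsilon>" "\<epsilon> \<le> 1"
  shows "1 \<le> \<epsilon> * of_int ((int (degree p) * l1_norm p + 1) ^ (2 * degree p - 1))"
proof -
  interpret hom: map_poly_comm_ring_hom "of_real :: real \<Rightarrow> complex" ..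
  have ev: "poly (cpoly q) (of_real x) = of_real (poly (map_poly of_int q) x)" for q x
    by (induction q) (auto simp: Polynomial.map_poly_pCons)
  have pd: "pderiv (map_poly of_int p) = (map_poly of_int (pderiv p) :: 'a :: {idom,ring_char_0} poly)"
    by (simp add: of_int_hom.map_poly_pderiv)
  have "poly (pderiv (cpoly p)) (of_real \<xi>) = 0"
    using crit unfolding pd by (simp add: ev)
  from det_crit_mat_critical_value[OF p this]
  have "poly (map_poly of_int (det (crit_mat p))) \<epsilon> = 0"
    unfolding ev \<epsilon>_def by simp
  hence "1 \<le> \<epsilon> * of_int (l1_norm (det (crit_mat p)))"
    using \<epsilon> by (intro int_poly_root_lower_bound det_crit_mat_nonzero p) auto
  also have "\<dots> \<le> \<epsilon> * of_int ((int (degree p) * l1_norm p + 1) ^ (2 * degree p - 1))"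
    using \<epsilon> l1_norm_det_crit_mat[OF p] by (intro mult_left_mono) (simp_all only: of_int_le_iff less_imp_le)
  finally show ?thesis .
qed

section \<open>Second derivative of the logarithm of a determinant\<close>

text \<open>Determinants of plain functions, so that entries can depend on a parameter and be
  differentiated without carrier conditions.\<close>

definition fdet :: "nat \<Rightarrow> (nat \<Rightarrow> nat \<Rightarrow> 'a) \<Rightarrow> 'a :: comm_ring_1" where
  "fdet n f = det (mat n n (\<lambda>(i, j). f i j))"

lemma fdet_conv_sum:
  "fdet n f = (\<Sum>p | p permutes {..<n}. signof p * (\<Prod>i<n. f i (p i)))"
  unfolding fdet_def det_def'[OF mat_carrier] lessThan_atLeast0
  by (intro sum.cong refl arg_cong2[of _ _ _ _ "(*)"] prod.cong)
     (auto dest: permutes_in_image)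

lemma fdet_cong: "(\<And>i j. i < n \<Longrightarrow> j < n \<Longrightarrow> f i j = g i j) \<Longrightarrow> fdet n f = fdet n g"
  unfolding fdet_def by (intro arg_cong[of _ _ det] eq_matI) auto

lemma fdet_id: "fdet n (\<lambda>i j. if i = j then 1 else 0) = 1"
proof -
  have *: "mat n n (\<lambda>(i, j). if i = j then 1 else 0) = 1\<^sub>m n" by (intro eq_matI) auto
  show ?thesis unfolding fdet_def * by simp
qed

text \<open>The product rule applied to the Leibniz formula, kept unevaluated so that it can be
  differentiated a second time.\<close>

definition fdet_deriv :: "nat \<Rightarrow> (nat \<Rightarrow> nat \<Rightarrow> real) \<Rightarrow> (nat \<Rightarrow> nat \<Rightarrow> real) \<Rightarrow> real" where
  "fdet_deriv n f g = (\<Sum>p | p permutes {..<n}. signof p *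
     (\<Sum>i<n. g i (p i) * (\<Prod>k\<in>{..<n} - {i}. f k (p k))))"

lemma DERIV_fdet:
  assumes "\<And>i j. i < n \<Longrightarrow> j < n \<Longrightarrow> ((\<lambda>s. f s i j) has_real_derivative g i j) (at s0)"
  shows "((\<lambda>s. fdet n (f s)) has_real_derivative fdet_deriv n (f s0) g) (at s0)"
  unfolding fdet_conv_sum fdet_deriv_def
  by (intro DERIV_sum DERIV_cmult has_field_derivative_prod assms) (auto dest: permutes_in_image)

text \<open>A permutation moving a point moves a second one, so only \<open>id\<close> contributes.\<close>

lemma fdet_deriv_id: "fdet_deriv n (\<lambda>i j. if i = j then 1 else 0) g = (\<Sum>i<n. g i i)"
proof -
  have "(\<Sum>i<n. g i (p i) * (\<Prod>k\<in>{..<n} - {i}. if k = p k then 1 else 0)) = 0"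
    if p: "p permutes {..<n}" "p \<noteq> id" for p
  proof (intro sum.neutral ballI)
    fix i assume i: "i \<in> {..<n}"
    obtain k where k: "p k \<noteq> k" using p(2) by fastforce
    hence "k \<in> {..<n}" using p(1) by (meson permutes_not_in)
    have "\<exists>k\<in>{..<n} - {i}. p k \<noteq> k"
    proof (cases "k = i")
      case False thus ?thesis using k \<open>k \<in> {..<n}\<close> by blast
    next
      case True
      have "p (p i) \<noteq> p i" using k True permutes_inj[OF p(1)] by (metis injD)
      moreover have "p i \<in> {..<n}" using permutes_in_image[OF p(1)] i by blast
      ultimately show ?thesis using k True by blast
    qed
    hence "(\<Prod>k\<in>{..<n} - {i}. if k = p k then 1 else 0 :: real) = 0"
      by (intro prod_zero) (simp, metis)
    thus "g i (p i) * (\<Prod>k\<in>{..<n} - {i}. if k = p k then 1 else 0) = 0" by simp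
  qed
  hence "fdet_deriv n (\<lambda>i j. if i = j then 1 else 0) g
      = (\<Sum>p\<in>{id}. signof p * (\<Sum>i<n. g i (p i) * (\<Prod>k\<in>{..<n} - {i}. if k = p k then 1 else 0)))"
    unfolding fdet_deriv_def
    by (intro sum.mono_neutral_right) (auto simp: permutes_id finite_permutations)
  thus ?thesis by simp
qed

text \<open>The product selects the permutations that fix everything outside {i, k}; there are two
  of them, the identity and the transposition.\<close>

lemma sum_fix_outside_pair:
  fixes f :: "(nat \<Rightarrow> nat) \<Rightarrow> real"
  assumes ik: "i < n" "k < n" "i \<noteq> k"
  shows "(\<Sum>p | p permutes {..<n}. f p * (\<Prod>l\<in>{..<n} - {i} - {k}. if l = p l then 1 else 0))
     = f id + f (Transposition.transpose i k)"
proof -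
  let ?t = "Transposition.transpose i k"
  have t: "?t permutes {..<n}" using ik by (intro permutes_swap_id) auto
  have "?t i \<noteq> id i" using ik by simp
  hence tid: "?t \<noteq> id" by metis
  have zero: "(\<Prod>l\<in>{..<n} - {i} - {k}. if l = p l then 1 else 0 :: real) = 0"
    if p: "p permutes {..<n}" "p \<noteq> id" "p \<noteq> ?t" for p
  proof (rule ccontr)
    assume "\<not> ?thesis"
    hence fix1: "p l = l" if "l \<in> {..<n} - {i} - {k}" for l
      using that by (metis (mono_tags, lifting) finite_Diff finite_lessThan prod_zero)
    have fix2: "p l = l" if "l \<noteq> i" "l \<noteq> k" for l
      using fix1[of l] permutes_not_in[OF p(1), of l] that by (cases "l < n") auto
    have inj: "inj p" using p(1) by (rule permutes_inj)
    have im: "p l \<in> {i, k}" if "l \<in> {i, k}" for l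
    proof (rule ccontr)
      assume a: "p l \<notin> {i, k}"
      hence "p (p l) = p l" by (intro fix2) auto
      hence "p l = l" using inj by (simp add: inj_eq)
      thus False using a that by auto
    qed
    have ne: "p i \<noteq> p k" using inj ik by (simp add: inj_eq)
    show False
    proof (cases "p i = i")
      case True
      hence "p k = k" using im[of k] ne by auto
      hence "p = id" using True fix2 by (intro ext) (metis id_apply)
      thus False using p(2) by simp
    next
      case False
      hence "p i = k" "p k = i" using im[of i] im[of k] ne by auto
      hence "p = ?t" using fix2 by (intro ext) (auto simp: Transposition.transpose_def)
      thus False using p(3) by simp
    qed
  qed
  have "(\<Sum>p | p permutes {..<n}. f p * (\<Prod>l\<in>{..<n} - {i} - {k}. if l = p l then 1 else 0))
     = (\<Sum>p\<in>{id, ?t}. f p * (\<Prod>l\<in>{..<n} - {i} - {k}. if l = p l then 1 else 0))"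
  proof (rule sum.mono_neutral_right)
    show "finite {p. p permutes {..<n}}" by (simp add: finite_permutations)
    show "{id, ?t} \<subseteq> {p. p permutes {..<n}}" using t by (auto simp: permutes_id)
    show "\<forall>p\<in>{p. p permutes {..<n}} - {id, ?t}. f p * (\<Prod>l\<in>{..<n} - {i} - {k}. if l = p l then 1 else 0) = 0"
      using zero by auto
  qed
  also have "\<dots> = f id + f ?t * (\<Prod>l\<in>{..<n} - {i} - {k}. if l = ?t l then 1 else 0)"
  proof -
    have "(\<Prod>l\<in>{..<n} - {i} - {k}. if l = id l then 1 else 0 :: real) = 1" by simp
    thus ?thesis using tid by (simp only: sum.insert finite.intros sum.empty singleton_iff empty_iff not_False_eq_True mult_1_right add_0_right)
  qed
  also have "(\<Prod>l\<in>{..<n} - {i} - {k}. if l = ?t l then 1 else 0 :: real) = 1"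
    by (intro prod.neutral) (auto simp: Transposition.transpose_def)
  finally show ?thesis by (simp only: mult_1_right)
qed

text \<open>The mixed second derivative of det at the identity is tr B tr A - tr (B A): the first
  part comes from the identity, the second from the transpositions with their sign -1.\<close>

lemma DERIV_fdet_deriv_id:
  fixes A B :: "nat \<Rightarrow> nat \<Rightarrow> real"
  shows "((\<lambda>h. fdet_deriv n (\<lambda>i j. (if i = j then 1 else 0) + h * A i j) B) has_real_derivative
     (\<Sum>i<n. B i i) * (\<Sum>i<n. A i i) - (\<Sum>i<n. \<Sum>k<n. B i k * A k i)) (at 0)"
proof -
  let ?P = "{p. p permutes {..<n}}"
  have "((\<lambda>h. fdet_deriv n (\<lambda>i j. (if i = j then 1 else 0) + h * A i j) B) has_real_derivative
    (\<Sum>p\<in>?P. signof p * (\<Sum>i<n. B i (p i) * (\<Sum>k\<in>{..<n} - {i}. A k (p k) *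
        (\<Prod>l\<in>{..<n} - {i} - {k}. (if l = p l then 1 else 0) + 0 * A l (p l)))))) (at 0)"
    unfolding fdet_deriv_def
    by (intro DERIV_sum DERIV_cmult has_field_derivative_prod) (auto intro!: derivative_eq_intros)
  also have "(\<Sum>p\<in>?P. signof p * (\<Sum>i<n. B i (p i) * (\<Sum>k\<in>{..<n} - {i}. A k (p k) *
        (\<Prod>l\<in>{..<n} - {i} - {k}. (if l = p l then 1 else 0) + 0 * A l (p l)))))
    = (\<Sum>i<n. \<Sum>k\<in>{..<n} - {i}. \<Sum>p\<in>?P. (signof p * B i (p i) * A k (p k)) *
        (\<Prod>l\<in>{..<n} - {i} - {k}. if l = p l then 1 else 0))"
    unfolding sum_distrib_left
    by (subst sum.swap, intro sum.cong refl, subst sum.swap) (simp add: mult.assoc)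
  also have "\<dots> = (\<Sum>i<n. \<Sum>k\<in>{..<n} - {i}. B i i * A k k - B i k * A k i)"
    by (intro sum.cong refl, subst sum_fix_outside_pair) (auto simp: sign_swap_id)
  \<comment> \<open>The terms k = i that are added here are zero.\<close>
  also have "\<dots> = (\<Sum>i<n. \<Sum>k<n. B i i * A k k - B i k * A k i)"
    by (intro sum.cong refl sum.mono_neutral_left) auto
  also have "\<dots> = (\<Sum>i<n. B i i) * (\<Sum>i<n. A i i) - (\<Sum>i<n. \<Sum>k<n. B i k * A k i)"
    by (simp add: sum_subtractf sum_product)
  finally show ?thesis .
qed

section \<open>Logarithmic derivatives along a two-parameter pencil\<close>

definition pencil :: "(nat \<Rightarrow> nat \<Rightarrow> real) \<Rightarrow> (nat \<Rightarrow> nat \<Rightarrow> real) \<Rightarrow> real \<Rightarrow> real \<Rightarrow> nat \<Rightarrow> nat \<Rightarrow> real" where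
  "pencil A B h s i j = (if i = j then 1 else 0) + h * A i j + s * B i j"

lemma DERIV_fdet_pencil:
  "((\<lambda>s. fdet n (pencil A B h s)) has_real_derivative
     fdet_deriv n (\<lambda>i j. (if i = j then 1 else 0) + h * A i j) B) (at 0)"
proof -
  have "((\<lambda>s. fdet n (pencil A B h s)) has_real_derivative fdet_deriv n (pencil A B h 0) B) (at 0)"
    by (rule DERIV_fdet) (auto simp: pencil_def intro!: derivative_eq_intros)
  thus ?thesis by (simp add: pencil_def[abs_def])
qed

lemma DERIV_fdet_pencil_0:
  "((\<lambda>h. fdet n (pencil A B h 0)) has_real_derivative (\<Sum>i<n. A i i)) (at 0)"
proof -
  have "((\<lambda>h. fdet n (pencil A B h 0)) has_real_derivative fdet_deriv n (pencil A B 0 0) A) (at 0)"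
    by (rule DERIV_fdet) (auto simp: pencil_def intro!: derivative_eq_intros)
  thus ?thesis by (simp add: pencil_def[abs_def] fdet_deriv_id)
qed

lemma fdet_pencil_0_0 [simp]: "fdet n (pencil A B 0 0) = 1"
  using fdet_id[of n] by (simp add: pencil_def[abs_def])

lemma eventually_fdet_pencil_pos: "eventually (\<lambda>h. fdet n (pencil A B h 0) > 0) (nhds 0)"
proof -
  have "isCont (\<lambda>h. fdet n (pencil A B h 0)) 0"
    using DERIV_fdet_pencil_0 by (rule DERIV_isCont)
  hence "((\<lambda>h. fdet n (pencil A B h 0)) \<longlongrightarrow> 1) (nhds 0)"
    unfolding isCont_def by (subst (asm) tendsto_at_iff_tendsto_nhds) auto
  thus ?thesis by (rule order_tendstoD) simp
qed

lemma DERIV_log_deriv_pencil: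
  "((\<lambda>h. fdet_deriv n (\<lambda>i j. (if i = j then 1 else 0) + h * A i j) B / fdet n (pencil A B h 0))
     has_real_derivative - (\<Sum>i<n. \<Sum>k<n. B i k * A k i)) (at 0)"
  by (rule DERIV_cong[OF DERIV_divide[OF DERIV_fdet_deriv_id DERIV_fdet_pencil_0]])
     (simp_all add: fdet_deriv_id)

text \<open>For -ln det the products of traces cancel and tr (B A) remains, summed over the two
  blocks; the positive factor \<open>\<kappa>\<close> is an additive constant under the
  logarithm.\<close>

lemma deriv2_log_fdet:
  fixes A B :: "nat \<Rightarrow> nat \<Rightarrow> real"
  assumes "\<kappa> > 0"
  shows "deriv (\<lambda>h. deriv (\<lambda>s. - ln (\<kappa> * (fdet m (pencil A B h s) * fdet n (pencil A' B' h s)))) 0) 0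
    = (\<Sum>i<m. \<Sum>k<m. B i k * A k i) + (\<Sum>i<n. \<Sum>k<n. B' i k * A' k i)"
proof -
  let ?E = "\<lambda>n A B h. fdet_deriv n (\<lambda>i j. (if i = j then 1 else 0) + h * A i j) B"
  let ?D = "\<lambda>n A B h. fdet n (pencil A B h 0)"
  have inner: "deriv (\<lambda>s. - ln (\<kappa> * (fdet m (pencil A B h s) * fdet n (pencil A' B' h s)))) 0
      = - (?E m A B h / ?D m A B h) - ?E n A' B' h / ?D n A' B' h"
    if pos: "?D m A B h > 0" "?D n A' B' h > 0" for h
  proof (rule DERIV_imp_deriv)
    have *: "((\<lambda>s. \<kappa> * (fdet m (pencil A B h s) * fdet n (pencil A' B' h s))) has_real_derivative
        \<kappa> * (?E m A B h * ?D n A' B' h + ?E n A' B' h * ?D m A B h)) (at 0)"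
      by (intro DERIV_cmult DERIV_mult DERIV_fdet_pencil)
    have "\<kappa> * (?D m A B h * ?D n A' B' h) > 0" using assms pos by simp
    from DERIV_minus[OF DERIV_chain2[OF DERIV_ln[OF this] *]]
    show "((\<lambda>s. - ln (\<kappa> * (fdet m (pencil A B h s) * fdet n (pencil A' B' h s)))) has_real_derivative
      - (?E m A B h / ?D m A B h) - ?E n A' B' h / ?D n A' B' h) (at 0)"
      by (rule DERIV_cong) (use assms pos in \<open>simp add: field_simps\<close>)
  qed
  have "deriv (\<lambda>h. deriv (\<lambda>s. - ln (\<kappa> * (fdet m (pencil A B h s) * fdet n (pencil A' B' h s)))) 0) 0
    = deriv (\<lambda>h. - (?E m A B h / ?D m A B h) - ?E n A' B' h / ?D n A' B' h) 0"
  \<comment> \<open>The formula for the inner derivative holds only where both determinants are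
    positive, which is guaranteed for h near 0.\<close>
  proof (rule deriv_cong_ev)
    show "\<forall>\<^sub>F h in nhds 0. deriv (\<lambda>s. - ln (\<kappa> * (fdet m (pencil A B h s) * fdet n (pencil A' B' h s)))) 0
      = - (?E m A B h / ?D m A B h) - ?E n A' B' h / ?D n A' B' h"
      using eventually_conj[OF eventually_fdet_pencil_pos[of m A B] eventually_fdet_pencil_pos[of n A' B']]
      by eventually_elim (use inner in blast)
  qed simp
  also have "\<dots> = (\<Sum>i<m. \<Sum>k<m. B i k * A k i) + (\<Sum>i<n. \<Sum>k<n. B' i k * A' k i)"
    by (rule DERIV_imp_deriv,
        rule DERIV_cong[OF DERIV_diff[OF DERIV_minus[OF DERIV_log_deriv_pencil] DERIV_log_deriv_pencil]])
       simp
  finally show ?thesis .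
qed

section \<open>Quadratic forms on polynomials\<close>

definition poly_functional :: "(real poly \<Rightarrow> real) \<Rightarrow> bool" where
  "poly_functional L \<longleftrightarrow> (\<forall>p q. L (p + q) = L p + L q) \<and> (\<forall>c p. L (smult c p) = c * L p)"

lemma poly_functional_ell: "poly_functional (ell n x)"
  by (simp add: poly_functional_def ell_add ell_smult)

lemma poly_functional_add: "poly_functional L \<Longrightarrow> L (p + q) = L p + L q"
  and poly_functional_smult: "poly_functional L \<Longrightarrow> L (smult c p) = c * L p"
  by (simp_all add: poly_functional_def)

lemma poly_functional_0: "poly_functional L \<Longrightarrow> L 0 = 0"
  using poly_functional_smult[of L 0 0] by simp

lemma poly_functional_diff:
  assumes "poly_functional L" shows "L (p - q) = L p - L q"
  using poly_functional_add[OF assms, of p "smult (-1) q"] poly_functional_smult[OF assms, of "-1" q] by simp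

lemma poly_functional_sum:
  assumes "poly_functional L" shows "L (\<Sum>i\<in>A. f i) = (\<Sum>i\<in>A. L (f i))"
  by (induction A rule: infinite_finite_induct)
     (simp_all add: poly_functional_add[OF assms] poly_functional_0[OF assms])

definition gram :: "(real poly \<Rightarrow> real) \<Rightarrow> real poly \<Rightarrow> (nat \<Rightarrow> real poly) \<Rightarrow> nat \<Rightarrow> nat \<Rightarrow> real" where
  "gram L w f i j = L (w * (f i * f j))"

lemma gram_commute: "gram L w f i j = gram L w f j i"
  by (simp add: gram_def mult.commute)

definition frob :: "nat \<Rightarrow> (nat \<Rightarrow> nat \<Rightarrow> real) \<Rightarrow> real" where
  "frob m A = (\<Sum>i<m. \<Sum>j<m. (A i j)\<^sup>2)"

lemma frob_nonneg: "frob m A \<ge> 0"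
  by (simp add: frob_def sum_nonneg)

definition pos_def :: "(real poly \<Rightarrow> real) \<Rightarrow> real poly \<Rightarrow> nat \<Rightarrow> bool" where
  "pos_def L w m \<longleftrightarrow> (\<forall>p. degree p < m \<longrightarrow> p \<noteq> 0 \<longrightarrow> L (w * (p * p)) > 0)"

text \<open>The shape produced by Gram-Schmidt on monomials: the first m members span the
  polynomials of degree below m. The condition \<open>f i \<noteq> 0\<close> matters at i = 0, since
  the zero polynomial has degree 0.\<close>

definition graded :: "nat \<Rightarrow> (nat \<Rightarrow> real poly) \<Rightarrow> bool" where
  "graded m f \<longleftrightarrow> (\<forall>i<m. degree (f i) = i \<and> f i \<noteq> 0)"

definition orthonormal :: "(real poly \<Rightarrow> real) \<Rightarrow> real poly \<Rightarrow> nat \<Rightarrow> (nat \<Rightarrow> real poly) \<Rightarrow> bool" where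
  "orthonormal L w m f \<longleftrightarrow> graded m f \<and> (\<forall>i<m. \<forall>j<m. gram L w f i j = (if i = j then 1 else 0))"

lemma graded_expansion:
  assumes "graded m f" "degree p < m"
  shows "\<exists>c. p = (\<Sum>i<m. smult (c i) (f i))"
  using assms
proof (induction m arbitrary: p)
  case (Suc m)
  have m: "degree (f m) = m" "f m \<noteq> 0" using Suc.prems(1) by (auto simp: graded_def)
  have gr: "graded m f" using Suc.prems(1) by (auto simp: graded_def)
  define d where "d = coeff p m / coeff (f m) m"
  define r where "r = p - smult d (f m)"
  have lc: "coeff (f m) m \<noteq> 0" using m by (metis leading_coeff_0_iff)
  have rm: "coeff r m = 0" using lc by (simp add: r_def d_def)
  have dr: "degree r \<le> m" unfolding r_def using Suc.prems(2) m by (intro degree_diff_le) auto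
  have "\<exists>c. r = (\<Sum>i<m. smult (c i) (f i))"
  proof (cases "r = 0")
    case True thus ?thesis by (intro exI[of _ "\<lambda>_. 0"]) simp
  next
    case False
    hence "degree r \<noteq> m" using rm by (metis leading_coeff_0_iff)
    thus ?thesis using dr Suc.IH[OF gr] by simp
  qed
  then obtain c where c: "r = (\<Sum>i<m. smult (c i) (f i))" by blast
  have "p = (\<Sum>i<Suc m. smult ((c(m := d)) i) (f i))"
    using c by (simp add: r_def algebra_simps)
  thus ?case by blast
qed simp

lemma functional_expand:
  assumes "poly_functional L"
  shows "L (w * ((\<Sum>i<m. smult (c i) (f i)) * (\<Sum>j<k. smult (d j) (g j))))
    = (\<Sum>i<m. \<Sum>j<k. c i * d j * L (w * (f i * g j)))"
proof -
  have "w * ((\<Sum>i<m. smult (c i) (f i)) * (\<Sum>j<k. smult (d j) (g j)))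
    = (\<Sum>i<m. \<Sum>j<k. smult (c i * d j) (w * (f i * g j)))"
    unfolding sum_product unfolding sum_distrib_left by (intro sum.cong refl) (simp add: ac_simps)
  thus ?thesis by (simp only: poly_functional_sum[OF assms] poly_functional_smult[OF assms])
qed

lemma functional_expand_left:
  assumes "poly_functional L"
  shows "L (w * ((\<Sum>i<m. smult (c i) (f i)) * q)) = (\<Sum>i<m. c i * L (w * (f i * q)))"
proof -
  have "w * ((\<Sum>i<m. smult (c i) (f i)) * q) = (\<Sum>i<m. smult (c i) (w * (f i * q)))"
    unfolding sum_distrib_right unfolding sum_distrib_left by simp
  thus ?thesis by (simp only: poly_functional_sum[OF assms] poly_functional_smult[OF assms])
qed

lemma orthonormal_expansion:
  assumes L: "poly_functional L" and f: "orthonormal L w m f" and p: "degree p < m"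
  shows "p = (\<Sum>i<m. smult (L (w * (p * f i))) (f i))"
proof -
  obtain c where c: "p = (\<Sum>i<m. smult (c i) (f i))"
    using graded_expansion[OF _ p] f by (auto simp: orthonormal_def)
  have "L (w * (p * f j)) = c j" if j: "j < m" for j
  proof -
    have "L (w * (p * f j)) = (\<Sum>i<m. c i * gram L w f i j)"
      using functional_expand_left[OF L, of w c f m "f j"]
      by (simp add: c[symmetric] gram_def)
    also have "\<dots> = (\<Sum>i<m. c i * (if i = j then 1 else 0))"
      using f j by (intro sum.cong) (auto simp: orthonormal_def)
    also have "\<dots> = c j" using j by (simp add: if_distrib sum.delta cong: if_cong)
    finally show ?thesis .
  qed
  thus ?thesis using c by simp
qed

lemma orthonormal_functional_expand:
  assumes L: "poly_functional L" and f: "orthonormal L w m f"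
    and M: "poly_functional M" and p: "degree p < m" "degree q < m"
  shows "M (w * (p * q)) = (\<Sum>i<m. \<Sum>j<m. L (w * (p * f i)) * L (w * (q * f j)) * gram M w f i j)"
  unfolding gram_def
  by (subst functional_expand[OF M, symmetric])
     (use orthonormal_expansion[OF L f p(1)] orthonormal_expansion[OF L f p(2)] in simp)

lemma orthonormal_parseval:
  assumes L: "poly_functional L" and f: "orthonormal L w m f" and p: "degree p < m" "degree q < m"
  shows "L (w * (p * q)) = (\<Sum>i<m. L (w * (p * f i)) * L (w * (q * f i)))"
proof -
  have "L (w * (p * q)) = (\<Sum>i<m. \<Sum>j<m. L (w * (p * f i)) * L (w * (q * f j)) * (if i = j then 1 else 0))"
    unfolding orthonormal_functional_expand[OF L f L p]
    by (intro sum.cong refl) (use f in \<open>auto simp: orthonormal_def\<close>)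
  thus ?thesis by (simp add: if_distrib sum.delta cong: if_cong)
qed

lemma sum_mult_le_frob:
  "(\<Sum>i<m. \<Sum>j<m. A i j * B i j)\<^sup>2 \<le> frob m A * frob m B"
proof -
  have "(\<Sum>z\<in>{..<m} \<times> {..<m}. A (fst z) (snd z) * B (fst z) (snd z))\<^sup>2
    \<le> (\<Sum>z\<in>{..<m} \<times> {..<m}. (A (fst z) (snd z))\<^sup>2) * (\<Sum>z\<in>{..<m} \<times> {..<m}. (B (fst z) (snd z))\<^sup>2)"
    by (rule Cauchy_Schwarz_ineq_sum)
  thus ?thesis by (simp add: frob_def sum.cartesian_product case_prod_beta)
qed

text \<open>With c the coordinates of p, M(w p^2) is the Frobenius product of the Gram matrix of M
  with c c^T, whose Frobenius norm is |c|^2 = L(w p^2). So the norm of the Gram matrix bounds M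
  relative to L.\<close>

lemma abs_functional_le_frob:
  assumes L: "poly_functional L" and f: "orthonormal L w m f"
    and M: "poly_functional M" and p: "degree p < m"
  shows "\<bar>M (w * (p * p))\<bar> \<le> sqrt (frob m (gram M w f)) * L (w * (p * p))"
proof -
  define c where "c i = L (w * (p * f i))" for i
  have Lp: "L (w * (p * p)) = (\<Sum>i<m. (c i)\<^sup>2)"
    using orthonormal_parseval[OF L f p p] by (simp add: c_def power2_eq_square)
  hence Lp0: "L (w * (p * p)) \<ge> 0" by (simp add: sum_nonneg)
  have "frob m (\<lambda>i j. c i * c j) = (L (w * (p * p)))\<^sup>2"
    by (simp add: frob_def Lp power_mult_distrib power2_eq_square[of "sum _ _"] sum_product)
  hence "(M (w * (p * p)))\<^sup>2 \<le> (L (w * (p * p)))\<^sup>2 * frob m (gram M w f)"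
    using sum_mult_le_frob[of "\<lambda>i j. c i * c j" "gram M w f" m]
    by (simp add: orthonormal_functional_expand[OF L f M p p] c_def)
  hence "sqrt ((M (w * (p * p)))\<^sup>2) \<le> sqrt ((L (w * (p * p)))\<^sup>2 * frob m (gram M w f))"
    by (rule real_sqrt_le_mono)
  thus ?thesis using Lp0 by (simp add: real_sqrt_mult mult.commute)
qed

lemma orthonormal_imp_pos_def:
  assumes L: "poly_functional L" and f: "orthonormal L w m f"
  shows "pos_def L w m"
  unfolding pos_def_def
proof (intro allI impI)
  fix p :: "real poly" assume p: "degree p < m" "p \<noteq> 0"
  have "\<exists>i<m. L (w * (p * f i)) \<noteq> 0"
  proof (rule ccontr)
    assume "\<not> ?thesis"
    hence "p = 0" by (subst orthonormal_expansion[OF L f p(1)]) simp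
    with p(2) show False by simp
  qed
  then obtain i where "i < m" "L (w * (p * f i)) \<noteq> 0" by blast
  hence "(\<Sum>i<m. L (w * (p * f i)) * L (w * (p * f i))) > 0"
    by (intro sum_pos2[of _ i]) (auto simp: zero_less_mult_iff)
  thus "L (w * (p * p)) > 0" using orthonormal_parseval[OF L f p(1) p(1)] by simp
qed

text \<open>Gram-Schmidt: the monomial of degree m minus its projection keeps leading coefficient 1,
  so its square norm is positive and it can be normalised.\<close>

lemma pos_def_imp_orthonormal:
  assumes L: "poly_functional L" and "pos_def L w m"
  shows "\<exists>f. orthonormal L w m f"
  using assms(2)
proof (induction m)
  case 0 thus ?case by (simp add: orthonormal_def graded_def)
next
  case (Suc m)
  have "pos_def L w m" using Suc.prems by (auto simp: pos_def_def)
  then obtain f where f: "orthonormal L w m f" using Suc.IH by blast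
  define x where "x = (monom 1 m :: real poly)"
  define s where "s = (\<Sum>i<m. smult (L (w * (x * f i))) (f i))"
  define r where "r = x - s"
  have "coeff s m = 0"
    unfolding s_def coeff_sum
    using f by (intro sum.neutral) (auto simp: orthonormal_def graded_def coeff_eq_0)
  hence rm: "coeff r m = 1" by (simp add: r_def x_def)
  have "degree s \<le> m" unfolding s_def
    using f by (intro degree_sum_le) (auto simp: orthonormal_def graded_def)
  hence "degree r \<le> m" unfolding r_def x_def
    by (intro degree_diff_le) (auto simp: degree_monom_eq)
  hence dr: "degree r = m" "r \<noteq> 0" using rm le_degree[of r m] by auto
  define N where "N = L (w * (r * r))"
  have N: "N > 0" using Suc.prems dr by (simp add: pos_def_def N_def)
  have orth: "L (w * (r * f j)) = 0" if j: "j < m" for j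
  proof -
    have "L (w * (s * f j)) = (\<Sum>i<m. L (w * (x * f i)) * gram L w f i j)"
      using functional_expand_left[OF L, of w "\<lambda>i. L (w * (x * f i))" f m "f j"]
      by (simp add: s_def[symmetric] gram_def)
    also have "\<dots> = (\<Sum>i<m. L (w * (x * f i)) * (if i = j then 1 else 0))"
      using f j by (intro sum.cong) (auto simp: orthonormal_def)
    also have "\<dots> = L (w * (x * f j))" using j by (simp add: if_distrib sum.delta cong: if_cong)
    finally show ?thesis
      by (simp add: r_def left_diff_distrib right_diff_distrib poly_functional_diff[OF L])
  qed
  define g where "g i = (if i = m then smult (1 / sqrt N) r else f i)" for i
  have gm: "gram L w g i j = (if i = j then 1 else 0)" if ij: "i < Suc m" "j < Suc m" for i j
  proof -
    have 1: "gram L w g m m = 1"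
    proof -
      have "1 / sqrt N * (1 / sqrt N * N) = 1" using N by (simp add: field_simps)
      thus ?thesis by (simp add: gram_def g_def poly_functional_smult[OF L] flip: N_def)
    qed
    have 2: "gram L w g m j = 0" if "j < m" for j
      using that orth[OF that] by (simp add: gram_def g_def poly_functional_smult[OF L])
    have 3: "gram L w g j m = 0" if "j < m" for j
      using 2[OF that] gram_commute by metis
    have 4: "gram L w g i j = (if i = j then 1 else 0)" if "i < m" "j < m"
      using that f by (simp add: gram_def g_def orthonormal_def)
    show ?thesis using ij 1 2 3 4 by (auto simp: less_Suc_eq)
  qed
  have "graded (Suc m) g"
    using f dr N by (auto simp: graded_def g_def orthonormal_def less_Suc_eq)
  thus ?case using gm by (auto simp: orthonormal_def)
qed

section \<open>Gram determinants under a change of basis\<close>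

lemma fdet_mult: "fdet m (\<lambda>i j. \<Sum>k<m. A i k * B k j) = fdet m A * fdet m B"
proof -
  have "mat m m (\<lambda>(i, j). \<Sum>k<m. A i k * B k j) = mat m m (\<lambda>(i, j). A i j) * mat m m (\<lambda>(i, j). B i j)"
    by (intro eq_matI) (auto simp: scalar_prod_def lessThan_atLeast0)
  thus ?thesis unfolding fdet_def by (simp add: det_mult[where n = m])
qed

lemma fdet_transpose: "fdet m (\<lambda>i j. A j i) = fdet m A"
proof -
  have "mat m m (\<lambda>(i, j). A j i) = transpose_mat (mat m m (\<lambda>(i, j). A i j))"
    by (intro eq_matI) auto
  thus ?thesis unfolding fdet_def by (simp add: det_transpose[where n = m])
qed

text \<open>Gram matrices change by congruence, G to P G P^T. The factor (det P)^2 does not depend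
  on the functional M, so it drops out of derivatives of ln det and of comparisons between
  determinants.\<close>

lemma fdet_gram_change_basis:
  assumes L: "poly_functional L" and f: "orthonormal L w m f" and M: "poly_functional M"
    and g: "\<And>i. i < m \<Longrightarrow> degree (g i) < m"
  shows "fdet m (gram M w g) = (fdet m (\<lambda>i j. L (w * (g i * f j))))\<^sup>2 * fdet m (gram M w f)"
proof -
  define P where "P i j = L (w * (g i * f j))" for i j
  have "fdet m (gram M w g) = fdet m (\<lambda>i j. \<Sum>k<m. P i k * (\<Sum>l<m. gram M w f k l * P j l))"
  proof (rule fdet_cong)
    fix i j assume "i < m" "j < m"
    thus "gram M w g i j = (\<Sum>k<m. P i k * (\<Sum>l<m. gram M w f k l * P j l))"
      unfolding gram_def[of M w g] using g
      by (subst orthonormal_functional_expand[OF L f M])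
         (simp_all add: P_def sum_distrib_left ac_simps)
  qed
  also have "\<dots> = fdet m P * (fdet m (gram M w f) * fdet m P)"
    unfolding fdet_mult[of m P] fdet_mult[of m _ "\<lambda>l j. P j l"] fdet_transpose[of m P] ..
  finally show ?thesis by (simp add: P_def[abs_def] power2_eq_square)
qed

text \<open>The coefficients of the f in terms of the g form a left inverse of the transition
  matrix.\<close>

lemma fdet_change_basis_nonzero:
  assumes L: "poly_functional L" and f: "orthonormal L w m f"
    and span: "\<And>a. a < m \<Longrightarrow> \<exists>c. f a = (\<Sum>i<m. smult (c i) (g i))"
  shows "fdet m (\<lambda>i j. L (w * (g i * f j))) \<noteq> 0"
proof -
  obtain Q where Q: "f a = (\<Sum>i<m. smult (Q a i) (g i))" if "a < m" for a
    using span by metis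
  have "fdet m (\<lambda>a b. \<Sum>i<m. Q a i * L (w * (g i * f b))) = fdet m (\<lambda>i j. if i = j then 1 else 0)"
  proof (rule fdet_cong)
    fix a b assume ab: "a < m" "b < m"
    have "L (w * (f a * f b)) = (\<Sum>i<m. Q a i * L (w * (g i * f b)))"
      using functional_expand_left[OF L, of w "Q a" g m "f b"] Q[OF ab(1)] by simp
    thus "(\<Sum>i<m. Q a i * L (w * (g i * f b))) = (if a = b then 1 else 0)"
      using f ab by (auto simp: orthonormal_def gram_def)
  qed
  hence "fdet m Q * fdet m (\<lambda>i j. L (w * (g i * f j))) = 1"
    by (simp add: fdet_mult fdet_id)
  thus ?thesis by auto
qed

text \<open>A positive semidefinite form vanishing on the diagonal at \<open>p\<close> vanishes against \<open>p\<close>, so \<open>p\<close>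
  would give a kernel vector of the Gram matrix.\<close>

lemma pos_semidef_imp_pos_def:
  assumes L: "poly_functional L" and f: "graded m f"
    and psd: "\<And>p. degree p < m \<Longrightarrow> L (w * (p * p)) \<ge> 0"
    and det: "fdet m (gram L w f) \<noteq> 0"
  shows "pos_def L w m"
  unfolding pos_def_def
proof (intro allI impI, rule ccontr)
  fix p assume p: "degree p < m" "p \<noteq> 0" "\<not> L (w * (p * p)) > 0"
  hence p0: "L (w * (p * p)) = 0" using psd[of p] by simp
  have pq: "L (w * (p * q)) = 0" if q: "degree q < m" for q
  proof -
    define a where "a = L (w * (p * q))"
    define b where "b = L (w * (q * q))"
    have "2 * s * a + s\<^sup>2 * b \<ge> 0" for s
    proof -
      have "degree (p + smult s q) < m" using p q by (intro degree_add_less) auto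
      hence "L (w * ((p + smult s q) * (p + smult s q))) \<ge> 0" by (rule psd)
      also have "w * ((p + smult s q) * (p + smult s q))
        = w * (p * p) + smult s (w * (p * q)) + smult s (w * (p * q)) + smult (s\<^sup>2) (w * (q * q))"
        by (simp add: algebra_simps power2_eq_square)
      finally show ?thesis
        by (simp only: poly_functional_add[OF L] poly_functional_smult[OF L] p0 a_def b_def)
    qed
    note quad = this
    have b: "b \<ge> 0" using psd[OF q] by (simp add: b_def)
    \<comment> \<open>With this choice the quadratic at s = -t equals -t^2 (b + 2); the added 1
      avoids dividing by b = 0.\<close>
    define t where "t = a / (b + 1)"
    have a: "a = t * (b + 1)" using b by (simp add: t_def)
    have "t\<^sup>2 * (b + 2) \<le> 0"
      using quad[of "- t"] by (simp add: a algebra_simps power2_eq_square)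
    hence "t = 0" using b by (simp add: mult_le_0_iff)
    hence "a = 0" by (simp add: a)
    thus ?thesis by (simp add: a_def)
  qed
  obtain c where c: "p = (\<Sum>i<m. smult (c i) (f i))"
    using graded_expansion[OF f p(1)] by blast
  define A where "A = mat m m (\<lambda>(i, j). gram L w f i j)"
  define v where "v = vec m c"
  have "A *\<^sub>v v = 0\<^sub>v m"
  proof (rule eq_vecI)
    fix i assume "i < dim_vec (0\<^sub>v m :: real vec)"
    hence i: "i < m" by simp
    have "(A *\<^sub>v v) $ i = (\<Sum>j<m. c j * L (w * (f i * f j)))"
      using i by (simp add: A_def v_def scalar_prod_def lessThan_atLeast0 gram_def mult.commute)
    also have "\<dots> = L (w * (p * f i))"
      using functional_expand_left[OF L, of w c f m "f i"]
      by (simp add: c[symmetric] mult.commute)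
    also have "\<dots> = 0" using f i by (intro pq) (simp add: graded_def)
    finally show "(A *\<^sub>v v) $ i = 0\<^sub>v m $ i" using i by simp
  qed (simp add: A_def)
  moreover have "v \<noteq> 0\<^sub>v m"
  proof
    assume "v = 0\<^sub>v m"
    hence "c i = 0" if "i < m" for i using that by (metis v_def index_vec index_zero_vec(1))
    hence "p = 0" using c by simp
    thus False using p by simp
  qed
  ultimately have "det A = 0"
    using det_0_iff_vec_prod_zero[of A m] mat_carrier[of m m] vec_carrier[of m c]
    unfolding A_def v_def by blast
  thus False using det by (simp add: fdet_def A_def)
qed

text \<open>Both sides are tr (Q^2) - 2 tr Q + m, with Q = P^T P and Q = P P^T respectively, and the
  two matrices have the same traces.\<close>

lemma frob_transpose_product:
  fixes P :: "nat \<Rightarrow> nat \<Rightarrow> real"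
  shows "frob m (\<lambda>b c. (\<Sum>a<m. P a b * P a c) - (if b = c then 1 else 0))
       = frob m (\<lambda>a c. (\<Sum>b<m. P a b * P c b) - (if a = c then 1 else 0))"
proof -
  have expand: "frob m (\<lambda>b c. S b c - (if b = c then 1 else 0)) = frob m S - 2 * (\<Sum>b<m. S b b) + real m" for S
  proof -
    have "(\<Sum>c<m. (S b c - (if b = c then 1 else 0))\<^sup>2) = (\<Sum>c<m. (S b c)\<^sup>2) - 2 * S b b + 1" if "b < m" for b
    proof -
      have "(S b c - (if b = c then 1 else 0))\<^sup>2 = (S b c)\<^sup>2 - (if b = c then 2 * S b b - 1 else 0)" for c
        by (auto simp: power2_eq_square algebra_simps)
      thus ?thesis using that by (simp add: sum_subtractf sum.delta)
    qed
    thus ?thesis by (simp add: frob_def sum.distrib sum_subtractf sum_distrib_left)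
  qed
  have "frob m (\<lambda>b c. \<Sum>a<m. P a b * P a c)
    = (\<Sum>b<m. \<Sum>c<m. \<Sum>a<m. \<Sum>d<m. (P a b * P a c) * (P d b * P d c))"
    by (simp add: frob_def power2_eq_square sum_product)
  also have "\<dots> = (\<Sum>b<m. \<Sum>a<m. \<Sum>c<m. \<Sum>d<m. (P a b * P a c) * (P d b * P d c))"
    by (rule sum.cong[OF refl], rule sum.swap)
  also have "\<dots> = (\<Sum>a<m. \<Sum>b<m. \<Sum>c<m. \<Sum>d<m. (P a b * P a c) * (P d b * P d c))"
    by (rule sum.swap)
  also have "\<dots> = (\<Sum>a<m. \<Sum>b<m. \<Sum>d<m. \<Sum>c<m. (P a b * P a c) * (P d b * P d c))"
    by (rule sum.cong[OF refl], rule sum.cong[OF refl], rule sum.swap)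
  also have "\<dots> = (\<Sum>a<m. \<Sum>d<m. \<Sum>b<m. \<Sum>c<m. (P a b * P a c) * (P d b * P d c))"
    by (rule sum.cong[OF refl], rule sum.swap)
  also have "\<dots> = frob m (\<lambda>a d. \<Sum>b<m. P a b * P d b)"
    unfolding frob_def power2_eq_square sum_product
    by (intro sum.cong refl) (simp only: mult_ac)
  finally have fr: "frob m (\<lambda>b c. \<Sum>a<m. P a b * P a c) = frob m (\<lambda>a d. \<Sum>b<m. P a b * P d b)" .
  have "(\<Sum>b<m. \<Sum>a<m. P a b * P a b) = (\<Sum>a<m. \<Sum>b<m. P a b * P a b)"
    by (rule sum.swap)
  with fr show ?thesis unfolding expand by linarith
qed

section \<open>The Hessian of the barrier\<close>

lemma inj_cheb: "inj_on cheb A"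
  by (metis degree_cheb inj_onI)

lemma ordered_basis_length:
  assumes "ordered_basis k ps" shows "length ps = Suc k"
proof -
  let ?C = "cheb ` {..<Suc k}"
  have "real_poly.independent ?C"
  proof
    assume "real_poly.dependent ?C"
    then obtain u where u: "\<exists>v\<in>?C. u v \<noteq> 0" "(\<Sum>v\<in>?C. smult (u v) v) = 0"
      by (subst (asm) real_poly.dependent_finite) auto
    have "(\<Sum>i<Suc k. smult (u (cheb i)) (cheb i)) = 0"
      using u(2) by (subst (asm) sum.reindex[OF inj_cheb]) simp
    hence "u (cheb i) = 0" if "i < Suc k" for i
      using cheb_sum_inj[of "\<lambda>i. u (cheb i)"] that by blast
    thus False using u(1) by auto
  qed
  moreover have "real_poly.span ?C = poly_space k"
  proof -
    have "real_poly.span ?C = range (\<lambda>u. \<Sum>v\<in>?C. smult (u v) v)"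
      by (rule real_poly.span_finite) simp
    also have "\<dots> = poly_space k"
    proof (intro equalityI subsetI)
      fix p assume "p \<in> range (\<lambda>u. \<Sum>v\<in>?C. smult (u v) v)"
      then obtain u where "p = (\<Sum>v\<in>?C. smult (u v) v)" by blast
      thus "p \<in> poly_space k" unfolding poly_space_def
        by (auto intro!: degree_sum_le order_trans[OF degree_smult_le])
    next
      fix p assume "p \<in> poly_space k"
      then obtain a where a: "p = (\<Sum>i<Suc k. smult (a i) (cheb i))"
        using cheb_sum_surj[of p "Suc k"] by (auto simp: poly_space_def)
      hence "p = (\<Sum>v\<in>?C. smult (a (the_inv_into {..<Suc k} cheb v)) v)" (is "_ = (\<Sum>v\<in>?C. smult (?u v) v)")
        by (subst sum.reindex[OF inj_cheb])
           (auto simp: the_inv_into_f_f[OF inj_cheb] intro!: sum.cong)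
      thus "p \<in> range (\<lambda>u. \<Sum>v\<in>?C. smult (u v) v)" by (rule range_eqI[where x = ?u])
    qed
    finally show ?thesis .
  qed
  ultimately obtain b where "bij_betw b (set ps) ?C"
    using real_poly.bij_if_span_eq_span_bases[of "set ps" ?C] assms by (auto simp: ordered_basis_def)
  hence "card (set ps) = Suc k"
    using bij_betw_same_card card_image[OF inj_cheb] by fastforce
  thus ?thesis using assms distinct_card by (metis ordered_basis_def)
qed

lemma ordered_basis_degree:
  assumes "ordered_basis k ps" "i < Suc k" shows "degree (ps ! i) < Suc k"
proof -
  have "ps ! i \<in> real_poly.span (set ps)"
    using assms ordered_basis_length[OF assms(1)] by (intro real_poly.span_base) simp
  thus ?thesis using assms(1) by (auto simp: ordered_basis_def poly_space_def)
qed

lemma ordered_basis_expansion: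
  assumes ps: "ordered_basis k ps" and q: "degree q < Suc k"
  shows "\<exists>c. q = (\<Sum>i<Suc k. smult (c i) (ps ! i))"
proof -
  have "q \<in> real_poly.span (set ps)" using ps q by (auto simp: ordered_basis_def poly_space_def)
  then obtain u where u: "q = (\<Sum>v\<in>set ps. smult (u v) v)"
    by (subst (asm) real_poly.span_finite) auto
  have "bij_betw ((!) ps) {..<Suc k} (set ps)"
    using ps ordered_basis_length[OF ps] by (intro bij_betw_nth) (auto simp: ordered_basis_def)
  hence "q = (\<Sum>i<Suc k. smult (u (ps ! i)) (ps ! i))"
    unfolding u by (rule sum.reindex_bij_betw[symmetric])
  thus ?thesis by (rule exI[where x = "\<lambda>i. u (ps ! i)"])
qed

section \<open>The operators \<Lambda>_i as Gram matrices\<close>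

abbreviation vell :: "real vec \<Rightarrow> real poly \<Rightarrow> real" where
  "vell x \<equiv> ell (dim_vec x) (vec_index x)"

lemma vell_add: "x \<in> carrier_vec n \<Longrightarrow> y \<in> carrier_vec n \<Longrightarrow> vell (x + y) p = vell x p + vell y p"
  by (auto simp flip: ell_arg_add intro: ell_cong)

lemma vell_diff: "x \<in> carrier_vec n \<Longrightarrow> y \<in> carrier_vec n \<Longrightarrow> vell (x - y) p = vell x p - vell y p"
  by (auto simp flip: ell_arg_diff intro: ell_cong)

lemma vell_smult: "vell (c \<cdot>\<^sub>v x) p = c * vell x p"
  by (auto simp flip: ell_arg_scale intro: ell_cong)

lemma vell_unit_vec: "i < n \<Longrightarrow> vell (unit_vec n i) p = cheb_coeff n i p"
  by (simp add: ell_def unit_vec_def sum.delta if_distrib[of "\<lambda>a. a * _"] cong: if_cong)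

lemma vell_cheb_poly: "x \<in> carrier_vec n \<Longrightarrow> y \<in> carrier_vec n \<Longrightarrow> vell y (cheb_poly x) = x \<bullet> y"
  by (auto simp: ell_cheb_poly scalar_prod_def lessThan_atLeast0 mult.commute)

text \<open>The Gram matrices satisfy the four defining conditions of \<Lambda>_i, the last one
  because q(z) is evaluation at z; uniqueness then resolves the definite description.\<close>

lemma Lambda_op_eq_gram:
  assumes ps: "ordered_basis k ps" and deg: "degree w + 2 * k < n" and x: "x \<in> carrier_vec n"
  shows "Lambda_op n w ps x = mat (Suc k) (Suc k) (\<lambda>(i, j). gram (vell x) w ((!) ps) i j)"
proof -
  define L where "L x = mat (Suc k) (Suc k) (\<lambda>(i, j). gram (vell x) w ((!) ps) i j)" for x
  have len: "length ps = Suc k" by (rule ordered_basis_length[OF ps])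
  have dg: "degree (w * (ps ! i * ps ! j)) < n" if "i < Suc k" "j < Suc k" for i j
    using ordered_basis_degree[OF ps that(1)] ordered_basis_degree[OF ps that(2)] deg
      degree_mult_le[of w "ps ! i * ps ! j"] degree_mult_le[of "ps ! i" "ps ! j"] by linarith
  have "is_Lambda n w ps L"
    unfolding is_Lambda_def len
  proof (intro conjI ballI allI)
    fix x :: "real vec"
    show "L x \<in> carrier_mat (Suc k) (Suc k)" by (simp add: L_def)
    show "transpose_mat (L x) = L x"
      by (intro eq_matI) (auto simp: L_def gram_commute)
  next
    fix x y :: "real vec" assume xy: "x \<in> carrier_vec n" "y \<in> carrier_vec n"
    show "L (x + y) = L x + L y"
      by (intro eq_matI) (simp_all add: L_def gram_def vell_add[OF xy, simplified])
  next
    fix c and x :: "real vec"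
    show "L (c \<cdot>\<^sub>v x) = c \<cdot>\<^sub>m L x"
      by (intro eq_matI) (simp_all add: L_def gram_def vell_smult[simplified])
  next
    fix z
    have "vell (cheb_vec n z) p = poly p z" if "degree p < n" for p
    proof -
      have "vell (cheb_vec n z) p = ell n (\<lambda>i. poly (cheb i) z) p"
        unfolding cheb_vec_def dim_vec by (rule ell_cong) simp
      thus ?thesis using ell_cheb_vec[OF that] by simp
    qed
    thus "L (cheb_vec n z) =
        mat (Suc k) (Suc k) (\<lambda>(i, j). poly w z * (poly (ps ! i) z * poly (ps ! j) z))"
      by (intro eq_matI) (auto simp: L_def gram_def dg)
  qed
  from Lambda_op_unique[OF ps deg this x] show ?thesis by (simp add: L_def)
qed

abbreviation m1 :: "nat \<Rightarrow> nat" where "m1 D \<equiv> Suc (d1 D)"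
abbreviation m2 :: "nat \<Rightarrow> nat" where "m2 D \<equiv> Suc (d2 D)"

lemma weight_degrees:
  assumes "D \<ge> 1"
  shows "degree (w1 D) + 2 * d1 D < D + 1" "degree (w2 D) + 2 * d2 D < D + 1"
  using assms by (auto simp: w1_def w2_def d1_def d2_def elim!: evenE oddE)

text \<open>The size of \<Lambda> equals the dimension of the space. This common number is the
  degree of homogeneity of det \<Lambda> and the constant in the gradient equation.\<close>

lemma m1_m2: "D \<ge> 1 \<Longrightarrow> m1 D + m2 D = D + 1"
  by (auto simp: d1_def d2_def elim!: evenE oddE)

lemma det_Lambda:
  assumes D: "D \<ge> 1" and p1: "ordered_basis (d1 D) p1" and p2: "ordered_basis (d2 D) p2"
    and x: "x \<in> carrier_vec (D + 1)"
  shows "det (Lambda D p1 p2 x) = fdet (m1 D) (gram (vell x) (w1 D) ((!) p1)) * fdet (m2 D) (gram (vell x) (w2 D) ((!) p2))"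
proof -
  define A where "A = mat (m1 D) (m1 D) (\<lambda>(i, j). gram (vell x) (w1 D) ((!) p1) i j)"
  define B where "B = mat (m2 D) (m2 D) (\<lambda>(i, j). gram (vell x) (w2 D) ((!) p2) i j)"
  have "Lambda D p1 p2 x = diag_block_mat [A, B]"
    unfolding Lambda_def A_def B_def
    using Lambda_op_eq_gram[OF p1 weight_degrees(1)[OF D] x] Lambda_op_eq_gram[OF p2 weight_degrees(2)[OF D] x]
    by simp
  also have "\<dots> = four_block_mat A (0\<^sub>m (m1 D) (m2 D)) (0\<^sub>m (m2 D) (m1 D)) B"
    by (simp only: diag_block_mat.simps(2)[of A "[B]"] Let_def diag_block_mat_singleton)
       (simp add: A_def B_def)
  also have "det \<dots> = det A * det B"
    by (rule det_four_block_mat_lower_left_zero[where n = "m1 D" and m = "m2 D"]) (simp_all add: A_def B_def)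
  finally show ?thesis by (simp add: fdet_def A_def B_def)
qed

definition onb :: "nat \<Rightarrow> real vec \<Rightarrow> (nat \<Rightarrow> real poly) \<Rightarrow> (nat \<Rightarrow> real poly) \<Rightarrow> bool" where
  "onb D x f1 f2 \<longleftrightarrow> orthonormal (vell x) (w1 D) (m1 D) f1 \<and> orthonormal (vell x) (w2 D) (m2 D) f2"

text \<open>The given bases enter the barrier only through \<open>\<kappa>\<close>, the squared
  determinants of the transition to \<open>f1\<close>, \<open>f2\<close>. All derivatives at
  \<open>x\<close> can thus be taken at the identity matrix, and nothing later depends on the choice
  of \<open>p1\<close>, \<open>p2\<close>.\<close>

lemma barrier_eq:
  assumes D: "D \<ge> 1" and p1: "ordered_basis (d1 D) p1" and p2: "ordered_basis (d2 D) p2"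
    and f: "onb D x f1 f2"
  shows "\<exists>\<kappa>>0. \<forall>y\<in>carrier_vec (D + 1). barrier D p1 p2 y
    = - ln (\<kappa> * (fdet (m1 D) (gram (vell y) (w1 D) f1) * fdet (m2 D) (gram (vell y) (w2 D) f2)))"
proof -
  define c1 where "c1 = fdet (m1 D) (\<lambda>i j. vell x (w1 D * (p1 ! i * f1 j)))"
  define c2 where "c2 = fdet (m2 D) (\<lambda>i j. vell x (w2 D * (p2 ! i * f2 j)))"
  have f1: "orthonormal (vell x) (w1 D) (m1 D) f1" and f2: "orthonormal (vell x) (w2 D) (m2 D) f2"
    using f by (auto simp: onb_def)
  have deg: "degree (f1 a) < m1 D" if "a < m1 D" for a
    using f1 that by (simp add: orthonormal_def graded_def)
  have deg2: "degree (f2 a) < m2 D" if "a < m2 D" for a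
    using f2 that by (simp add: orthonormal_def graded_def)
  have "c1 \<noteq> 0" unfolding c1_def
    by (rule fdet_change_basis_nonzero[OF poly_functional_ell f1])
       (use deg ordered_basis_expansion[OF p1] in blast)
  moreover have "c2 \<noteq> 0" unfolding c2_def
    by (rule fdet_change_basis_nonzero[OF poly_functional_ell f2])
       (use deg2 ordered_basis_expansion[OF p2] in blast)
  ultimately have "c1\<^sup>2 * c2\<^sup>2 > 0" by simp
  moreover have "barrier D p1 p2 y
    = - ln (c1\<^sup>2 * c2\<^sup>2 * (fdet (m1 D) (gram (vell y) (w1 D) f1) * fdet (m2 D) (gram (vell y) (w2 D) f2)))"
    if y: "y \<in> carrier_vec (D + 1)" for y
    unfolding barrier_def det_Lambda[OF D p1 p2 y]
    by (subst fdet_gram_change_basis[OF poly_functional_ell f1 poly_functional_ell ordered_basis_degree[OF p1]], assumption,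
        subst fdet_gram_change_basis[OF poly_functional_ell f2 poly_functional_ell ordered_basis_degree[OF p2]], assumption)
       (simp add: c1_def c2_def mult_ac)
  ultimately show ?thesis by blast
qed

definition frob_inner :: "nat \<Rightarrow> (nat \<Rightarrow> nat \<Rightarrow> real) \<Rightarrow> (nat \<Rightarrow> nat \<Rightarrow> real) \<Rightarrow> real" where
  "frob_inner m A B = (\<Sum>i<m. \<Sum>j<m. A i j * B i j)"

lemma gram_unit_vec:
  "i < n \<Longrightarrow> gram (vell (unit_vec n i)) w f a c = cheb_coeff n i (w * (f a * f c))"
  unfolding gram_def by (rule vell_unit_vec)

lemma hessian_entry:
  assumes D: "D \<ge> 1" and p1: "ordered_basis (d1 D) p1" and p2: "ordered_basis (d2 D) p2"
    and x: "x \<in> carrier_vec (D + 1)" and f: "onb D x f1 f2" and ij: "i < D + 1" "j < D + 1"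
  shows "hessian (D + 1) (barrier D p1 p2) x $$ (i, j)
    = frob_inner (m1 D) (gram (vell (unit_vec (D + 1) i)) (w1 D) f1) (gram (vell (unit_vec (D + 1) j)) (w1 D) f1)
    + frob_inner (m2 D) (gram (vell (unit_vec (D + 1) i)) (w2 D) f2) (gram (vell (unit_vec (D + 1) j)) (w2 D) f2)"
proof -
  let ?n = "D + 1"
  define A1 where "A1 i = gram (vell (unit_vec ?n i)) (w1 D) f1" for i
  define A2 where "A2 i = gram (vell (unit_vec ?n i)) (w2 D) f2" for i
  obtain \<kappa> where \<kappa>: "\<kappa> > 0" and bar: "\<And>y. y \<in> carrier_vec ?n \<Longrightarrow> barrier D p1 p2 y
    = - ln (\<kappa> * (fdet (m1 D) (gram (vell y) (w1 D) f1) * fdet (m2 D) (gram (vell y) (w2 D) f2)))"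
    using barrier_eq[OF D p1 p2 f] by blast
  have fd: "fdet m (gram (vell (x + h \<cdot>\<^sub>v unit_vec ?n i + s \<cdot>\<^sub>v unit_vec ?n j)) w f)
      = fdet m (pencil (gram (vell (unit_vec ?n i)) w f) (gram (vell (unit_vec ?n j)) w f) h s)"
    if "orthonormal (vell x) w m f" for m w f h s
  proof (rule fdet_cong)
    fix a c assume ac: "a < m" "c < m"
    have "vell (x + h \<cdot>\<^sub>v unit_vec ?n i + s \<cdot>\<^sub>v unit_vec ?n j) q
      = vell x q + h * vell (unit_vec ?n i) q + s * vell (unit_vec ?n j) q" for q
      using x by (subst vell_add[where n = ?n], simp, simp, subst vell_add[where n = ?n], simp, simp)
        (simp only: vell_smult)
    thus "gram (vell (x + h \<cdot>\<^sub>v unit_vec ?n i + s \<cdot>\<^sub>v unit_vec ?n j)) w f a c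
      = pencil (gram (vell (unit_vec ?n i)) w f) (gram (vell (unit_vec ?n j)) w f) h s a c"
      using that ac by (simp only: gram_def pencil_def orthonormal_def)
  qed
  have "barrier D p1 p2 (x + h \<cdot>\<^sub>v unit_vec ?n i + s \<cdot>\<^sub>v unit_vec ?n j)
    = - ln (\<kappa> * (fdet (m1 D) (pencil (A1 i) (A1 j) h s) * fdet (m2 D) (pencil (A2 i) (A2 j) h s)))" for h s
    using f x by (subst bar) (simp_all only: onb_def fd A1_def A2_def add_carrier_vec smult_carrier_vec unit_vec_carrier)
  \<comment> \<open>The outer derivative moves along the i-th unit vector with parameter h, the
    inner one along the j-th with parameter s. Symmetry of the Gram matrices then turns the trace of
    the product into a Frobenius inner product.\<close>
  hence "hessian ?n (barrier D p1 p2) x $$ (i, j)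
    = (\<Sum>a<m1 D. \<Sum>c<m1 D. A1 j a c * A1 i c a) + (\<Sum>a<m2 D. \<Sum>c<m2 D. A2 j a c * A2 i c a)"
    using ij \<kappa> by (simp add: hessian_def partial_def deriv2_log_fdet del: One_nat_def)
  also have "\<dots> = frob_inner (m1 D) (A1 i) (A1 j) + frob_inner (m2 D) (A2 i) (A2 j)"
    unfolding frob_inner_def
    by (intro arg_cong2[of _ _ _ _ "(+)"] sum.cong refl) (simp_all add: A1_def A2_def gram_commute mult.commute)
  finally show ?thesis by (simp add: A1_def A2_def)
qed

lemma gram_conv_unit_vec:
  assumes "u \<in> carrier_vec n"
  shows "gram (vell u) w f a c = (\<Sum>j<n. u $ j * gram (vell (unit_vec n j)) w f a c)"
  using assms by (simp add: gram_unit_vec del: index_unit_vec dim_vec) (simp add: gram_def ell_def)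

lemma frob_inner_sum_right:
  "frob_inner m A (\<lambda>a c. \<Sum>j<n. t j * B j a c) = (\<Sum>j<n. t j * frob_inner m A (B j))"
proof -
  have "frob_inner m A (\<lambda>a c. \<Sum>j<n. t j * B j a c) = (\<Sum>i<m. \<Sum>c<m. \<Sum>j<n. t j * (A i c * B j i c))"
    unfolding frob_inner_def sum_distrib_left by (intro sum.cong refl) (simp add: mult_ac)
  also have "\<dots> = (\<Sum>i<m. \<Sum>j<n. \<Sum>c<m. t j * (A i c * B j i c))"
    by (rule sum.cong[OF refl], rule sum.swap)
  also have "\<dots> = (\<Sum>j<n. \<Sum>i<m. \<Sum>c<m. t j * (A i c * B j i c))"
    by (rule sum.swap)
  finally show ?thesis by (simp add: frob_inner_def sum_distrib_left)
qed

lemma frob_inner_commute: "frob_inner m A B = frob_inner m B A"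
  by (simp add: frob_inner_def mult.commute)

lemma frob_inner_self: "frob_inner m A A = frob m A"
  by (simp add: frob_inner_def frob_def power2_eq_square)

text \<open>In bases orthonormal at \<open>x\<close> the Hessian is the pullback of the Frobenius
  inner product. In particular the squared local norm of u at x is the sum of the two
  \<open>frob\<close> values of its Gram matrices.\<close>

lemma hessian_form:
  assumes D: "D \<ge> 1" and p1: "ordered_basis (d1 D) p1" and p2: "ordered_basis (d2 D) p2"
    and x: "x \<in> carrier_vec (D + 1)" and f: "onb D x f1 f2"
    and u: "u \<in> carrier_vec (D + 1)" and v: "v \<in> carrier_vec (D + 1)"
  shows "u \<bullet> (hessian (D + 1) (barrier D p1 p2) x *\<^sub>v v)
    = frob_inner (m1 D) (gram (vell u) (w1 D) f1) (gram (vell v) (w1 D) f1)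
    + frob_inner (m2 D) (gram (vell u) (w2 D) f2) (gram (vell v) (w2 D) f2)"
proof -
  let ?n = "D + 1"
  let ?H = "hessian ?n (barrier D p1 p2) x"
  let ?e = "unit_vec ?n"
  have H: "?H \<in> carrier_mat ?n ?n" by (simp add: hessian_def)
  have sumr: "frob_inner m (gram M w f) (gram (vell z) w f)
      = (\<Sum>j<?n. z $ j * frob_inner m (gram M w f) (gram (vell (?e j)) w f))"
    if "z \<in> carrier_vec ?n" for m M w f z
  proof -
    have g: "gram (vell z) w f = (\<lambda>a c. \<Sum>j<?n. z $ j * gram (vell (?e j)) w f a c)"
      by (intro ext) (rule gram_conv_unit_vec[OF that])
    show ?thesis unfolding g by (rule frob_inner_sum_right)
  qed
  have "u \<bullet> (?H *\<^sub>v v) = (\<Sum>i<?n. u $ i * (\<Sum>j<?n. ?H $$ (i, j) * v $ j))"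
    using H u v by (simp add: scalar_prod_def lessThan_atLeast0 del: One_nat_def)
  also have "\<dots> = (\<Sum>i<?n. u $ i * (\<Sum>j<?n. (frob_inner (m1 D) (gram (vell (?e i)) (w1 D) f1) (gram (vell (?e j)) (w1 D) f1)
      + frob_inner (m2 D) (gram (vell (?e i)) (w2 D) f2) (gram (vell (?e j)) (w2 D) f2)) * v $ j))"
    by (intro sum.cong refl arg_cong2[of _ _ _ _ "(*)"] hessian_entry[OF D p1 p2 x f]) auto
  also have "\<dots> = (\<Sum>i<?n. u $ i * (\<Sum>j<?n. v $ j * frob_inner (m1 D) (gram (vell (?e i)) (w1 D) f1) (gram (vell (?e j)) (w1 D) f1)))
    + (\<Sum>i<?n. u $ i * (\<Sum>j<?n. v $ j * frob_inner (m2 D) (gram (vell (?e i)) (w2 D) f2) (gram (vell (?e j)) (w2 D) f2)))"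
    by (simp only: distrib_right distrib_left sum.distrib mult.commute[of "v $ _"])
  also have "\<dots> = (\<Sum>i<?n. u $ i * frob_inner (m1 D) (gram (vell v) (w1 D) f1) (gram (vell (?e i)) (w1 D) f1))
    + (\<Sum>i<?n. u $ i * frob_inner (m2 D) (gram (vell v) (w2 D) f2) (gram (vell (?e i)) (w2 D) f2))"
    by (simp only: sumr[OF v, symmetric] frob_inner_commute[of _ "gram (vell v) _ _"])
  also have "\<dots> = frob_inner (m1 D) (gram (vell u) (w1 D) f1) (gram (vell v) (w1 D) f1)
    + frob_inner (m2 D) (gram (vell u) (w2 D) f2) (gram (vell v) (w2 D) f2)"
    by (simp only: sumr[OF u, symmetric] frob_inner_commute[of _ "gram (vell u) _ _"])
  finally show ?thesis .
qed

section \<open>Dual certificates near a gradient certificate\<close>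

text \<open>Injectivity of \<Lambda>: the products w p q span all polynomials of degree at most D.
  For even D the weight 1 yields each monomial; for odd D half the sum and half the difference of (1
  + z) z^j and (1 - z) z^j yield z^j and z^(j+1).\<close>

lemma functional_monoms_eq_0:
  assumes M: "poly_functional M" and D: "D \<ge> 1"
    and z1: "\<And>p q. degree p < m1 D \<Longrightarrow> degree q < m1 D \<Longrightarrow> M (w1 D * (p * q)) = 0"
    and z2: "\<And>p q. degree p < m2 D \<Longrightarrow> degree q < m2 D \<Longrightarrow> M (w2 D * (p * q)) = 0"
    and i: "i \<le> D"
  shows "M (monom 1 i) = 0"
proof -
  have split: "\<exists>a b. a \<le> d \<and> b \<le> d \<and> a + b = i" if "i \<le> 2 * d" for i d :: nat
    by (intro exI[of _ "min i d"] exI[of _ "i - min i d"]) (use that in auto)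
  show ?thesis
  proof (cases "even D")
    case True
    then obtain a b where ab: "a \<le> d1 D" "b \<le> d1 D" "a + b = i"
      using split[of i "d1 D"] i by (auto simp: d1_def)
    hence "M (w1 D * (monom 1 a * monom 1 b)) = 0"
      by (intro z1) (simp_all add: degree_monom_eq)
    thus ?thesis using True ab by (simp add: w1_def mult_monom)
  next
    case False
    have z: "M (monom 1 j) = 0 \<and> M (monom 1 (Suc j)) = 0" if "j \<le> 2 * (D div 2)" for j
    proof -
      obtain a b where ab: "a \<le> D div 2" "b \<le> D div 2" "a + b = j" using split[OF \<open>j \<le> _\<close>] by blast
      have "M (w1 D * (monom 1 a * monom 1 b)) = 0"
        using ab by (intro z1) (simp_all add: degree_monom_eq d1_def)
      also have "w1 D * (monom 1 a * monom 1 b) = monom 1 j - monom 1 (Suc j)"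
        using False ab by (simp add: w1_def mult_monom monom_Suc algebra_simps)
      finally have m: "M (monom 1 j) - M (monom 1 (Suc j)) = 0" by (simp add: poly_functional_diff[OF M])
      have "M (w2 D * (monom 1 a * monom 1 b)) = 0"
        using ab False by (intro z2) (simp_all add: degree_monom_eq d2_def)
      also have "w2 D * (monom 1 a * monom 1 b) = monom 1 j + monom 1 (Suc j)"
        using False ab by (simp add: w2_def mult_monom monom_Suc algebra_simps)
      finally have "M (monom 1 j) + M (monom 1 (Suc j)) = 0" by (simp add: poly_functional_add[OF M])
      thus ?thesis using m by simp
    qed
    show ?thesis
    proof (cases i)
      case 0 thus ?thesis using z[of 0] by simp
    next
      case (Suc j)
      thus ?thesis using z[of j] i False by (auto elim!: oddE)
    qed
  qed
qed

lemma vell_eq_0: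
  assumes u: "u \<in> carrier_vec (D + 1)" and D: "D \<ge> 1"
    and z1: "\<And>p q. degree p < m1 D \<Longrightarrow> degree q < m1 D \<Longrightarrow> vell u (w1 D * (p * q)) = 0"
    and z2: "\<And>p q. degree p < m2 D \<Longrightarrow> degree q < m2 D \<Longrightarrow> vell u (w2 D * (p * q)) = 0"
  shows "u = 0\<^sub>v (D + 1)"
proof (rule eq_vecI)
  fix k assume "k < dim_vec (0\<^sub>v (D + 1) :: real vec)"
  hence k: "k < D + 1" by simp
  have "u $ k = vell u (cheb k)" using u k by (simp add: ell_cheb)
  also have "cheb k = (\<Sum>i\<le>k. smult (coeff (cheb k) i) (monom 1 i))"
    using poly_as_sum_of_monoms[of "cheb k"] by (simp add: smult_monom)
  also have "vell u \<dots> = (\<Sum>i\<le>k. coeff (cheb k) i * vell u (monom 1 i))"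
    by (simp only: poly_functional_sum[OF poly_functional_ell] poly_functional_smult[OF poly_functional_ell])
  also have "\<dots> = 0"
    using k by (intro sum.neutral) (auto intro!: functional_monoms_eq_0[OF poly_functional_ell D z1 z2])
  finally show "u $ k = 0\<^sub>v (D + 1) $ k" using k by simp
qed (use u in simp)

lemma frob_eq_0D: "frob m A = 0 \<Longrightarrow> i < m \<Longrightarrow> j < m \<Longrightarrow> A i j = 0"
  unfolding frob_def by (subst (asm) sum_nonneg_eq_0_iff, simp, simp add: sum_nonneg)
    (auto simp: sum_nonneg_eq_0_iff)

text \<open>A kernel vector has local norm 0, so both its Gram matrices vanish and injectivity of
  \<Lambda> makes it zero.\<close>

lemma hessian_invertible:
  assumes D: "D \<ge> 1" and p1: "ordered_basis (d1 D) p1" and p2: "ordered_basis (d2 D) p2"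
    and x: "x \<in> carrier_vec (D + 1)" and f: "onb D x f1 f2"
  shows "\<exists>G. mat_inverse (hessian (D + 1) (barrier D p1 p2) x) = Some G \<and> G \<in> carrier_mat (D + 1) (D + 1)
    \<and> hessian (D + 1) (barrier D p1 p2) x * G = 1\<^sub>m (D + 1)"
proof -
  let ?n = "D + 1"
  define H where "H = hessian ?n (barrier D p1 p2) x"
  have H: "H \<in> carrier_mat ?n ?n" by (simp add: H_def hessian_def)
  have "det H \<noteq> 0"
  proof
    assume "det H = 0"
    then obtain u where u: "u \<in> carrier_vec ?n" "u \<noteq> 0\<^sub>v ?n" "H *\<^sub>v u = 0\<^sub>v ?n"
      using det_0_iff_vec_prod_zero[OF H] by blast
    have "u \<bullet> (H *\<^sub>v u) = 0" using u by simp
    hence *: "frob (m1 D) (gram (vell u) (w1 D) f1) + frob (m2 D) (gram (vell u) (w2 D) f2) = 0"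
      unfolding H_def using hessian_form[OF D p1 p2 x f u(1) u(1)] by (simp add: frob_inner_self)
    hence "frob (m1 D) (gram (vell u) (w1 D) f1) = 0" "frob (m2 D) (gram (vell u) (w2 D) f2) = 0"
      using frob_nonneg[of "m1 D" "gram (vell u) (w1 D) f1"] frob_nonneg[of "m2 D" "gram (vell u) (w2 D) f2"]
      by linarith+
    note z = this
    have g2: "gram (vell u) (w2 D) f2 i j = 0" if "i < m2 D" "j < m2 D" for i j
      using z(2) that by (rule frob_eq_0D)
    have g: "gram (vell u) (w1 D) f1 i j = 0" if "i < m1 D" "j < m1 D" for i j
      using z(1) that by (rule frob_eq_0D)
    have f1: "orthonormal (vell x) (w1 D) (m1 D) f1" and f2: "orthonormal (vell x) (w2 D) (m2 D) f2"
      using f by (auto simp: onb_def)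
    have "u = 0\<^sub>v ?n"
    proof (rule vell_eq_0[OF u(1) D])
      fix p q :: "real poly" assume "degree p < m1 D" "degree q < m1 D"
      from orthonormal_functional_expand[OF poly_functional_ell f1 poly_functional_ell this]
      show "vell u (w1 D * (p * q)) = 0" using g by simp
    next
      fix p q :: "real poly" assume "degree p < m2 D" "degree q < m2 D"
      from orthonormal_functional_expand[OF poly_functional_ell f2 poly_functional_ell this]
      show "vell u (w2 D * (p * q)) = 0" using g2 by simp
    qed
    with u(2) show False by simp
  qed
  from det_non_zero_imp_unit[OF H this]
  have "H \<in> Units (ring_mat TYPE(real) ?n ())" .
  then obtain G where G: "mat_inverse H = Some G"
    using mat_inverse(1)[OF H, of "()"] by (cases "mat_inverse H") auto
  with mat_inverse(2)[OF H G] show ?thesis unfolding H_def by blast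
qed

section \<open>Membership in the dual cone and its interior\<close>

lemma sos_functional_nonneg:
  assumes M: "poly_functional M" and psd: "\<And>p. degree p < Suc k \<Longrightarrow> M (w * (p * p)) \<ge> 0" and s: "s \<in> sos k"
  shows "M (w * s) \<ge> 0"
proof -
  obtain ps where ps: "s = (\<Sum>p\<leftarrow>ps. p ^ 2)" "set ps \<subseteq> poly_space k" using s by (auto simp: sos_def)
  have "M (w * (\<Sum>p\<leftarrow>ps. p ^ 2)) \<ge> 0" using ps(2)
  proof (induction ps)
    case Nil thus ?case by (simp add: poly_functional_0[OF M])
  next
    case (Cons p ps)
    have "M (w * (p * p)) \<ge> 0" using Cons.prems by (intro psd) (auto simp: poly_space_def)
    thus ?case using Cons by (simp add: distrib_left poly_functional_add[OF M] power2_eq_square)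
  qed
  thus ?thesis by (simp add: ps)
qed

definition psd :: "nat \<Rightarrow> real vec \<Rightarrow> bool" where
  "psd D y \<longleftrightarrow> (\<forall>p. degree p < m1 D \<longrightarrow> vell y (w1 D * (p * p)) \<ge> 0)
    \<and> (\<forall>p. degree p < m2 D \<longrightarrow> vell y (w2 D * (p * p)) \<ge> 0)"

lemma psd_imp_dual_cone:
  assumes y: "y \<in> carrier_vec (D + 1)" "psd D y"
  shows "y \<in> dual_cone (D + 1) (Sigma_cone D)"
  unfolding dual_cone_def
proof (intro CollectI conjI ballI)
  fix x assume "x \<in> Sigma_cone D"
  then obtain s1 s2 where x: "x \<in> carrier_vec (D + 1)" and s: "s1 \<in> sos (d1 D)" "s2 \<in> sos (d2 D)"
    and eq: "cheb_poly x = w1 D * s1 + w2 D * s2" by (auto simp: Sigma_cone_def)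
  have "x \<bullet> y = vell y (w1 D * s1) + vell y (w2 D * s2)"
    unfolding vell_cheb_poly[OF x y(1), symmetric] eq by (rule ell_add)
  also have "\<dots> \<ge> 0"
  proof (rule add_nonneg_nonneg)
    show "vell y (w1 D * s1) \<ge> 0"
      by (rule sos_functional_nonneg[OF poly_functional_ell _ s(1)]) (use y(2) in \<open>simp add: psd_def\<close>)
    show "vell y (w2 D * s2) \<ge> 0"
      by (rule sos_functional_nonneg[OF poly_functional_ell _ s(2)]) (use y(2) in \<open>simp add: psd_def\<close>)
  qed
  finally show "x \<bullet> y \<ge> 0" .
qed (fact y(1))

lemma abs_vec_le_linf_norm:
  assumes "i < dim_vec z" shows "\<bar>z $ i\<bar> \<le> linf_norm z"
  unfolding linf_norm_def by (rule Max_ge) (use assms in auto)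

text \<open>A crude comparison of the local norm with the sup norm. The constant may depend on the
  basis, since it only serves to find some sup-norm ball inside the cone. The side condition on the
  norm covers n = 0, where it is a maximum over the empty set.\<close>

lemma frob_gram_le_linf:
  "\<exists>K\<ge>0. \<forall>z\<in>carrier_vec n. 0 \<le> linf_norm z \<longrightarrow> frob m (gram (vell z) w f) \<le> (K * linf_norm z)\<^sup>2"
proof -
  define S where "S = (\<Sum>a<m. \<Sum>c<m. \<Sum>i<n. \<bar>cheb_coeff n i (w * (f a * f c))\<bar>)"
  have S: "(\<Sum>i<n. \<bar>cheb_coeff n i (w * (f a * f c))\<bar>) \<le> S" if "a < m" "c < m" for a c
  proof -
    have "(\<Sum>i<n. \<bar>cheb_coeff n i (w * (f a * f c))\<bar>) \<le> (\<Sum>c<m. \<Sum>i<n. \<bar>cheb_coeff n i (w * (f a * f c))\<bar>)"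
      using that by (intro member_le_sum) (auto intro: sum_nonneg)
    also have "\<dots> \<le> S" unfolding S_def
      using that by (intro member_le_sum[where f = "\<lambda>a. \<Sum>c<m. _ a c"]) (auto intro!: sum_nonneg)
    finally show ?thesis .
  qed
  have S0: "S \<ge> 0" by (auto simp: S_def intro!: sum_nonneg)
  have "frob m (gram (vell z) w f) \<le> (real m * S * linf_norm z)\<^sup>2"
    if z: "z \<in> carrier_vec n" "0 \<le> linf_norm z" for z
  proof -
    have "(gram (vell z) w f a c)\<^sup>2 \<le> (S * linf_norm z)\<^sup>2" if "a < m" "c < m" for a c
    proof -
      have "\<bar>gram (vell z) w f a c\<bar> \<le> (\<Sum>i<n. \<bar>z $ i\<bar> * \<bar>cheb_coeff n i (w * (f a * f c))\<bar>)"
        using z by (auto simp: gram_def ell_def simp flip: abs_mult intro: sum_abs)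
      also have "\<dots> \<le> (\<Sum>i<n. linf_norm z * \<bar>cheb_coeff n i (w * (f a * f c))\<bar>)"
        using z by (intro sum_mono mult_right_mono abs_vec_le_linf_norm) auto
      also have "\<dots> \<le> linf_norm z * S"
        unfolding sum_distrib_left[symmetric] using S[OF that] z by (intro mult_left_mono)
      finally show ?thesis by (simp add: abs_le_square_iff[symmetric] abs_mult mult.commute S0 z)
    qed
    hence "frob m (gram (vell z) w f) \<le> (\<Sum>a<m. \<Sum>c<m. (S * linf_norm z)\<^sup>2)"
      unfolding frob_def by (intro sum_mono) auto
    thus ?thesis by (simp add: power2_eq_square mult_ac)
  qed
  thus ?thesis using S0 by (intro exI[of _ "real m * S"]) auto
qed

lemma frob_le_1_imp_nonneg:
  assumes L: "poly_functional L" and f: "orthonormal L w m f" and M: "poly_functional M"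
    and fr: "frob m (gram M w f) \<le> 1" and p: "degree p < m"
  shows "L (w * (p * p)) + M (w * (p * p)) \<ge> 0"
proof -
  have "L (w * (p * p)) \<ge> 0" using orthonormal_parseval[OF L f p p] by (simp add: sum_nonneg)
  moreover have "sqrt (frob m (gram M w f)) \<le> 1" using fr by simp
  ultimately have "sqrt (frob m (gram M w f)) * L (w * (p * p)) \<le> 1 * L (w * (p * p))"
    by (rule mult_right_mono[rotated])
  thus ?thesis using abs_functional_le_frob[OF L f M p] by linarith
qed

text \<open>The Dikin ellipsoid: the closed unit ball of the local norm around x stays in the cone,
  here with the bound required of each block separately.\<close>

lemma psd_perturb:
  assumes x: "x \<in> carrier_vec (D + 1)" and z: "z \<in> carrier_vec (D + 1)" and f: "onb D x f1 f2"
    and fr: "frob (m1 D) (gram (vell z) (w1 D) f1) \<le> 1" "frob (m2 D) (gram (vell z) (w2 D) f2) \<le> 1"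
  shows "psd D (x + z)"
  unfolding psd_def vell_add[OF x z]
  using f frob_le_1_imp_nonneg[OF poly_functional_ell _ poly_functional_ell fr(1)]
    frob_le_1_imp_nonneg[OF poly_functional_ell _ poly_functional_ell fr(2)]
  by (auto simp: onb_def)

lemma onb_imp_interior:
  assumes x: "x \<in> carrier_vec (D + 1)" and f: "onb D x f1 f2"
  shows "x \<in> vec_interior (D + 1) (dual_cone (D + 1) (Sigma_cone D))"
proof -
  let ?n = "D + 1"
  obtain K1 where K1: "K1 \<ge> 0" "\<And>z. z \<in> carrier_vec ?n \<Longrightarrow> 0 \<le> linf_norm z \<Longrightarrow>
      frob (m1 D) (gram (vell z) (w1 D) f1) \<le> (K1 * linf_norm z)\<^sup>2"
    using frob_gram_le_linf[of ?n "m1 D" "w1 D" f1] by blast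
  obtain K2 where K2: "K2 \<ge> 0" "\<And>z. z \<in> carrier_vec ?n \<Longrightarrow> 0 \<le> linf_norm z \<Longrightarrow>
      frob (m2 D) (gram (vell z) (w2 D) f2) \<le> (K2 * linf_norm z)\<^sup>2"
    using frob_gram_le_linf[of ?n "m2 D" "w2 D" f2] by blast
  define \<epsilon> where "\<epsilon> = 1 / (K1 + K2 + 1)"
  have \<epsilon>: "\<epsilon> > 0" "K1 * \<epsilon> \<le> 1" "K2 * \<epsilon> \<le> 1" using K1(1) K2(1) by (auto simp: \<epsilon>_def)
  have "y \<in> dual_cone ?n (Sigma_cone D)" if y: "y \<in> carrier_vec ?n" "linf_norm (y - x) < \<epsilon>" for y
  proof -
    define z where "z = y - x"
    have z: "z \<in> carrier_vec ?n" using x y by (simp add: z_def)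
    have "0 \<le> \<bar>z $ 0\<bar>" by simp
    also have "\<dots> \<le> linf_norm z" using z by (intro abs_vec_le_linf_norm) simp
    finally have z0: "0 \<le> linf_norm z" .
    have "K * linf_norm z \<le> 1" if "K * \<epsilon> \<le> 1" "K \<ge> 0" for K
      using mult_left_mono[of "linf_norm z" \<epsilon> K] y(2) that by (simp add: z_def)
    hence "(K * linf_norm z)\<^sup>2 \<le> 1" if "K * \<epsilon> \<le> 1" "K \<ge> 0" for K
      using that z0 by (simp add: power_le_one)
    hence "(K1 * linf_norm z)\<^sup>2 \<le> 1" "(K2 * linf_norm z)\<^sup>2 \<le> 1"
      using K1(1) K2(1) \<epsilon> by blast+
    hence "psd D (x + z)"
      using order_trans[OF K1(2)[OF z z0]] order_trans[OF K2(2)[OF z z0]]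
      by (intro psd_perturb[OF x z f]) simp_all
    moreover have "x + z = y" using x y by (intro eq_vecI) (auto simp: z_def)
    ultimately show ?thesis using y by (intro psd_imp_dual_cone) simp_all
  qed
  thus ?thesis using x \<epsilon>(1) by (auto simp: vec_interior_def)
qed

lemma pos_def_imp_onb:
  assumes "pos_def (vell x) (w1 D) (m1 D)" "pos_def (vell x) (w2 D) (m2 D)"
  shows "\<exists>f1 f2. onb D x f1 f2"
  using pos_def_imp_orthonormal[OF poly_functional_ell] assms by (auto simp: onb_def)

lemma pos_def_perturb:
  assumes L: "poly_functional L" and f: "orthonormal L w m f" and M: "poly_functional M"
    and fr: "frob m (gram M w f) < 1"
  shows "pos_def (\<lambda>p. L p + M p) w m"
  unfolding pos_def_def
proof (intro allI impI)
  fix p :: "real poly" assume p: "degree p < m" "p \<noteq> 0"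
  have "L (w * (p * p)) > 0" using orthonormal_imp_pos_def[OF L f] p by (simp add: pos_def_def)
  moreover have "sqrt (frob m (gram M w f)) < 1" using fr by simp
  ultimately have "sqrt (frob m (gram M w f)) * L (w * (p * p)) < 1 * L (w * (p * p))"
    by (rule mult_strict_right_mono[rotated])
  thus "L (w * (p * p)) + M (w * (p * p)) > 0" using abs_functional_le_frob[OF L f M p(1)] by linarith
qed

text \<open>For the transition matrix \<open>P\<close> from the \<open>L\<close>-orthonormal \<open>f\<close> to the \<open>L'\<close>-orthonormal \<open>g\<close> the
  matrix \<open>P P\<^sup>T\<close> is the Gram matrix of \<open>g\<close> under \<open>L\<close>, while \<open>P\<^sup>T P\<close> represents the gradient of
  the barrier at \<open>L'\<close>.\<close>

lemma transition_matrix: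
  assumes L: "poly_functional L" and f: "orthonormal L w m f"
    and L': "poly_functional L'" and g: "orthonormal L' w m g"
  obtains S where
    "\<And>M. poly_functional M \<Longrightarrow> (\<Sum>a<m. gram M w g a a) = frob_inner m S (gram M w f)"
    "frob m (\<lambda>i j. S i j - (if i = j then 1 else 0)) = frob m (gram (\<lambda>p. L p - L' p) w g)"
proof
  define P where "P a b = L (w * (g a * f b))" for a b
  define S where "S i j = (\<Sum>a<m. P a i * P a j)" for i j
  have dg: "degree (g a) < m" if "a < m" for a using g that by (simp add: orthonormal_def graded_def)
  show "(\<Sum>a<m. gram M w g a a) = frob_inner m S (gram M w f)" if M: "poly_functional M" for M
  proof -
    have "(\<Sum>a<m. gram M w g a a) = (\<Sum>a<m. \<Sum>i<m. \<Sum>j<m. P a i * P a j * gram M w f i j)"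
      by (intro sum.cong refl, subst gram_def, subst orthonormal_functional_expand[OF L f M])
         (simp_all add: dg P_def)
    also have "\<dots> = (\<Sum>i<m. \<Sum>a<m. \<Sum>j<m. P a i * P a j * gram M w f i j)"
      by (rule sum.swap)
    also have "\<dots> = (\<Sum>i<m. \<Sum>j<m. \<Sum>a<m. P a i * P a j * gram M w f i j)"
      by (rule sum.cong[OF refl], rule sum.swap)
    finally show ?thesis by (simp add: frob_inner_def S_def sum_distrib_right)
  qed
  have "frob m (\<lambda>i j. S i j - (if i = j then 1 else 0))
      = frob m (\<lambda>a c. (\<Sum>b<m. P a b * P c b) - (if a = c then 1 else 0))"
    unfolding S_def by (rule frob_transpose_product)
  also have "\<dots> = frob m (gram (\<lambda>p. L p - L' p) w g)"
    unfolding frob_def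
  proof (intro sum.cong refl arg_cong[of _ _ "\<lambda>r. r\<^sup>2"])
    fix a c assume ac: "a \<in> {..<m}" "c \<in> {..<m}"
    have "L (w * (g a * g c)) = (\<Sum>b<m. P a b * P c b)"
      using orthonormal_parseval[OF L f dg dg] ac by (simp add: P_def)
    moreover have "L' (w * (g a * g c)) = (if a = c then 1 else 0)"
      using g ac by (simp add: orthonormal_def gram_def)
    ultimately show "(\<Sum>b<m. P a b * P c b) - (if a = c then 1 else 0) = gram (\<lambda>p. L p - L' p) w g a c"
      by (simp add: gram_def)
  qed
  finally show "frob m (\<lambda>i j. S i j - (if i = j then 1 else 0)) = frob m (gram (\<lambda>p. L p - L' p) w g)" .
qed

text \<open>With W and S taken over both blocks, the equation says that the squared norm of W is the
  inner product of S - I with W. Cauchy-Schwarz and cancellation of one factor give the bound;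
  \<open>frob\<close> is already the squared norm.\<close>

lemma frob_le_of_gradient_equation:
  fixes A1 A2 B1 B2 S1 S2 :: "nat \<Rightarrow> nat \<Rightarrow> real"
  defines "I \<equiv> \<lambda>i j. if i = j then 1 else 0 :: real"
  assumes eq: "frob_inner m W1 (\<lambda>i j. I i j + W1 i j) + frob_inner n W2 (\<lambda>i j. I i j + W2 i j)
      = frob_inner m S1 W1 + frob_inner n S2 W2"
  shows "frob m W1 + frob n W2 \<le> frob m (\<lambda>i j. S1 i j - I i j) + frob n (\<lambda>i j. S2 i j - I i j)"
proof -
  define a1 where "a1 = frob_inner m (\<lambda>i j. S1 i j - I i j) W1"
  define a2 where "a2 = frob_inner n (\<lambda>i j. S2 i j - I i j) W2"
  define F where "F = frob m (\<lambda>i j. S1 i j - I i j) + frob n (\<lambda>i j. S2 i j - I i j)"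
  define G where "G = frob m W1 + frob n W2"
  have G: "G = a1 + a2"
    using eq by (simp add: G_def a1_def a2_def frob_inner_def frob_def power2_eq_square algebra_simps sum.distrib sum_subtractf)
  have le: "a1\<^sup>2 \<le> frob m (\<lambda>i j. S1 i j - I i j) * frob m W1" "a2\<^sup>2 \<le> frob n (\<lambda>i j. S2 i j - I i j) * frob n W2"
    unfolding a1_def a2_def frob_inner_def by (rule sum_mult_le_frob)+
  \<comment> \<open>Cauchy-Schwarz on the direct sum, assembled from the two blocks.\<close>
  have CS: "(a1 + a2)\<^sup>2 \<le> (p1 + p2) * (q1 + q2)"
    if "a1\<^sup>2 \<le> p1 * q1" "a2\<^sup>2 \<le> p2 * q2" "p1 \<ge> 0" "p2 \<ge> 0" "q1 \<ge> 0" "q2 \<ge> 0" for p1 p2 q1 q2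
  proof -
    have "\<bar>a1\<bar> \<le> sqrt p1 * sqrt q1" "\<bar>a2\<bar> \<le> sqrt p2 * sqrt q2"
      using that by (simp_all flip: real_sqrt_mult add: real_le_rsqrt)
    hence "\<bar>a1 + a2\<bar> \<le> sqrt p1 * sqrt q1 + sqrt p2 * sqrt q2" by linarith
    hence "(a1 + a2)\<^sup>2 \<le> (sqrt p1 * sqrt q1 + sqrt p2 * sqrt q2)\<^sup>2"
      by (metis abs_ge_zero power2_abs power_mono)
    also have "\<dots> = p1 * q1 + p2 * q2 + 2 * ((sqrt p1 * sqrt q2) * (sqrt p2 * sqrt q1))"
      using that by (simp add: power2_sum power_mult_distrib algebra_simps)
    also have "2 * ((sqrt p1 * sqrt q2) * (sqrt p2 * sqrt q1)) \<le> (sqrt p1 * sqrt q2)\<^sup>2 + (sqrt p2 * sqrt q1)\<^sup>2"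
      using sum_squares_bound[of "sqrt p1 * sqrt q2" "sqrt p2 * sqrt q1"] by (simp add: mult_ac)
    also have "\<dots> = p1 * q2 + p2 * q1" using that by (simp add: power_mult_distrib)
    finally show ?thesis by (simp add: algebra_simps)
  qed
  have "G\<^sup>2 \<le> F * G" unfolding G F_def
    by (subst (2) G[symmetric], unfold G_def) (intro CS le frob_nonneg)
  moreover have "G \<ge> 0" "F \<ge> 0" by (simp_all add: G_def F_def frob_nonneg)
  ultimately have "G \<le> F" by (cases "G = 0") (auto simp: power2_eq_square)
  thus ?thesis by (simp add: G_def F_def)
qed

text \<open>Put v = c H(x)^-1 t; it suffices that v is in the dual cone. At x = y homogeneity gives
  v = y. In general the local norm at x of v - x is at most the local norm at y of x - y, hence
  below 1, and v lies in the Dikin ellipsoid of x.\<close>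

lemma dual_certificate_near_gradient_certificate:
  assumes D: "D \<ge> 1" and p1: "ordered_basis (d1 D) p1" and p2: "ordered_basis (d2 D) p2"
    and t: "t \<in> Sigma_cone D" and x: "x \<in> carrier_vec (D + 1)" and y: "y \<in> carrier_vec (D + 1)"
    and g: "onb D y g1 g2" and c: "c > 0"
    and grad: "\<And>u. u \<in> carrier_vec (D + 1) \<Longrightarrow> c * (u \<bullet> t)
      = (\<Sum>a<m1 D. gram (vell u) (w1 D) g1 a a) + (\<Sum>a<m2 D. gram (vell u) (w2 D) g2 a a)"
    and near: "frob (m1 D) (gram (vell (x - y)) (w1 D) g1) + frob (m2 D) (gram (vell (x - y)) (w2 D) g2) < 1"
  shows "dual_certificate D p1 p2 t x"
proof -
  let ?n = "D + 1" and ?I = "\<lambda>i j. if i = j then 1 else 0 :: real"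
  define z where "z = x - y"
  have z: "z \<in> carrier_vec ?n" using x y by (simp add: z_def)
  have g1: "orthonormal (vell y) (w1 D) (m1 D) g1" and g2: "orthonormal (vell y) (w2 D) (m2 D) g2"
    using g by (auto simp: onb_def)
  have tc: "t \<in> carrier_vec ?n" using t by (simp add: Sigma_cone_def)
  have vx: "vell x = (\<lambda>p. vell y p + vell z p)"
    unfolding z_def by (rule ext) (simp only: vell_diff[OF x y])
  have vz: "vell z = (\<lambda>p. vell x p - vell y p)"
    unfolding z_def by (rule ext) (simp only: vell_diff[OF x y])
  have "frob (m1 D) (gram (vell z) (w1 D) g1) < 1" "frob (m2 D) (gram (vell z) (w2 D) g2) < 1"
    using near frob_nonneg[of "m1 D" "gram (vell z) (w1 D) g1"] frob_nonneg[of "m2 D" "gram (vell z) (w2 D) g2"]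
    unfolding z_def by linarith+
  note fr = this
  have "pos_def (vell x) (w1 D) (m1 D)"
    unfolding vx using fr(1) by (rule pos_def_perturb[OF poly_functional_ell g1 poly_functional_ell])
  moreover have "pos_def (vell x) (w2 D) (m2 D)"
    unfolding vx using fr(2) by (rule pos_def_perturb[OF poly_functional_ell g2 poly_functional_ell])
  ultimately obtain f1 f2 where f: "onb D x f1 f2" using pos_def_imp_onb by blast
  have f1: "orthonormal (vell x) (w1 D) (m1 D) f1" and f2: "orthonormal (vell x) (w2 D) (m2 D) f2"
    using f by (auto simp: onb_def)
  obtain S1 where S1: "\<And>M. poly_functional M \<Longrightarrow> (\<Sum>a<m1 D. gram M (w1 D) g1 a a) = frob_inner (m1 D) S1 (gram M (w1 D) f1)"
    "frob (m1 D) (\<lambda>i j. S1 i j - ?I i j) = frob (m1 D) (gram (vell z) (w1 D) g1)"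
    by (rule transition_matrix[OF poly_functional_ell f1 poly_functional_ell g1, folded vz]) (rule that)
  obtain S2 where S2: "\<And>M. poly_functional M \<Longrightarrow> (\<Sum>a<m2 D. gram M (w2 D) g2 a a) = frob_inner (m2 D) S2 (gram M (w2 D) f2)"
    "frob (m2 D) (\<lambda>i j. S2 i j - ?I i j) = frob (m2 D) (gram (vell z) (w2 D) g2)"
    by (rule transition_matrix[OF poly_functional_ell f2 poly_functional_ell g2, folded vz]) (rule that)
  define H where "H = hessian ?n (barrier D p1 p2) x"
  have H: "H \<in> carrier_mat ?n ?n" by (simp add: H_def hessian_def)
  obtain G where G: "mat_inverse H = Some G" "G \<in> carrier_mat ?n ?n" "H * G = 1\<^sub>m ?n"
    unfolding H_def using hessian_invertible[OF D p1 p2 x f] by blast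
  define v where "v = c \<cdot>\<^sub>v (G *\<^sub>v t)"
  have v: "v \<in> carrier_vec ?n" using G(2) tc by (simp add: v_def)
  have "H *\<^sub>v v = c \<cdot>\<^sub>v (H *\<^sub>v (G *\<^sub>v t))"
    unfolding v_def using H G(2) tc by (intro mult_mat_vec) auto
  also have "H *\<^sub>v (G *\<^sub>v t) = t"
    using assoc_mult_mat_vec[OF H G(2) tc] tc by (simp add: G(3))
  finally have Hv: "H *\<^sub>v v = c \<cdot>\<^sub>v t" .
  define u where "u = v - x"
  have u: "u \<in> carrier_vec ?n" using v x by (simp add: u_def)
  define W1 where "W1 = gram (vell u) (w1 D) f1"
  define W2 where "W2 = gram (vell u) (w2 D) f2"
  have vv: "vell v p = vell x p + vell u p" for p
    unfolding u_def vell_diff[OF v x] by simp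
  have inner: "frob_inner m (gram (vell u) w f) (gram (vell v) w f)
      = frob_inner m (gram (vell u) w f) (\<lambda>i j. ?I i j + gram (vell u) w f i j)"
    if "orthonormal (vell x) w m f" for m w f
    unfolding frob_inner_def
    by (intro sum.cong refl) (use that in \<open>simp add: gram_def vv orthonormal_def\<close>)
  \<comment> \<open>The Gram matrix of v is that of x, which is the identity, plus that of u = v -
    x. The chain rewrites u^T H v once by the Hessian form and once by H v = c t and the gradient
    equation at y.\<close>
  have "frob_inner (m1 D) W1 (\<lambda>i j. ?I i j + W1 i j) + frob_inner (m2 D) W2 (\<lambda>i j. ?I i j + W2 i j)
      = u \<bullet> (H *\<^sub>v v)"
    unfolding H_def hessian_form[OF D p1 p2 x f u v] W1_def W2_def
    by (simp only: inner[OF f1] inner[OF f2])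
  also have "\<dots> = c * (u \<bullet> t)" using u tc by (simp add: Hv)
  also have "\<dots> = frob_inner (m1 D) S1 W1 + frob_inner (m2 D) S2 W2"
    unfolding grad[OF u] W1_def W2_def by (simp only: S1(1)[OF poly_functional_ell] S2(1)[OF poly_functional_ell])
  finally have "frob (m1 D) W1 + frob (m2 D) W2 < 1"
    using frob_le_of_gradient_equation[of "m1 D" W1 "m2 D" W2 S1 S2] S1(2) S2(2) near
    by (simp add: z_def)
  hence W: "frob (m1 D) W1 \<le> 1" "frob (m2 D) W2 \<le> 1"
    using frob_nonneg[of "m1 D" W1] frob_nonneg[of "m2 D" W2] by linarith+
  have "psd D (x + u)"
    using psd_perturb[OF x u f] W by (simp add: W1_def W2_def)
  moreover have "x + u = v" using v x by (intro eq_vecI) (auto simp: u_def)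
  ultimately have vd: "v \<in> dual_cone ?n (Sigma_cone D)" using v by (intro psd_imp_dual_cone) simp_all
  have "G *\<^sub>v t \<in> dual_cone ?n (Sigma_cone D)"
    unfolding dual_cone_def
  proof (intro CollectI conjI ballI)
    show Gt: "G *\<^sub>v t \<in> carrier_vec ?n" using G(2) tc by simp
    fix s assume s: "s \<in> Sigma_cone D"
    hence "s \<in> carrier_vec ?n" by (simp add: Sigma_cone_def)
    hence "s \<bullet> v = c * (s \<bullet> (G *\<^sub>v t))" using Gt by (simp add: v_def)
    moreover have "s \<bullet> v \<ge> 0" using vd s by (simp add: dual_cone_def)
    ultimately show "s \<bullet> (G *\<^sub>v t) \<ge> 0" using c by (simp add: zero_le_mult_iff)
  qed
  thus ?thesis
    unfolding dual_certificate_def using t onb_imp_interior[OF x f] G(1) by (auto simp: H_def)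
qed

section \<open>Bounds on the cone and its dual\<close>

lemma sos_0: "0 \<in> sos k"
  unfolding sos_def by (intro CollectI exI[of _ "[]"]) simp

lemma sos_add:
  assumes "s \<in> sos k" "t \<in> sos k" shows "s + t \<in> sos k"
proof -
  obtain ps qs where "s = (\<Sum>p\<leftarrow>ps. p ^ 2)" "set ps \<subseteq> poly_space k"
    "t = (\<Sum>p\<leftarrow>qs. p ^ 2)" "set qs \<subseteq> poly_space k"
    using assms by (auto simp: sos_def)
  thus ?thesis unfolding sos_def by (intro CollectI exI[of _ "ps @ qs"]) simp
qed

lemma sos_square: "degree p \<le> k \<Longrightarrow> p * p \<in> sos k"
  unfolding sos_def by (intro CollectI exI[of _ "[p]"]) (simp add: poly_space_def power2_eq_square)

lemma wsos_imp_weighted_sos: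
  assumes "p \<in> wsos D" "D \<ge> 1"
  shows "\<exists>s1\<in>sos (d1 D). \<exists>s2\<in>sos (d2 D). p = w1 D * s1 + w2 D * s2"
  using assms(1)
proof induction
  case zero
  show ?case using sos_0 by (intro bexI[of _ 0]) auto
next
  case (add p q)
  then obtain s1 s2 t1 t2 where "s1 \<in> sos (d1 D)" "s2 \<in> sos (d2 D)" "p = w1 D * s1 + w2 D * s2"
    "t1 \<in> sos (d1 D)" "t2 \<in> sos (d2 D)" "q = w1 D * t1 + w2 D * t2" by blast
  thus ?case
    by (intro bexI[of _ "s1 + t1"] bexI[of _ "s2 + t2"]) (auto intro: sos_add simp: algebra_simps)
next
  case (square w p)
  show ?case
  proof (cases "p = 0")
    case True
    thus ?thesis using sos_0 by (intro bexI[of _ 0]) auto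
  next
    case False
    have nz: "w \<noteq> 0" using square(1) by (auto simp: weights_def split: if_splits)
    have deg: "degree w + 2 * degree p \<le> D"
      using square(2) False nz by (simp add: degree_mult_eq)
    consider "w = w1 D" | "w = w2 D" "w \<noteq> w1 D"
      using square(1) by (auto simp: weights_def w1_def w2_def split: if_splits)
    thus ?thesis
    proof cases
      case 1
      have "p * p \<in> sos (d1 D)" using deg by (intro sos_square) (simp add: d1_def)
      thus ?thesis using 1 sos_0 by (intro bexI[of _ "p * p"] bexI[of _ 0]) auto
    next
      case 2
      \<comment> \<open>For even D the weight has degree 2, which leaves degree at most D/2 - 1 for
        p.\<close>
      have "p * p \<in> sos (d2 D)"
        using deg 2 assms(2) by (intro sos_square) (auto simp: d2_def w2_def split: if_splits)
      thus ?thesis using 2 sos_0 by (intro bexI[of _ 0] bexI[of _ "p * p"]) auto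
    qed
  qed
qed

lemma degree_cheb_poly:
  assumes "x \<in> carrier_vec (D + 1)" shows "degree (cheb_poly x) \<le> D"
  unfolding cheb_poly_def using assms
  by (intro degree_sum_le) (auto intro!: order_trans[OF degree_smult_le])

lemma nonneg_imp_Sigma:
  assumes D: "D \<ge> 1" and x: "x \<in> carrier_vec (D + 1)"
    and nn: "\<And>z. -1 \<le> z \<Longrightarrow> z \<le> 1 \<Longrightarrow> poly (cheb_poly x) z \<ge> 0"
  shows "x \<in> Sigma_cone D"
proof -
  have "cheb_poly x \<in> wsos (degree (cheb_poly x))" using nn by (rule nonneg_imp_wsos)
  hence "cheb_poly x \<in> wsos D" using degree_cheb_poly[OF x] by (rule wsos_mono)
  from wsos_imp_weighted_sos[OF this D] show ?thesis using x by (auto simp: Sigma_cone_def)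
qed

lemma poly_sos_nonneg: "s \<in> sos k \<Longrightarrow> poly s z \<ge> 0"
proof -
  assume "s \<in> sos k"
  then obtain ps where "s = (\<Sum>p\<leftarrow>ps. p ^ 2)" by (auto simp: sos_def)
  moreover have "poly (\<Sum>p\<leftarrow>ps. p ^ 2) z \<ge> 0" by (induction ps) auto
  ultimately show ?thesis by simp
qed

lemma poly_weights_pos:
  assumes z: "\<bar>z\<bar> < 1" shows "poly (w1 D) z > 0" "poly (w2 D) z > 0"
proof -
  have "(1 - z) * (1 + z) > 0" using z by (intro mult_pos_pos) auto
  thus "poly (w1 D) z > 0" "poly (w2 D) z > 0" using z by (auto simp: w1_def w2_def algebra_simps)
qed

lemma poly_weights_nonneg:
  assumes z: "\<bar>z\<bar> \<le> 1" shows "poly (w1 D) z \<ge> 0" "poly (w2 D) z \<ge> 0"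
proof -
  have "(1 - z) * (1 + z) \<ge> 0" using z by (intro mult_nonneg_nonneg) auto
  thus "poly (w1 D) z \<ge> 0" "poly (w2 D) z \<ge> 0" using z by (auto simp: w1_def w2_def algebra_simps)
qed

lemma Sigma_nonneg:
  assumes "x \<in> Sigma_cone D" "\<bar>z\<bar> \<le> 1" shows "poly (cheb_poly x) z \<ge> 0"
proof -
  obtain s1 s2 where "s1 \<in> sos (d1 D)" "s2 \<in> sos (d2 D)" "cheb_poly x = w1 D * s1 + w2 D * s2"
    using assms(1) by (auto simp: Sigma_cone_def)
  thus ?thesis using poly_weights_nonneg[OF assms(2)] poly_sos_nonneg by simp
qed

lemma poly_cheb_poly: "x \<in> carrier_vec n \<Longrightarrow> poly (cheb_poly x) z = (\<Sum>i<n. x $ i * poly (cheb i) z)"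
  by (auto simp: cheb_poly_def poly_sum)

lemma dual_cone_functional_nonneg:
  fixes x y :: "real vec"
  assumes D: "D \<ge> 1" and y: "y \<in> dual_cone (D + 1) (Sigma_cone D)"
    and x: "x \<in> carrier_vec (D + 1)" and nn: "\<And>z. \<bar>z\<bar> \<le> 1 \<Longrightarrow> poly (cheb_poly x) z \<ge> 0"
  shows "x \<bullet> y \<ge> 0"
proof -
  have "x \<in> Sigma_cone D" using nn by (intro nonneg_imp_Sigma[OF D x]) auto
  thus ?thesis using y by (simp add: dual_cone_def)
qed

lemma sum_unit: "i < (n :: nat) \<Longrightarrow> (\<Sum>k<n. (if k = i then c else 0) * (f k :: real)) = c * f i"
  using sum.mono_neutral_right[of "{..<n}" "{i}" "\<lambda>k. (if k = i then c else 0) * f k"] by simp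

text \<open>The test polynomials are T_0 + T_i and T_0 - T_i, nonnegative on [-1,1] because |T_i|
  \<le> 1 there, and t - \<epsilon> T_0.\<close>

lemma dual_cone_bounds:
  fixes y t :: "real vec"
  assumes D: "D \<ge> 1" and y: "y \<in> dual_cone (D + 1) (Sigma_cone D)"
  shows "i < D + 1 \<Longrightarrow> \<bar>y $ i\<bar> \<le> y $ 0"
    and "t \<in> carrier_vec (D + 1) \<Longrightarrow> (\<And>z. \<bar>z\<bar> \<le> 1 \<Longrightarrow> poly (cheb_poly t) z \<ge> \<epsilon>) \<Longrightarrow> \<epsilon> * y $ 0 \<le> t \<bullet> y"
proof -
  have yc: "y \<in> carrier_vec (D + 1)" using y by (simp add: dual_cone_def)
  have dot: "(\<Sum>k<D + 1. a k * y $ k) \<ge> 0"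
    if "\<And>z. \<bar>z\<bar> \<le> 1 \<Longrightarrow> (\<Sum>k<D + 1. a k * poly (cheb k) z) \<ge> 0" for a
  proof -
    have "vec (D + 1) a \<bullet> y \<ge> 0"
      by (rule dual_cone_functional_nonneg[OF D y]) (use that in \<open>auto simp: poly_cheb_poly\<close>)
    thus ?thesis using yc by (simp add: scalar_prod_def lessThan_atLeast0)
  qed
  have e: "(\<Sum>k<D + 1. ((if k = 0 then 1 else 0) + (if k = i then c else 0)) * f k) = f 0 + c * f i"
    if "i < D + 1" for i c and f :: "nat \<Rightarrow> real"
    using sum_unit[of 0 "D + 1" 1 f] sum_unit[OF that, of c f] by (simp add: distrib_right sum.distrib del: sum.lessThan_Suc)
  show "\<bar>y $ i\<bar> \<le> y $ 0" if i: "i < D + 1"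
  proof -
    have "y $ 0 + c * y $ i \<ge> 0" if "\<bar>c\<bar> = 1" for c
    proof -
      have "(\<Sum>k<D + 1. ((if k = 0 then 1 else 0) + (if k = i then c else 0)) * poly (cheb k) z) \<ge> 0"
        if z: "\<bar>z\<bar> \<le> 1" for z
      proof -
        have "\<bar>c * poly (cheb i) z\<bar> \<le> 1" using abs_poly_cheb_le[OF z, of i] \<open>\<bar>c\<bar> = 1\<close> by (simp add: abs_mult)
        thus ?thesis unfolding e[OF i] by simp
      qed
      from dot[OF this] show ?thesis unfolding e[OF i] .
    qed
    from this[of 1] this[of "-1"] show ?thesis by simp
  qed
  show "\<epsilon> * y $ 0 \<le> t \<bullet> y" if t: "t \<in> carrier_vec (D + 1)" "\<And>z. \<bar>z\<bar> \<le> 1 \<Longrightarrow> poly (cheb_poly t) z \<ge> \<epsilon>"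
  proof -
    have s: "(\<Sum>k<D + 1. (t $ k - (if k = 0 then \<epsilon> else 0)) * f k) = (\<Sum>k<D + 1. t $ k * f k) - \<epsilon> * f 0"
      for f :: "nat \<Rightarrow> real"
      using sum_unit[of 0 "D + 1" \<epsilon> f] by (simp add: left_diff_distrib sum_subtractf del: sum.lessThan_Suc)
    have "(\<Sum>k<D + 1. (t $ k - (if k = 0 then \<epsilon> else 0)) * y $ k) \<ge> 0"
      by (rule dot) (use t(2) in \<open>simp only: s poly_cheb_poly[OF t(1)], simp\<close>)
    thus ?thesis unfolding s using yc t(1) by (simp add: scalar_prod_def lessThan_atLeast0)
  qed
qed

text \<open>Lowering the constant coefficient by \<epsilon>/2 stays in the cone and lowers every
  value by \<epsilon>/2.\<close>

lemma interior_Sigma_pos: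
  assumes "t \<in> vec_interior (D + 1) (Sigma_cone D)" "\<bar>z\<bar> \<le> 1"
  shows "poly (cheb_poly t) z > 0"
proof -
  obtain \<epsilon> where t: "t \<in> carrier_vec (D + 1)" and \<epsilon>: "\<epsilon> > 0"
    "\<And>y. y \<in> carrier_vec (D + 1) \<Longrightarrow> linf_norm (y - t) < \<epsilon> \<Longrightarrow> y \<in> Sigma_cone D"
    using assms(1) by (auto simp: vec_interior_def)
  define y where "y = vec (D + 1) (\<lambda>k. t $ k - (if k = 0 then \<epsilon> / 2 else 0))"
  have "linf_norm (y - t) < \<epsilon>"
    unfolding linf_norm_def
  proof (subst Max_less_iff)
    show "\<forall>a\<in>{\<bar>(y - t) $ i\<bar> |i. i < dim_vec (y - t)}. a < \<epsilon>"
      using t \<epsilon>(1) by (auto simp: y_def)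
  qed (use t in auto)
  hence "y \<in> Sigma_cone D" by (intro \<epsilon>(2)) (auto simp: y_def)
  hence "poly (cheb_poly y) z \<ge> 0" using assms(2) by (rule Sigma_nonneg)
  also have "poly (cheb_poly y) z = (\<Sum>k<D + 1. (t $ k - (if k = 0 then \<epsilon> / 2 else 0)) * poly (cheb k) z)"
    by (subst poly_cheb_poly[of _ "D + 1"]) (auto simp: y_def intro!: sum.cong)
  also have "\<dots> = poly (cheb_poly t) z - \<epsilon> / 2"
    using sum_unit[of 0 "D + 1" "\<epsilon> / 2" "\<lambda>k. poly (cheb k) z"] poly_cheb_poly[OF t]
    by (simp add: left_diff_distrib sum_subtractf del: sum.lessThan_Suc)
  finally show ?thesis using \<epsilon>(1) by simp
qed

section \<open>A strictly feasible dual vector\<close>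

lemma cheb_node_bounds:
  assumes "k < n" shows "0 < cheb_node n k" "cheb_node n k < pi"
proof -
  define r where "r = (2 * real k + 1) / (2 * real n)"
  have r: "0 < r" "r < 1" using assms by (auto simp: r_def)
  have "cheb_node n k = pi * r" by (simp add: cheb_node_def r_def)
  thus "0 < cheb_node n k" "cheb_node n k < pi"
    using r mult_strict_left_mono[of r 1 pi] by simp_all
qed

lemma inj_on_cos_cheb_node: "inj_on (\<lambda>j. cos (cheb_node n j)) {..<n}"
proof (rule inj_onI)
  fix i j assume ij: "i \<in> {..<n}" "j \<in> {..<n}" "cos (cheb_node n i) = cos (cheb_node n j)"
  have r: "0 \<le> cheb_node n k" "cheb_node n k \<le> pi" if "k < n" for k
    using cheb_node_bounds[OF that] by simp_all
  have "cheb_node n i = cheb_node n j"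
    using ij r by (metis arccos_cos lessThan_iff)
  thus "i = j" using ij(1) by (auto simp: cheb_node_def)
qed

lemma abs_cos_cheb_node_less: assumes "j < n" shows "\<bar>cos (cheb_node n j)\<bar> < 1"
proof -
  note r = cheb_node_bounds[OF assms]
  have "cos (cheb_node n j) < cos 0" using r by (intro cos_monotone_0_pi) auto
  moreover have "cos pi < cos (cheb_node n j)" using r by (intro cos_monotone_0_pi) auto
  ultimately show ?thesis by simp
qed

text \<open>The functional of the first unit vector is the average over the n Chebyshev nodes. They
  are distinct and interior, so the weight is positive at each, and a nonzero polynomial of degree
  below n cannot vanish at all of them.\<close>

lemma pos_def_unit_vec:
  assumes w: "\<And>z. \<bar>z\<bar> < 1 \<Longrightarrow> poly w z > 0" and m: "m \<le> n"
  shows "pos_def (vell (unit_vec n 0)) w m"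
  unfolding pos_def_def
proof (intro allI impI)
  fix p :: "real poly" assume p: "degree p < m" "p \<noteq> 0"
  have n: "0 < n" using p m by simp
  let ?X = "\<lambda>j. cos (cheb_node n j)"
  have nn: "poly (w * (p * p)) (?X j) \<ge> 0" if "j < n" for j
    using w[OF abs_cos_cheb_node_less[OF that]] by (simp add: less_imp_le)
  have "\<exists>j<n. poly p (?X j) \<noteq> 0"
  proof (rule ccontr)
    assume "\<not> ?thesis"
    hence "?X ` {..<n} \<subseteq> {z. poly p z = 0}" by auto
    hence "card (?X ` {..<n}) \<le> card {z. poly p z = 0}"
      using poly_roots_finite[OF p(2)] by (intro card_mono)
    also have "\<dots> \<le> degree p" using p(2) by (rule card_poly_roots_bound)
    finally show False using p m by (simp add: card_image[OF inj_on_cos_cheb_node])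
  qed
  then obtain j where j: "j < n" "poly p (?X j) \<noteq> 0" by blast
  have "poly (w * (p * p)) (?X j) > 0"
    using w[OF abs_cos_cheb_node_less[OF j(1)]] j(2) by (auto simp: zero_less_mult_iff)
  hence "(\<Sum>j<n. poly (w * (p * p)) (?X j)) > 0"
    using nn j(1) by (intro sum_pos2[of _ j]) auto
  thus "vell (unit_vec n 0) (w * (p * p)) > 0"
    unfolding vell_unit_vec[OF n] using n by (simp add: cheb_coeff_def)
qed

section \<open>The minimum of a positive polynomial with integer coefficients\<close>

fun int_cheb :: "nat \<Rightarrow> int poly" where
  "int_cheb 0 = 1"
| "int_cheb (Suc 0) = [:0, 1:]"
| "int_cheb (Suc (Suc n)) = [:0, 2:] * int_cheb (Suc n) - int_cheb n"

lemma of_int_poly_int_cheb: "map_poly real_of_int (int_cheb k) = cheb k"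
  by (induction k rule: int_cheb.induct)
     (simp_all add: of_int_poly_hom.hom_minus of_int_poly_hom.hom_mult Polynomial.map_poly_pCons
        del: mult_pCons_left)

text \<open>The recurrence gives 2 * 3^(k+1) + 3^k = 7 * 3^k, below 3^(k+2). This exponential
  factor, raised to the power 2 D, contributes the leading part of the term d^2.\<close>

lemma l1_norm_int_cheb: "l1_norm (int_cheb k) \<le> 3 ^ k"
proof (induction k rule: int_cheb.induct)
  case (3 k)
  have "l1_norm (int_cheb (Suc (Suc k))) \<le> l1_norm ([:0, 2:] * int_cheb (Suc k)) + l1_norm (int_cheb k)"
    unfolding int_cheb.simps by (rule l1_norm_diff)
  also have "l1_norm ([:0, 2:] * int_cheb (Suc k)) \<le> l1_norm [:0, 2:] * l1_norm (int_cheb (Suc k))"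
    by (rule l1_norm_mult)
  also have "l1_norm [:0, 2:] = (2 :: int)" by simp
  also have "2 * l1_norm (int_cheb (Suc k)) + l1_norm (int_cheb k) \<le> 3 ^ Suc (Suc k)"
  proof -
    have "(0 :: int) \<le> 3 ^ k" by simp
    with 3 show ?thesis unfolding power_Suc by linarith
  qed
  finally show ?case by simp
qed auto

lemma cheb_poly_min_lower_bound:
  fixes t :: "int vec" and b :: int
  assumes t: "t \<in> carrier_vec (D + 1)" and D: "D \<ge> 1"
    and b: "\<And>i. i < D + 1 \<Longrightarrow> \<bar>t $ i\<bar> \<le> b"
    and pos: "\<And>z. \<bar>z\<bar> \<le> 1 \<Longrightarrow> poly (cheb_poly (map_vec real_of_int t)) z > 0"
    and z: "\<bar>z\<bar> \<le> 1"
  shows "1 \<le> poly (cheb_poly (map_vec real_of_int t)) z * (real D * (real (D + 1) * of_int b * 3 ^ D) + 1) ^ (2 * D)"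
proof -
  define P where "P = (\<Sum>i<D + 1. smult (t $ i) (int_cheb i))"
  define p where "p = cheb_poly (map_vec real_of_int t)"
  have pP: "p = map_poly real_of_int P"
    using t by (simp add: p_def cheb_poly_def P_def of_int_poly_hom.hom_sum of_int_hom.map_poly_hom_smult
      of_int_poly_int_cheb del: sum.lessThan_Suc)
  have l1: "l1_norm P \<le> int (D + 1) * b * 3 ^ D"
  proof -
    have "l1_norm P \<le> (\<Sum>i<D + 1. \<bar>t $ i\<bar> * l1_norm (int_cheb i))"
      unfolding P_def by (rule order_trans[OF l1_norm_sum]) (simp del: sum.lessThan_Suc)
    also have "\<dots> \<le> (\<Sum>i<D + 1. b * 3 ^ D)"
    proof (rule sum_mono)
      fix i assume i: "i \<in> {..<D + 1}"
      have "l1_norm (int_cheb i) \<le> 3 ^ i" by (rule l1_norm_int_cheb)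
      also have "\<dots> \<le> 3 ^ D" using i by (intro power_increasing) auto
      finally show "\<bar>t $ i\<bar> * l1_norm (int_cheb i) \<le> b * 3 ^ D"
        using b[of i] i l1_norm_nonneg[of "int_cheb i"] by (intro mult_mono) auto
    qed
    finally show ?thesis by simp
  qed
  have degP: "degree P \<le> D"
    using degree_cheb_poly[of "map_vec real_of_int t" D] t by (simp flip: p_def add: pP)
  define B where "B = (real D * (real (D + 1) * of_int b * 3 ^ D) + 1) ^ (2 * D)"
  have b0: "b \<ge> 0" using b[of 0] by simp
  have B1: "B \<ge> 1" unfolding B_def using b0 by (intro one_le_power) simp
  have "continuous_on {-1..1} (poly p)" by (intro continuous_at_imp_continuous_on ballI poly_isCont)
  then obtain \<xi> where \<xi>: "\<xi> \<in> {-1..1}" "\<And>x. x \<in> {-1..1} \<Longrightarrow> poly p \<xi> \<le> poly p x"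
    using continuous_attains_inf[of "{-1..1::real}" "poly p"] by auto
  have pos\<xi>: "poly p \<xi> > 0" using pos[of \<xi>] \<xi>(1) by (auto simp: p_def)
  have int_val: "poly p (of_int k) \<in> \<int>" for k
    unfolding pP by (simp add: of_int_hom.poly_map_poly)
  have "1 \<le> poly p \<xi> * B"
  proof (cases "poly p \<xi> \<ge> 1")
    case True
    thus ?thesis using B1 mult_mono[of 1 "poly p \<xi>" 1 B] by simp
  next
    case False
    have ends: "poly p (of_int k) \<ge> 1" if "k \<in> {-1, 1}" for k
    proof -
      have "poly p (of_int k) > 0" using pos[of "of_int k"] that by (auto simp: p_def)
      thus ?thesis using int_val[of k] by (auto elim!: Ints_cases)
    qed
    \<comment> \<open>Values at the end points are positive integers, so a minimum below 1 is
      attained in the open interval.\<close>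
    hence "\<xi> \<noteq> -1" "\<xi> \<noteq> 1" using False ends[of "-1"] ends[of 1] by auto
    hence \<xi>': "-1 < \<xi>" "\<xi> < 1" using \<xi>(1) by auto
    have "poly (pderiv p) \<xi> = 0"
    proof (rule DERIV_local_min)
      show "DERIV (poly p) \<xi> :> poly (pderiv p) \<xi>" by (rule poly_DERIV)
      show "0 < min (\<xi> + 1) (1 - \<xi>)" using \<xi>' by simp
      show "\<forall>y. \<bar>\<xi> - y\<bar> < min (\<xi> + 1) (1 - \<xi>) \<longrightarrow> poly p \<xi> \<le> poly p y"
        using \<xi>(2) by (auto simp: abs_if split: if_splits)
    qed
    moreover have "degree P > 0"
    proof (rule ccontr)
      assume "\<not> degree P > 0"
      hence "degree p = 0" by (simp add: pP)
      then obtain c where "p = [:c:]" by (rule degree_eq_zeroE)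
      thus False using ends[of 1] False by simp
    qed
    ultimately have "1 \<le> poly p \<xi> * of_int ((int (degree P) * l1_norm P + 1) ^ (2 * degree P - 1))"
      using critical_value_lower_bound[of P \<xi>] pos\<xi> False by (simp add: pP)
    also have "\<dots> \<le> poly p \<xi> * B"
    proof (rule mult_left_mono)
      have "(int (degree P) * l1_norm P + 1) ^ (2 * degree P - 1)
          \<le> (int D * (int (D + 1) * b * 3 ^ D) + 1) ^ (2 * degree P - 1)"
        using degP l1 l1_norm_nonneg[of P] by (intro power_mono add_mono mult_mono) auto
      \<comment> \<open>The degree may fall below D; since the base is at least 1, the exponent can
        be raised to one depending on D alone.\<close>
      also have "\<dots> \<le> (int D * (int (D + 1) * b * 3 ^ D) + 1) ^ (2 * D)"
        using degP b0 by (intro power_increasing) auto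
      finally have "real_of_int ((int (degree P) * l1_norm P + 1) ^ (2 * degree P - 1))
          \<le> real_of_int ((int D * (int (D + 1) * b * 3 ^ D) + 1) ^ (2 * D))" by (simp only: of_int_le_iff)
      also have "\<dots> = B" by (simp add: B_def)
      finally show "real_of_int ((int (degree P) * l1_norm P + 1) ^ (2 * degree P - 1)) \<le> B" .
    qed (use pos\<xi> in simp)
    finally show ?thesis .
  qed
  also have "\<dots> \<le> poly p z * B"
    using \<xi>(2)[of z] z B1 by (intro mult_right_mono) (auto simp: abs_le_iff)
  finally show ?thesis by (simp add: p_def B_def)
qed

section \<open>Existence of the gradient certificate\<close>

text \<open>Tychonoff's theorem in \<open>nat \<Rightarrow> real\<close>; one function space serves
  every dimension.\<close>

lemma compact_coordinate_box:
  fixes S :: "nat \<Rightarrow> real set"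
  assumes "\<And>i. compact (S i)" shows "compact {y. \<forall>i. y i \<in> S i}"
proof -
  have "compactin (product_topology (\<lambda>_. euclidean) UNIV) (PiE UNIV S)"
    using assms by (auto simp: compactin_PiE compactin_euclidean_iff)
  moreover have "PiE UNIV S = {y. \<forall>i. y i \<in> S i}" by (auto simp: PiE_def)
  ultimately show ?thesis
    by (simp add: euclidean_product_topology compactin_euclidean_iff)
qed

lemma continuous_on_ell [continuous_intros]: "continuous_on A (\<lambda>y. ell n y p)"
  unfolding ell_def
  by (intro continuous_intros continuous_on_subset[OF continuous_on_product_coordinates]) auto

lemma continuous_on_fdet:
  assumes "\<And>i j. continuous_on A (\<lambda>y. f y i j)"
  shows "continuous_on A (\<lambda>y. fdet m (f y) :: real)"
  unfolding fdet_conv_sum by (intro continuous_intros assms)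

lemma closed_Collect_ball_le:
  assumes "\<And>p. continuous_on UNIV (\<lambda>y. f y p)"
  shows "closed {y. \<forall>p. P p \<longrightarrow> (0 :: real) \<le> f y p}"
proof (intro closed_Collect_all)
  fix p show "closed {y. P p \<longrightarrow> 0 \<le> f y p}"
    using closed_Collect_le[OF continuous_on_const assms, of 0 p] by (cases "P p") auto
qed

lemma psd_max_det:
  assumes D: "D \<ge> 1" and t: "t \<in> carrier_vec (D + 1)" and \<epsilon>: "\<epsilon> > 0"
    and tp: "\<And>z. \<bar>z\<bar> \<le> 1 \<Longrightarrow> poly (cheb_poly t) z \<ge> \<epsilon>"
    and y0: "y0 \<in> carrier_vec (D + 1)" "psd D y0" "t \<bullet> y0 = 1"
  shows "\<exists>y\<in>carrier_vec (D + 1). psd D y \<and> t \<bullet> y = 1 \<and>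
    (\<forall>x\<in>carrier_vec (D + 1). psd D x \<longrightarrow> t \<bullet> x = 1 \<longrightarrow>
      fdet (m1 D) (gram (vell x) (w1 D) e1) * fdet (m2 D) (gram (vell x) (w2 D) e2)
      \<le> fdet (m1 D) (gram (vell y) (w1 D) e1) * fdet (m2 D) (gram (vell y) (w2 D) e2))"
proof -
  let ?n = "D + 1"
  define F where "F y = fdet (m1 D) (gram (ell ?n y) (w1 D) e1) * fdet (m2 D) (gram (ell ?n y) (w2 D) e2)" for y
  \<comment> \<open>The radius comes from \<epsilon> y_0 \<le> t y = 1 and |y_i| \<le> y_0.
    Coordinates beyond D are pinned to 0, which keeps the box compact and matches the extension of
    vectors by zero.\<close>
  define B where "B = {y. \<forall>i. y i \<in> (if i < ?n then {- (1 / \<epsilon>)..1 / \<epsilon>} else {0})}"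
  define K where "K = B \<inter> ({y. \<forall>p. degree p < m1 D \<longrightarrow> 0 \<le> ell ?n y (w1 D * (p * p))}
    \<inter> {y. \<forall>p. degree p < m2 D \<longrightarrow> 0 \<le> ell ?n y (w2 D * (p * p))} \<inter> {y. (\<Sum>i<?n. t $ i * y i) = 1})"
  have "closed {y. (\<Sum>i<?n. t $ i * y i) = 1}"
    by (intro closed_Collect_eq continuous_intros continuous_on_product_coordinates)
  hence "compact K" unfolding K_def B_def
    by (intro compact_Int_closed closed_Int closed_Collect_ball_le continuous_on_ell compact_coordinate_box) auto
  moreover have "continuous_on K F" unfolding F_def gram_def
    by (intro continuous_on_mult continuous_on_fdet continuous_on_ell)
  moreover define ext where "ext y = (\<lambda>i. if i < ?n then y $ i else 0)" for y :: "real vec"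
  have ell_ext: "ell ?n (ext x) = vell x" if "x \<in> carrier_vec ?n" for x
    using that by (intro ext) (auto simp: ext_def intro: ell_cong)
  have extK: "ext x \<in> K" if x: "x \<in> carrier_vec ?n" "psd D x" "t \<bullet> x = 1" for x
  proof -
    note bd = dual_cone_bounds[OF D psd_imp_dual_cone[OF x(1,2)]]
    have "\<epsilon> * x $ 0 \<le> 1" using bd(2)[OF t tp] x(3) by simp
    hence "x $ 0 \<le> 1 / \<epsilon>" using \<epsilon> by (simp add: field_simps)
    hence "\<bar>x $ i\<bar> \<le> 1 / \<epsilon>" if "i < ?n" for i using bd(1)[OF that] by linarith
    hence "ext x \<in> B" by (force simp: B_def ext_def abs_le_iff)
    moreover have "(\<Sum>i<?n. t $ i * ext x i) = 1"
      using x t by (simp add: scalar_prod_def lessThan_atLeast0 ext_def del: sum.op_ivl_Suc)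
    ultimately show ?thesis
      using x(2) by (simp only: K_def Int_iff mem_Collect_eq ell_ext[OF x(1)] psd_def)
  qed
  moreover have "K \<noteq> {}" using extK[OF y0] by blast
  ultimately obtain ys where ys: "ys \<in> K" "\<And>x. x \<in> K \<Longrightarrow> F x \<le> F ys"
    using continuous_attains_sup[of K F] by blast
  define y where "y = vec ?n ys"
  have yc: "y \<in> carrier_vec ?n" by (simp add: y_def)
  have ell_y: "vell y = ell ?n ys" by (rule ext) (auto simp: y_def intro: ell_cong)
  have "psd D y" using ys(1) by (simp only: K_def Int_iff mem_Collect_eq psd_def ell_y) blast
  moreover have "t \<bullet> y = 1"
    using ys(1) t by (simp add: K_def y_def scalar_prod_def lessThan_atLeast0 del: sum.op_ivl_Suc)
  moreover have "fdet (m1 D) (gram (vell x) (w1 D) e1) * fdet (m2 D) (gram (vell x) (w2 D) e2)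
      \<le> fdet (m1 D) (gram (vell y) (w1 D) e1) * fdet (m2 D) (gram (vell y) (w2 D) e2)"
    if x: "x \<in> carrier_vec ?n" "psd D x" "t \<bullet> x = 1" for x
    using ys(2)[OF extK[OF x]] by (simp only: F_def ell_ext[OF x(1)] ell_y)
  ultimately show ?thesis using yc by blast
qed

lemma pos_def_imp_psd:
  assumes "pos_def (vell y) (w1 D) (m1 D)" "pos_def (vell y) (w2 D) (m2 D)"
  shows "psd D y"
proof -
  have "vell y (w * (p * p)) \<ge> 0" if "pos_def (vell y) w m" "degree p < m" for w m p
    using that by (cases "p = 0") (auto simp: pos_def_def poly_functional_0[OF poly_functional_ell] less_imp_le)
  thus ?thesis using assms by (auto simp: psd_def)
qed

lemma pos_def_smult: "c > 0 \<Longrightarrow> pos_def (vell y) w m \<Longrightarrow> pos_def (vell (c \<cdot>\<^sub>v y)) w m"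
  unfolding pos_def_def vell_smult by simp

lemma gram_smult: "gram (vell (h \<cdot>\<^sub>v u)) w f = (\<lambda>a c. h * gram (vell u) w f a c)"
  by (intro ext) (simp only: gram_def vell_smult)

lemma frob_scale: "frob m (\<lambda>a c. h * A a c) = h\<^sup>2 * frob m A"
  by (simp add: frob_def power_mult_distrib sum_distrib_left)

text \<open>At the maximizer the derivative of the determinant vanishes along each u with t u = 0.
  In bases orthonormal at y this derivative is the trace of the Gram matrices of u, so the trace is
  a multiple of t u, and its value at y itself gives the factor D + 1.\<close>

lemma gradient_certificate_exists:
  assumes D: "D \<ge> 1" and t: "t \<in> carrier_vec (D + 1)" and \<epsilon>: "\<epsilon> > 0"
    and tp: "\<And>z. \<bar>z\<bar> \<le> 1 \<Longrightarrow> poly (cheb_poly t) z \<ge> \<epsilon>"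
  obtains y :: "real vec" and g1 g2 where "y \<in> carrier_vec (D + 1)" "onb D y g1 g2"
    "\<And>i. i < D + 1 \<Longrightarrow> \<bar>y $ i\<bar> \<le> 1 / \<epsilon>"
    "\<And>u. u \<in> carrier_vec (D + 1) \<Longrightarrow> real (D + 1) * (u \<bullet> t)
      = (\<Sum>a<m1 D. gram (vell u) (w1 D) g1 a a) + (\<Sum>a<m2 D. gram (vell u) (w2 D) g2 a a)"
proof -
  let ?n = "D + 1"
  define e0 :: "real vec" where "e0 = unit_vec ?n 0"
  have e0: "e0 \<in> carrier_vec ?n" by (simp add: e0_def)
  have pd0: "pos_def (vell e0) (w1 D) (m1 D)" "pos_def (vell e0) (w2 D) (m2 D)"
    unfolding e0_def
    by (rule pos_def_unit_vec; use m1_m2[OF D] in \<open>simp add: poly_weights_pos\<close>)+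
  have "\<epsilon> * e0 $ 0 \<le> t \<bullet> e0"
    using dual_cone_bounds(2)[OF D psd_imp_dual_cone[OF e0 pos_def_imp_psd[OF pd0]] t tp] by simp
  hence te0: "t \<bullet> e0 > 0" using \<epsilon> by (simp add: e0_def)
  define y0 where "y0 = (1 / (t \<bullet> e0)) \<cdot>\<^sub>v e0"
  have y0: "y0 \<in> carrier_vec ?n" using e0 by (simp add: y0_def)
  have pdy0: "pos_def (vell y0) (w1 D) (m1 D)" "pos_def (vell y0) (w2 D) (m2 D)"
    unfolding y0_def by (rule pos_def_smult[OF _ pd0(1)] pos_def_smult[OF _ pd0(2)]; use te0 in simp)+
  have ty0: "t \<bullet> y0 = 1" using t e0 te0 by (simp add: y0_def)
  obtain e1 e2 where "onb D y0 e1 e2" using pos_def_imp_onb[OF pdy0] by blast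
  hence e: "orthonormal (vell y0) (w1 D) (m1 D) e1" "orthonormal (vell y0) (w2 D) (m2 D) e2"
    by (auto simp: onb_def)
  define Fe where "Fe x = fdet (m1 D) (gram (vell x) (w1 D) e1) * fdet (m2 D) (gram (vell x) (w2 D) e2)" for x
  obtain y where y: "y \<in> carrier_vec ?n" "psd D y" "t \<bullet> y = 1"
    and max: "\<And>x. x \<in> carrier_vec ?n \<Longrightarrow> psd D x \<Longrightarrow> t \<bullet> x = 1 \<Longrightarrow> Fe x \<le> Fe y"
    using psd_max_det[OF D t \<epsilon> tp y0 pos_def_imp_psd[OF pdy0] ty0, of e1 e2] unfolding Fe_def by blast
  have fdet1: "fdet m (gram (vell x) w f) = 1" if "orthonormal (vell x) w m f" for x w m f
    using fdet_cong[of m "gram (vell x) w f" "\<lambda>i j. if i = j then 1 else 0"] that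
    by (simp add: orthonormal_def fdet_id)
  have "Fe y0 = 1" unfolding Fe_def fdet1[OF e(1)] fdet1[OF e(2)] by simp
  \<comment> \<open>In bases orthonormal at the feasible point \<open>y0\<close> the objective is 1
    there. So it is nonzero at the maximizer, neither block is singular, and semidefiniteness
    improves to definiteness.\<close>
  hence Fy: "Fe y \<ge> 1" using max[OF y0 pos_def_imp_psd[OF pdy0] ty0] by simp
  have "pos_def (vell y) (w1 D) (m1 D)"
    by (rule pos_semidef_imp_pos_def[OF poly_functional_ell, of _ e1])
       (use e y(2) Fy in \<open>auto simp: orthonormal_def psd_def Fe_def\<close>)
  moreover have "pos_def (vell y) (w2 D) (m2 D)"
    by (rule pos_semidef_imp_pos_def[OF poly_functional_ell, of _ e2])
       (use e y(2) Fy in \<open>auto simp: orthonormal_def psd_def Fe_def\<close>)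
  ultimately obtain g1 g2 where g: "onb D y g1 g2" using pos_def_imp_onb by blast
  hence g1: "orthonormal (vell y) (w1 D) (m1 D) g1" and g2: "orthonormal (vell y) (w2 D) (m2 D) g2"
    by (auto simp: onb_def)
  define Fg where "Fg x = fdet (m1 D) (gram (vell x) (w1 D) g1) * fdet (m2 D) (gram (vell x) (w2 D) g2)" for x
  have dg: "degree (e1 i) < m1 D" if "i < m1 D" for i
    using e(1) that by (simp add: orthonormal_def graded_def)
  have dg2: "degree (e2 i) < m2 D" if "i < m2 D" for i
    using e(2) that by (simp add: orthonormal_def graded_def)
  obtain \<kappa> where \<kappa>: "\<And>x. Fe x = \<kappa> * Fg x"
  proof
    fix x
    show "Fe x = ((fdet (m1 D) (\<lambda>i j. vell y (w1 D * (e1 i * g1 j))))\<^sup>2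
        * (fdet (m2 D) (\<lambda>i j. vell y (w2 D * (e2 i * g2 j))))\<^sup>2) * Fg x"
      unfolding Fe_def Fg_def
      by (subst fdet_gram_change_basis[OF poly_functional_ell g1 poly_functional_ell dg], assumption,
          subst fdet_gram_change_basis[OF poly_functional_ell g2 poly_functional_ell dg2], assumption)
         (simp only: mult_ac)
  qed
  have Fgy: "Fg y = 1" unfolding Fg_def fdet1[OF g1] fdet1[OF g2] by simp
  have "\<kappa> \<ge> 1" using Fy \<kappa>[of y] Fgy by simp
  hence maxg: "Fg x \<le> 1" if "x \<in> carrier_vec ?n" "psd D x" "t \<bullet> x = 1" for x
    using max[OF that] \<kappa>[of x] \<kappa>[of y] Fgy mult_le_cancel_left_pos[of \<kappa> "Fg x" 1] by simp
  define tr where "tr u = (\<Sum>a<m1 D. gram (vell u) (w1 D) g1 a a) + (\<Sum>a<m2 D. gram (vell u) (w2 D) g2 a a)" for u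
  have tangent: "tr u = 0" if u: "u \<in> carrier_vec ?n" "t \<bullet> u = 0" for u
  proof -
    let ?Z = "\<lambda>(_::nat) (_::nat). 0 :: real"
    define A1 where "A1 = gram (vell u) (w1 D) g1"
    define A2 where "A2 = gram (vell u) (w2 D) g2"
    define \<phi> where "\<phi> h = fdet (m1 D) (pencil A1 ?Z h 0) * fdet (m2 D) (pencil A2 ?Z h 0)" for h
    have pen: "fdet m (gram (vell (y + h \<cdot>\<^sub>v u)) w f) = fdet m (pencil (gram (vell u) w f) ?Z h 0)"
      if "orthonormal (vell y) w m f" for w m f h
    proof (rule fdet_cong)
      fix a c assume "a < m" "c < m"
      thus "gram (vell (y + h \<cdot>\<^sub>v u)) w f a c = pencil (gram (vell u) w f) ?Z h 0 a c"
        using that unfolding gram_def pencil_def vell_add[OF y(1) smult_carrier_vec[THEN iffD2, OF u(1)]] vell_smult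
        by (simp add: orthonormal_def gram_def)
    qed
    have \<phi>: "\<phi> h = Fg (y + h \<cdot>\<^sub>v u)" for h
      unfolding \<phi>_def Fg_def pen[OF g1] pen[OF g2] A1_def A2_def ..
    have "(\<phi> has_real_derivative ((\<Sum>i<m1 D. A1 i i) * fdet (m2 D) (pencil A2 ?Z 0 0)
        + (\<Sum>i<m2 D. A2 i i) * fdet (m1 D) (pencil A1 ?Z 0 0))) (at 0)"
      unfolding \<phi>_def by (intro DERIV_mult DERIV_fdet_pencil_0)
    hence der: "(\<phi> has_real_derivative tr u) (at 0)" by (simp add: tr_def A1_def A2_def)
    \<comment> \<open>For |h| < \<delta> both |h| and |h| b are at most 1 for either squared norm b,
      hence h^2 b \<le> 1 and y + h u remains in the Dikin ellipsoid of y.\<close>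
    define \<delta> where "\<delta> = 1 / (frob (m1 D) A1 + frob (m2 D) A2 + 1)"
    have \<delta>: "\<delta> > 0" using frob_nonneg[of "m1 D" A1] frob_nonneg[of "m2 D" A2] by (simp add: \<delta>_def)
    have "\<phi> h \<le> \<phi> 0" if h: "\<bar>0 - h\<bar> < \<delta>" for h
    proof -
      have fr: "h\<^sup>2 * b \<le> 1" if b: "0 \<le> b" "b \<le> frob (m1 D) A1 + frob (m2 D) A2" for b
      proof -
        have "\<bar>h\<bar> * (b + 1) \<le> \<delta> * (frob (m1 D) A1 + frob (m2 D) A2 + 1)"
          using h b by (intro mult_mono) auto
        also have "\<dots> = 1" using b by (simp add: \<delta>_def)
        finally have hb: "\<bar>h\<bar> * b + \<bar>h\<bar> \<le> 1" by (simp add: algebra_simps)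
        moreover have "0 \<le> \<bar>h\<bar> * b" using b by simp
        ultimately have "\<bar>h\<bar> \<le> 1" "\<bar>h\<bar> * b \<le> 1" by linarith+
        hence "\<bar>h\<bar> * (\<bar>h\<bar> * b) \<le> 1 * 1" using b by (intro mult_mono) auto
        thus ?thesis by (simp add: power2_eq_square flip: mult.assoc)
      qed
      have f1: "frob (m1 D) (gram (vell (h \<cdot>\<^sub>v u)) (w1 D) g1) \<le> 1"
        unfolding gram_smult frob_scale A1_def[symmetric]
        using frob_nonneg[of "m2 D" A2] by (intro fr frob_nonneg) simp
      have f2: "frob (m2 D) (gram (vell (h \<cdot>\<^sub>v u)) (w2 D) g2) \<le> 1"
        unfolding gram_smult frob_scale A2_def[symmetric]
        using frob_nonneg[of "m1 D" A1] by (intro fr frob_nonneg) simp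
      have "psd D (y + h \<cdot>\<^sub>v u)"
        using smult_carrier_vec[THEN iffD2, OF u(1)] by (rule psd_perturb[OF y(1) _ g f1 f2])
      moreover have "t \<bullet> (y + h \<cdot>\<^sub>v u) = 1"
        using scalar_prod_add_distrib[OF t y(1) smult_carrier_vec[THEN iffD2, OF u(1)]] t u y(3) by simp
      ultimately have "Fg (y + h \<cdot>\<^sub>v u) \<le> 1" using y(1) u(1) by (intro maxg) auto
      moreover have "\<phi> 0 = 1" by (simp add: \<phi>_def)
      ultimately show ?thesis by (simp add: \<phi>)
    qed
    thus ?thesis using DERIV_local_max[OF der \<delta>] by blast
  qed
  have tr_y: "tr y = real ?n"
  proof -
    have "(\<Sum>a<m. gram (vell y) w f a a) = real m" if "orthonormal (vell y) w m f" for w m f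
      using that by (simp add: orthonormal_def)
    thus ?thesis unfolding tr_def using g1 g2 m1_m2[OF D] by (metis of_nat_add)
  qed
  have grad: "real ?n * (u \<bullet> t) = tr u" if u: "u \<in> carrier_vec ?n" for u
  proof -
    define c where "c = t \<bullet> u"
    \<comment> \<open>Since t y = 1, removing (t u) y leaves a tangent direction.\<close>
    define v where "v = u - c \<cdot>\<^sub>v y"
    have cy: "c \<cdot>\<^sub>v y \<in> carrier_vec ?n" using y by simp
    have v: "v \<in> carrier_vec ?n" using u cy by (simp add: v_def)
    have "t \<bullet> v = 0"
      using scalar_prod_minus_distrib[OF t u cy] t y by (simp add: v_def c_def)
    hence "tr v = 0" using v by (intro tangent)
    moreover have "tr v = tr u - c * tr y"
      unfolding tr_def gram_def v_def vell_diff[OF u cy] vell_smult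
      by (simp add: sum_subtractf sum_distrib_left algebra_simps)
    ultimately show ?thesis using tr_y comm_scalar_prod[OF u t] by (simp add: c_def)
  qed
  have "\<bar>y $ i\<bar> \<le> 1 / \<epsilon>" if "i < ?n" for i
  proof -
    note bd = dual_cone_bounds[OF D psd_imp_dual_cone[OF y(1,2)]]
    have "\<epsilon> * y $ 0 \<le> 1" using bd(2)[OF t tp] y(3) by simp
    hence "y $ 0 \<le> 1 / \<epsilon>" using \<epsilon> by (simp add: field_simps)
    thus ?thesis using bd(1)[OF that] by linarith
  qed
  thus thesis using that[OF y(1) g] grad unfolding tr_def by blast
qed

section \<open>Rounding\<close>

text \<open>Each w g_a^2 is at most S on [-1,1], so |w g_a g_c| \<le> S by the arithmetic-geometric
  mean inequality. The coefficients are then at most 2 S, and n entries of size at most 1/2 give n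
  S.\<close>

lemma abs_gram_le:
  assumes n: "n > 0" and w: "\<And>z. \<bar>z\<bar> \<le> 1 \<Longrightarrow> poly w z \<ge> 0"
    and S: "\<And>z. \<bar>z\<bar> \<le> 1 \<Longrightarrow> (\<Sum>a<m. poly (w * (g a * g a)) z) \<le> S"
    and e: "e \<in> carrier_vec n" "\<And>i. i < n \<Longrightarrow> \<bar>e $ i\<bar> \<le> 1 / 2"
    and ac: "a < m" "c < m"
  shows "\<bar>gram (vell e) w g a c\<bar> \<le> real n * S"
proof -
  have "\<bar>cheb_coeff n i (w * (g a * g c))\<bar> \<le> 2 * S" for i
  proof (rule abs_cheb_coeff_le[OF _ n])
    fix z :: real assume z: "\<bar>z\<bar> \<le> 1"
    have diag: "poly w z * (poly (g b) z)\<^sup>2 \<le> S" if "b < m" for b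
    proof -
      have "poly (w * (g b * g b)) z \<le> (\<Sum>a<m. poly (w * (g a * g a)) z)"
        using that w[OF z] by (intro member_le_sum) auto
      thus ?thesis using S[OF z] by (simp add: power2_eq_square)
    qed
    have "2 * \<bar>poly (g a) z * poly (g c) z\<bar> \<le> (poly (g a) z)\<^sup>2 + (poly (g c) z)\<^sup>2"
      using sum_squares_bound[of "\<bar>poly (g a) z\<bar>" "\<bar>poly (g c) z\<bar>"] by (simp add: abs_mult)
    hence "poly w z * (2 * \<bar>poly (g a) z * poly (g c) z\<bar>) \<le> poly w z * ((poly (g a) z)\<^sup>2 + (poly (g c) z)\<^sup>2)"
      using w[OF z] by (rule mult_left_mono)
    also have "\<dots> \<le> S + S" using diag[OF ac(1)] diag[OF ac(2)] by (simp add: distrib_left)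
    finally show "\<bar>poly (w * (g a * g c)) z\<bar> \<le> S" using w[OF z] by (simp add: abs_mult)
  qed
  note coeff = this
  have "\<bar>gram (vell e) w g a c\<bar> \<le> (\<Sum>i<n. \<bar>e $ i * cheb_coeff n i (w * (g a * g c))\<bar>)"
    using e(1) by (auto simp: gram_def ell_def)
  also have "\<dots> \<le> (\<Sum>i<n. 1 / 2 * (2 * S))"
    unfolding abs_mult using e(2) coeff by (intro sum_mono mult_mono) auto
  finally show ?thesis by simp
qed

lemma frob_le:
  assumes "\<And>i j. i < m \<Longrightarrow> j < m \<Longrightarrow> \<bar>A i j\<bar> \<le> b"
  shows "frob m A \<le> (real m * b)\<^sup>2"
proof -
  have "frob m A \<le> (\<Sum>i<m. \<Sum>j<m. b\<^sup>2)"
    unfolding frob_def using assms by (intro sum_mono) (simp add: abs_le_square_iff[symmetric] order_trans[OF _ abs_ge_self])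
  thus ?thesis by (simp add: power2_eq_square mult_ac)
qed

lemma vell_cheb_vec: "degree p < n \<Longrightarrow> vell (cheb_vec n z) p = poly p z"
proof -
  assume "degree p < n"
  moreover have "vell (cheb_vec n z) p = ell n (\<lambda>i. poly (cheb i) z) p"
    unfolding cheb_vec_def dim_vec by (rule ell_cong) simp
  ultimately show ?thesis using ell_cheb_vec by simp
qed

text \<open>The gradient equation is tested with u = q(z), the evaluation at z. It thus reads as an
  explicit weighted sum of squares for c t.\<close>

lemma gradient_pointwise:
  assumes D: "D \<ge> 1" and t: "t \<in> carrier_vec (D + 1)" and g: "onb D y g1 g2"
    and grad: "\<And>u. u \<in> carrier_vec (D + 1) \<Longrightarrow> c * (u \<bullet> t)
      = (\<Sum>a<m1 D. gram (vell u) (w1 D) g1 a a) + (\<Sum>a<m2 D. gram (vell u) (w2 D) g2 a a)"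
  shows "c * poly (cheb_poly t) z
    = (\<Sum>a<m1 D. poly (w1 D * (g1 a * g1 a)) z) + (\<Sum>a<m2 D. poly (w2 D * (g2 a * g2 a)) z)"
proof -
  have dg: "degree (w * (f a * f a)) < D + 1"
    if "graded (Suc k) f" "degree w + 2 * k < D + 1" "a < Suc k" for w k f a
  proof -
    have "degree (f a) \<le> k" using that by (simp add: graded_def)
    thus ?thesis using that(2) degree_mult_le[of w "f a * f a"] degree_mult_le[of "f a" "f a"] by linarith
  qed
  have gr: "graded (m1 D) g1" "graded (m2 D) g2" using g by (auto simp: onb_def orthonormal_def)
  have "c * poly (cheb_poly t) z = c * (cheb_vec (D + 1) z \<bullet> t)"
    using cheb_vec_scalar_prod[OF t] by simp
  also have "\<dots> = (\<Sum>a<m1 D. gram (vell (cheb_vec (D + 1) z)) (w1 D) g1 a a)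
      + (\<Sum>a<m2 D. gram (vell (cheb_vec (D + 1) z)) (w2 D) g2 a a)"
    by (rule grad) (simp add: cheb_vec_def)
  also have "\<dots> = (\<Sum>a<m1 D. poly (w1 D * (g1 a * g1 a)) z) + (\<Sum>a<m2 D. poly (w2 D * (g2 a * g2 a)) z)"
    unfolding gram_def
    by (intro arg_cong2[of _ _ _ _ "(+)"] sum.cong refl vell_cheb_vec
        dg[OF gr(1) weight_degrees(1)[OF D]] dg[OF gr(2) weight_degrees(2)[OF D]]) auto
  finally show ?thesis .
qed

text \<open>Passing from y to N y divides the orthonormal basis by sqrt N and so the local norm by
  N; this is what makes room for rounding.\<close>

lemma orthonormal_smult:
  assumes "N > 0" and f: "orthonormal (vell y) w m f"
  shows "orthonormal (vell (N \<cdot>\<^sub>v y)) w m (\<lambda>a. smult (1 / sqrt N) (f a))"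
proof -
  have "N * (1 / sqrt N * (1 / sqrt N)) = 1" using assms(1) by (simp add: field_simps)
  moreover have "gram (vell (N \<cdot>\<^sub>v y)) w (\<lambda>a. smult (1 / sqrt N) (f a)) i j
      = N * (1 / sqrt N * (1 / sqrt N)) * gram (vell y) w f i j" for i j
    unfolding gram_def vell_smult by (simp add: ell_smult)
  ultimately show ?thesis using f assms(1) by (simp add: orthonormal_def graded_def)
qed

lemma gram_smult_basis:
  assumes "N > 0"
  shows "gram (vell u) w (\<lambda>a. smult (1 / sqrt N) (f a)) = (\<lambda>i j. 1 / N * gram (vell u) w f i j)"
proof (intro ext)
  fix i j
  have "1 / sqrt N * (1 / sqrt N) = 1 / N" using assms by simp
  thus "gram (vell u) w (\<lambda>a. smult (1 / sqrt N) (f a)) i j = 1 / N * gram (vell u) w f i j"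
    by (simp add: gram_def ell_smult flip: mult.assoc)
qed

text \<open>With n = D + 1 the gradient equation bounds the sums of squares by n T, so the Gram
  entries of the rounding error are at most n^2 T. The blocks have total size n, so the local norm
  at y is at most n^3 T, and at N y it is below 1.\<close>

lemma rounded_dual_certificate:
  assumes D: "D \<ge> 1" and p1: "ordered_basis (d1 D) p1" and p2: "ordered_basis (d2 D) p2"
    and t: "t \<in> Sigma_cone D" and y: "y \<in> carrier_vec (D + 1)" and g: "onb D y g1 g2"
    and grad: "\<And>u. u \<in> carrier_vec (D + 1) \<Longrightarrow> real (D + 1) * (u \<bullet> t)
      = (\<Sum>a<m1 D. gram (vell u) (w1 D) g1 a a) + (\<Sum>a<m2 D. gram (vell u) (w2 D) g2 a a)"
    and T: "\<And>z. \<bar>z\<bar> \<le> 1 \<Longrightarrow> poly (cheb_poly t) z \<le> T"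
    and N: "real (D + 1) ^ 3 * T < N" "0 < N"
    and x: "x \<in> carrier_vec (D + 1)" "\<And>i. i < D + 1 \<Longrightarrow> \<bar>x $ i - N * y $ i\<bar> \<le> 1 / 2"
  shows "dual_certificate D p1 p2 t x"
proof -
  let ?n = "D + 1"
  define h1 where "h1 = (\<lambda>a. smult (1 / sqrt N) (g1 a))"
  define h2 where "h2 = (\<lambda>a. smult (1 / sqrt N) (g2 a))"
  define S where "S = real ?n * T"
  define e where "e = x - N \<cdot>\<^sub>v y"
  have tc: "t \<in> carrier_vec ?n" using t by (simp add: Sigma_cone_def)
  have Ny: "N \<cdot>\<^sub>v y \<in> carrier_vec ?n" using y by simp
  have e: "e \<in> carrier_vec ?n" "\<And>i. i < ?n \<Longrightarrow> \<bar>e $ i\<bar> \<le> 1 / 2"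
    using x y by (auto simp: e_def)
  have T0: "T \<ge> 0" using T[of 0] Sigma_nonneg[OF t, of 0] by simp
  have S0: "S \<ge> 0" using T0 by (simp add: S_def)
  have h: "onb D (N \<cdot>\<^sub>v y) h1 h2"
    using g orthonormal_smult[OF N(2)] unfolding onb_def h1_def h2_def by blast
  have sums: "(\<Sum>a<m1 D. poly (w1 D * (g1 a * g1 a)) z) \<le> S" "(\<Sum>a<m2 D. poly (w2 D * (g2 a * g2 a)) z) \<le> S"
    if z: "\<bar>z\<bar> \<le> 1" for z
  proof -
    have "real ?n * poly (cheb_poly t) z \<le> S" unfolding S_def using T[OF z] by (intro mult_left_mono) auto
    moreover have "(\<Sum>a<m1 D. poly (w1 D * (g1 a * g1 a)) z) \<ge> 0" "(\<Sum>a<m2 D. poly (w2 D * (g2 a * g2 a)) z) \<ge> 0"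
      unfolding poly_mult
      by (intro sum_nonneg mult_nonneg_nonneg zero_le_square poly_weights_nonneg[OF z])+
    ultimately show "(\<Sum>a<m1 D. poly (w1 D * (g1 a * g1 a)) z) \<le> S" "(\<Sum>a<m2 D. poly (w2 D * (g2 a * g2 a)) z) \<le> S"
      using gradient_pointwise[OF D tc g grad, of z] by linarith+
  qed
  have fr1: "frob (m1 D) (gram (vell e) (w1 D) g1) \<le> (real (m1 D) * (real ?n * S))\<^sup>2"
    by (rule frob_le, rule abs_gram_le[OF _ poly_weights_nonneg(1) sums(1) e]) auto
  have fr2: "frob (m2 D) (gram (vell e) (w2 D) g2) \<le> (real (m2 D) * (real ?n * S))\<^sup>2"
    by (rule frob_le, rule abs_gram_le[OF _ poly_weights_nonneg(2) sums(2) e]) auto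
  define b where "b = real ?n * S / N"
  have b: "b \<ge> 0" "real ?n * b < 1"
    using N S0 by (simp_all add: b_def S_def power3_eq_cube mult.assoc)
  have "frob (m1 D) (gram (vell e) (w1 D) h1) + frob (m2 D) (gram (vell e) (w2 D) h2)
      = (1 / N)\<^sup>2 * (frob (m1 D) (gram (vell e) (w1 D) g1) + frob (m2 D) (gram (vell e) (w2 D) g2))"
    unfolding h1_def h2_def gram_smult_basis[OF N(2)] frob_scale by (rule distrib_left[symmetric])
  also have "\<dots> \<le> (1 / N)\<^sup>2 * ((real (m1 D) * (real ?n * S))\<^sup>2 + (real (m2 D) * (real ?n * S))\<^sup>2)"
    using fr1 fr2 by (intro mult_left_mono add_mono) auto
  also have "\<dots> = (real (m1 D) * b)\<^sup>2 + (real (m2 D) * b)\<^sup>2"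
  proof -
    have "(1 / N)\<^sup>2 * ((p * q)\<^sup>2 + (r * q)\<^sup>2) = (p * (q / N))\<^sup>2 + (r * (q / N))\<^sup>2" for p q r
      by (simp add: power_mult_distrib power_divide add_divide_distrib)
    thus ?thesis by (simp only: b_def)
  qed
  \<comment> \<open>The two blocks are merged by p^2 + r^2 \<le> (p + r)^2, so that only their total
    size D + 1 remains.\<close>
  also have "\<dots> \<le> (real (m1 D) * b + real (m2 D) * b)\<^sup>2"
    using b(1) by (simp add: power2_sum)
  also have "real (m1 D) * b + real (m2 D) * b = real ?n * b"
    using m1_m2[OF D] by (metis distrib_right of_nat_add)
  also have "(real ?n * b)\<^sup>2 < 1"
    using b by (intro power_less_one_iff[THEN iffD2]) auto
  finally have near: "frob (m1 D) (gram (vell e) (w1 D) h1) + frob (m2 D) (gram (vell e) (w2 D) h2) < 1" .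
  have "real ?n / N * (u \<bullet> t)
      = (\<Sum>a<m1 D. gram (vell u) (w1 D) h1 a a) + (\<Sum>a<m2 D. gram (vell u) (w2 D) h2 a a)"
    if "u \<in> carrier_vec ?n" for u
  proof -
    have "real ?n / N * (u \<bullet> t) = 1 / N * (real ?n * (u \<bullet> t))" by simp
    also have "\<dots> = (\<Sum>a<m1 D. gram (vell u) (w1 D) h1 a a) + (\<Sum>a<m2 D. gram (vell u) (w2 D) h2 a a)"
      unfolding grad[OF that] h1_def h2_def gram_smult_basis[OF N(2)]
      by (simp only: distrib_left sum_distrib_left)
    finally show ?thesis .
  qed
  from dual_certificate_near_gradient_certificate[OF D p1 p2 t x(1) Ny h _ this near[unfolded e_def]]
  show ?thesis using N(2) by simp
qed

section \<open>Size estimates\<close>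

lemma bit_size_bound:
  assumes "bit_size k \<le> int \<tau>" shows "\<bar>k\<bar> \<le> 2 ^ \<tau>"
proof -
  have "\<lceil>log 2 (\<bar>real_of_int k\<bar> + 1)\<rceil> \<le> int \<tau>" using assms by (simp add: bit_size_def)
  hence "log 2 (\<bar>real_of_int k\<bar> + 1) \<le> real \<tau>" by (simp add: ceiling_le_iff)
  hence "\<bar>real_of_int k\<bar> + 1 \<le> 2 powr real \<tau>"
    by (subst (asm) log_le_iff) auto
  hence "\<bar>real_of_int k\<bar> \<le> 2 ^ \<tau>" by (simp add: powr_realpow)
  thus ?thesis by (metis of_int_abs of_int_le_iff of_int_numeral of_int_power)
qed

lemma linf_norm_le:
  assumes "dim_vec x > 0" "\<And>i. i < dim_vec x \<Longrightarrow> \<bar>x $ i\<bar> \<le> b"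
  shows "linf_norm x \<le> b"
  unfolding linf_norm_def by (rule Max.boundedI) (use assms in auto)

lemma ln_nat_le: "k \<ge> 1 \<Longrightarrow> ln (real k) \<le> real k"
  using ln_le_minus_one[of "real k"] by simp

text \<open>The crude ln k \<le> k is enough for factors polynomial in D, as they are absorbed by
  d^2. The constant is 102 = 2 + 16 + 84, where 84 = 6 * 14 stems from the exponent 2 D \<le> 6
  d.\<close>

lemma ln_size_bound:
  fixes d D \<tau> :: nat
  assumes d: "d \<ge> 1" and D: "D \<in> {2 * d, 2 * d + 1}"
  defines "N \<equiv> real (D + 1) ^ 4 * 2 ^ \<tau> + 1"
    and "B \<equiv> (real D * (real (D + 1) * 2 ^ \<tau> * 3 ^ D) + 1) ^ (2 * D)"
  shows "ln (2 * N * B) \<le> 102 * (real d * real \<tau> + real d ^ 2)"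
proof -
  have D3: "real D \<le> 3 * real d" "real (D + 1) \<le> 4 * real d" "D \<ge> 1" using d D by auto
  have ln2: "ln (2::real) \<le> 1" "ln (2::real) \<ge> 0" using ln_le_minus_one[of "2::real"] by auto
  have ln3: "ln (3::real) \<le> 2" using ln_le_minus_one[of "3::real"] by simp
  have lnD: "ln (real D) \<le> 3 * real d" "ln (real (D + 1)) \<le> 4 * real d"
    using ln_nat_le[of D] ln_nat_le[of "D + 1"] D3 by linarith+
  have \<tau>: "real \<tau> * ln 2 \<le> real \<tau>" using ln2 mult_left_mono[of "ln 2" 1 "real \<tau>"] by simp
  define a where "a = real (D + 1) ^ 4 * 2 ^ \<tau>"
  define c where "c = real D * (real (D + 1) * 2 ^ \<tau> * 3 ^ D)"
  have a1: "a \<ge> 1" unfolding a_def by (intro mult_ge1_I one_le_power) auto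
  have c1: "c \<ge> 1" unfolding c_def using D3(3) by (intro mult_ge1_I one_le_power) auto
  have Na: "N = a + 1" and Bc: "B = (c + 1) ^ (2 * D)" by (simp_all only: N_def B_def a_def c_def)
  have "ln N \<le> ln (2 * a)" using a1 by (intro ln_mono) (auto simp: Na)
  also have "\<dots> = ln 2 + (4 * ln (real (D + 1)) + real \<tau> * ln 2)"
    using a1 by (simp add: a_def ln_mult ln_realpow del: of_nat_Suc of_nat_add)
  also have "\<dots> \<le> 1 + 16 * real d + real \<tau>" using ln2 lnD \<tau> by linarith
  finally have lnN: "ln N \<le> 1 + 16 * real d + real \<tau>" .
  have "ln (c + 1) \<le> ln (2 * c)" using c1 by (intro ln_mono) auto
  also have "\<dots> = ln 2 + (ln (real D) + (ln (real (D + 1)) + real \<tau> * ln 2 + real D * ln 3))"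
    using c1 D3(3) by (simp add: c_def ln_mult ln_realpow del: of_nat_Suc of_nat_add)
  also have "real D * ln 3 \<le> (3 * real d) * 2" using D3 ln3 by (intro mult_mono) auto
  hence "ln 2 + (ln (real D) + (ln (real (D + 1)) + real \<tau> * ln 2 + real D * ln 3))
      \<le> 1 + 13 * real d + real \<tau>" using ln2 lnD \<tau> by linarith
  also have "\<dots> \<le> 14 * real d + real \<tau>" using d by simp
  finally have lnc: "ln (c + 1) \<le> 14 * real d + real \<tau>" .
  have "ln B = real (2 * D) * ln (c + 1)"
    using c1 by (simp add: Bc ln_realpow)
  also have "\<dots> \<le> (6 * real d) * (14 * real d + real \<tau>)"
    using D3 lnc c1 by (intro mult_mono) auto
  finally have lnB: "ln B \<le> 84 * real d ^ 2 + 6 * (real d * real \<tau>)"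
    by (simp add: power2_eq_square algebra_simps)
  have N0: "N > 0" using a1 by (simp add: Na)
  have B0: "B > 0" using c1 by (simp add: Bc)
  have "ln (2 * N * B) = ln 2 + ln N + ln B" using N0 B0 by (simp add: ln_mult)
  also have "\<dots> \<le> 2 + 16 * real d + real \<tau> + 84 * real d ^ 2 + 6 * (real d * real \<tau>)"
    using ln2 lnN lnB by linarith
  also have "\<dots> \<le> 2 * real d ^ 2 + 16 * real d ^ 2 + real d * real \<tau> + 84 * real d ^ 2 + 6 * (real d * real \<tau>)"
  proof -
    have "real d * 1 \<le> real d * real d" using d by (intro mult_left_mono) auto
    moreover have "real d \<ge> 1" using d by simp
    ultimately have "1 \<le> real d ^ 2" "real d \<le> real d ^ 2" unfolding power2_eq_square by linarith+
    moreover have "real \<tau> \<le> real d * real \<tau>" using d mult_right_mono[of 1 "real d" "real \<tau>"] by simp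
    ultimately show ?thesis by linarith
  qed
  also have "\<dots> \<le> 102 * (real d * real \<tau> + real d ^ 2)" by (simp add: distrib_left)
  finally show ?thesis .
qed

theorem corollary3p5:
  shows "\<exists>C>0::real. \<forall>(d::nat) (D::nat) (\<tau>::nat) p1 p2 t.
    d \<ge> 1 \<longrightarrow> D \<in> {2 * d, 2 * d + 1} \<longrightarrow>
    ordered_basis (d1 D) p1 \<longrightarrow> ordered_basis (d2 D) p2 \<longrightarrow>
    t \<in> carrier_vec (D + 1) \<longrightarrow>
    map_vec real_of_int t \<in> vec_interior (D + 1) (Sigma_cone D) \<longrightarrow>
    (\<forall>i<D + 1. bit_size (t $ i) \<le> int \<tau>) \<longrightarrow>
    (\<exists>y\<in>carrier_vec (D + 1).
       map_vec real_of_int y \<in> vec_interior (D + 1) (dual_cone (D + 1) (Sigma_cone D)) \<and>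
       dual_certificate D p1 p2 (map_vec real_of_int t) (map_vec real_of_int y) \<and>
       ln (linf_norm (map_vec real_of_int y)) \<le> C * (real d * real \<tau> + real d ^ 2))"
proof (intro exI[of _ 102] conjI allI impI)
  fix d D \<tau> :: nat and p1 p2 and t :: "int vec"
  assume d: "d \<ge> 1" and D: "D \<in> {2 * d, 2 * d + 1}"
    and p1: "ordered_basis (d1 D) p1" and p2: "ordered_basis (d2 D) p2"
    and t: "t \<in> carrier_vec (D + 1)"
    and int: "map_vec real_of_int t \<in> vec_interior (D + 1) (Sigma_cone D)"
    and bits: "\<forall>i<D + 1. bit_size (t $ i) \<le> int \<tau>"
  let ?n = "D + 1"
  define s where "s = map_vec real_of_int t"
  \<comment> \<open>On [-1,1] the polynomial of t is at most T = (D + 1) 2^\<tau>, and rounding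
    requires N > (D + 1)^3 T; the added 1 makes this strict.\<close>
  define N where "N = real ?n ^ 4 * 2 ^ \<tau> + 1"
  define B where "B = (real D * (real ?n * 2 ^ \<tau> * 3 ^ D) + 1) ^ (2 * D)"
  have D1: "D \<ge> 1" using d D by auto
  have sc: "s \<in> carrier_vec ?n" using t by (simp add: s_def)
  have pos: "poly (cheb_poly s) z > 0" if "\<bar>z\<bar> \<le> 1" for z
    using interior_Sigma_pos[OF int that] by (simp add: s_def)
  have tb: "\<bar>t $ i\<bar> \<le> 2 ^ \<tau>" if "i < ?n" for i
    using bits that by (intro bit_size_bound) simp
  have B1: "B \<ge> 1" unfolding B_def by (intro one_le_power) simp
  have low: "poly (cheb_poly s) z \<ge> 1 / B" if "\<bar>z\<bar> \<le> 1" for z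
  proof -
    have "1 \<le> poly (cheb_poly s) z * B"
      using cheb_poly_min_lower_bound[OF t D1 tb pos[unfolded s_def] that] by (simp add: B_def s_def)
    thus ?thesis using B1 by (simp add: divide_le_eq)
  qed
  have sS: "s \<in> Sigma_cone D"
    by (rule nonneg_imp_Sigma[OF D1 sc]) (use pos in \<open>auto intro!: less_imp_le\<close>)
  have up: "poly (cheb_poly s) z \<le> real ?n * 2 ^ \<tau>" if z: "\<bar>z\<bar> \<le> 1" for z
  proof -
    have "poly (cheb_poly s) z \<le> (\<Sum>i<?n. \<bar>s $ i * poly (cheb i) z\<bar>)"
      unfolding poly_cheb_poly[OF sc] by (intro sum_mono) simp
    also have "\<dots> \<le> (\<Sum>i<?n. 2 ^ \<tau> * 1)"
    proof (rule sum_mono)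
      fix i assume i: "i \<in> {..<?n}"
      have "\<bar>s $ i\<bar> = real_of_int \<bar>t $ i\<bar>" using t i by (simp add: s_def)
      also have "\<dots> \<le> 2 ^ \<tau>" using tb[of i] i by (metis lessThan_iff of_int_le_iff of_int_numeral of_int_power)
      finally show "\<bar>s $ i * poly (cheb i) z\<bar> \<le> 2 ^ \<tau> * 1"
        unfolding abs_mult using abs_poly_cheb_le[OF z] by (intro mult_mono) auto
    qed
    finally show ?thesis by simp
  qed
  have "0 < 1 / B" using B1 by simp
  then obtain y :: "real vec" and g1 g2 where y: "y \<in> carrier_vec ?n" "onb D y g1 g2"
    "\<And>i. i < ?n \<Longrightarrow> \<bar>y $ i\<bar> \<le> 1 / (1 / B)"
    "\<And>u. u \<in> carrier_vec ?n \<Longrightarrow> real ?n * (u \<bullet> s)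
      = (\<Sum>a<m1 D. gram (vell u) (w1 D) g1 a a) + (\<Sum>a<m2 D. gram (vell u) (w2 D) g2 a a)"
    by (rule gradient_certificate_exists[OF D1 sc _ low]) (assumption, rule that)
  define k where "k = vec ?n (\<lambda>i. round (N * y $ i))"
  define x where "x = map_vec real_of_int k"
  have k: "k \<in> carrier_vec ?n" by (simp add: k_def)
  have x: "x \<in> carrier_vec ?n" by (simp add: x_def k_def)
  have xy: "\<bar>x $ i - N * y $ i\<bar> \<le> 1 / 2" if "i < ?n" for i
    using that of_int_round_abs_le[of "N * y $ i"] by (simp add: x_def k_def)
  have N1: "N \<ge> 1" by (simp add: N_def)
  have Nbig: "real ?n ^ 3 * (real ?n * 2 ^ \<tau>) < N"
    by (simp add: N_def power3_eq_cube power4_eq_xxxx mult_ac)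
  have cert: "dual_certificate D p1 p2 s x"
    by (rule rounded_dual_certificate[OF D1 p1 p2 sS y(1,2,4) up Nbig _ x xy]) (use N1 in auto)
  have "\<bar>x $ i\<bar> \<le> 2 * N * B" if i: "i < ?n" for i
  proof -
    \<comment> \<open>The maximizer has entries at most B, and N B \<ge> 1 absorbs the rounding
      error 1/2.\<close>
    have "\<bar>N * y $ i\<bar> \<le> N * B" using N1 y(3)[OF i] by (simp add: abs_mult mult_left_mono)
    moreover have "1 \<le> N * B" using N1 B1 mult_mono[of 1 N 1 B] by simp
    ultimately show ?thesis using xy[OF i] by linarith
  qed
  hence "linf_norm x \<le> 2 * N * B" using x by (intro linf_norm_le) auto
  moreover have "linf_norm x \<ge> 0" using abs_vec_le_linf_norm[of 0 x] x by (auto intro: order_trans)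
  moreover have "2 * N * B \<ge> 1" using N1 B1 mult_mono[of 1 N 1 B] by simp
  ultimately have "ln (linf_norm x) \<le> ln (2 * N * B)"
    \<comment> \<open>The convention \<open>ln 0 = 0\<close> covers a zero norm, because the
      right-hand side is nonnegative.\<close>
    by (cases "linf_norm x = 0") (auto intro: ln_mono)
  also have "\<dots> \<le> 102 * (real d * real \<tau> + real d ^ 2)"
    unfolding N_def B_def by (rule ln_size_bound[OF d D])
  finally have size: "ln (linf_norm x) \<le> 102 * (real d * real \<tau> + real d ^ 2)" .
  show "\<exists>y\<in>carrier_vec ?n.
       map_vec real_of_int y \<in> vec_interior ?n (dual_cone ?n (Sigma_cone D)) \<and>
       dual_certificate D p1 p2 (map_vec real_of_int t) (map_vec real_of_int y) \<and>
       ln (linf_norm (map_vec real_of_int y)) \<le> 102 * (real d * real \<tau> + real d ^ 2)"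
    using cert size k unfolding x_def s_def by (auto simp: dual_certificate_def)
qed simp

end
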